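(* Let $\mathcal A\in\{\mathfrak S,\mathcal B,\mathcal Bs,\mathcal H,\mathcal P\}$. For any integer $N$, let $(M_i^N)_{i\in\mathcal I}$ and $(L_j^N)_{j\in\mathcal J}$ be two families of random matrices of size $N$ ($\mathcal I\cap\mathcal J=\emptyset$). Suppose that each of the two families $(M_i^N)_{i\in\mathcal I}$ and $(L_j^N)_{j\in\mathcal J}$ converges in $\mathcal A$-distribution, and that for any integer $N$, $(L_j^N)_{j\in\mathcal J}$ is $\mathcal G(\mathcal A)$-invariant and the two families $(M_i^N)_{i\in\mathcal I}$ and $(L_j^N)_{j\in\mathcal J}$ are independent. Then the families $(M_i^N)_{i\in\mathcal I}$ and $(L_j^N)_{j\in\mathcal J}$ are asymptotically $\mathcal A$-free.
   Context: Partitions. For $k\ge 0$, $\mathcal P_k$ is the set of partitions of $\{1,\dots,k,1',\dots,k'\}$, drawn with a top row $1,\dots,k$ and a bottom row $1',\dots,k'$. $\mathrm{nc}(p)$ is the number of blocks of $p$; $p\vee p'$ is the finest partition coarser than both; $\mathrm{id}_k=\{\{i,i'\}\}$; the cycles of $p$ are the blocks of $p\vee\mathrm{id}_k$; ${}^tp$ is obtained by exchanging $i$ and $i'$ for every $i$; $p\trianglelefteq p'$ means $p'$ is coarser than $p$; $p\otimes p'$ is obtained by putting $p'$ to the right of $p$. A permutation $\sigma\in\mathfrak S_k$ is identified with $\{\{i,\sigma(i)'\}\}\in\mathcal P_k$. $\mathcal B_k$, $\mathcal H_k$, $\mathcal Bs_k$ are the sets of $p\in\mathcal P_k$ whose blocks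 all have size $2$, all have even size, all have size at most $2$ respectively. Set $d(p,p')=\frac{\mathrm{nc}(p)+\mathrm{nc}(p')}{2}-\mathrm{nc}(p\vee p')$ and $p\le p'$ if $d(\mathrm{id}_k,p)+d(p,p')=d(\mathrm{id}_k,p')$ (a partial order). $E_i^j$ is the $N\times N$ matrix sending $e_j$ to $e_i$ and the other basis vectors to $0$. For $I=(i_1,\dots,i_k,i_{1'},\dots,i_{k'})\in\{1,\dots,N\}^{2k}$, $\mathrm{Ker}(I)\in\mathcal P_k$ is the partition where $a,b$ are in the same block iff $i_a=i_b$; $\rho_N(p)=\sum_{I:\,p\trianglelefteq\mathrm{Ker}(I)}E_{i_{1'}}^{i_1}\otimes\dots\otimes E_{i_{k'}}^{i_k}$. Groups. $\mathcal G(\mathfrak S)(N)=U(N)$, $\mathcal G(\mathcal B)(N)=O(N)$, $\mathcal G(\mathcal H)(N)$ = signed permutation matrices, $\mathcal G(\mathcal Bs)(N)$ = orthogonal matrices whose rows and columns all sum to $1$, $\mathcal G(\mathcal P)(N)$ = permutation matrices. A family of random matrices is $\mathcal G(\mathcal A)$-invariant if for every $g\in\mathcal G(\mathcal A)(N)$ and all indices, $(gL_{j_1}g^{-1},\dots,gL_{j_k}g^{-1})$ has the same law as $(L_{j_1},\dots,L_{j_k})$. Random matrices have entries with finite moments of all orders. $\mathbb Em_p(B_1,\dots,B_k)=N^{-\mathrm{nc}(p\vee\mathrm{id}_k)}\mathbb E\,\mathrm{Tr}[(B_1\otimes\dots\otimes B_k)\rho_N({}^tp)]$. A family $(B^N_t)_{t\in\mathcal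 T}$ converges in $\mathcal A$-distribution if $\mathbb Em_p(B_{t_1}^N,\dots,B^N_{t_k})$ converges as $N\to\infty$ for all $k$, $p\in\mathcal A_k$ and indices; the limit is $\mathbb Em_p(B_{t_1},\dots,B_{t_k})$, and asymptotic $\mathcal A$-cumulants are defined by $\mathbb Em_p(B_{t_1},\dots,B_{t_k})=\sum_{p'\in\mathcal A_k,p'\le p}\mathbb E\kappa_{p'}^{\mathcal A}(B_{t_1},\dots,B_{t_k})$ for all $p\in\mathcal A_k$. Asymptotic $\mathcal A$-freeness: $(M_i^N)_{i\in\mathcal I}$ and $(L_j^N)_{j\in\mathcal J}$ are asymptotically $\mathcal A$-free if the joint family $(M_i^N)_{i\in\mathcal I}\cup(L_j^N)_{j\in\mathcal J}$ converges in $\mathcal A$-distribution and (i) for all $k$, $p\in\mathcal A_k$ and $B_1,\dots,B_k$ taken from the two families, if some cycle of $p$ contains two indices $s,t$ with $B_s$ in the first family and $B_t$ in the second, then $\mathbb E\kappa_p^{\mathcal A}(B_1,\dots,B_k)=0$; (ii) for $p_1\in\mathcal A_{k_1}$, $p_2\in\mathcal A_{k_2}$: $\mathbb E\kappa^{\mathcal A}_{p_1\otimes p_2}(M_{i_1},\dots,M_{i_{k_1}},L_{j_1},\dots,L_{j_{k_2}})=\mathbb E\kappa^{\mathcal A}_{p_1}(M_{i_1},\dots,M_{i_{k_1}})\,\mathbb E\kappa^{\mathcal A}_{p_2}(L_{j_1},\dots,L_{j_{k_2}})$. *)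

theory Defs
  imports
    "HOL-Probability.Probability"
    "Jordan_Normal_Form.Gauss_Jordan_Elimination"
    "Jordan_Normal_Form.Schur_Decomposition"
begin

hide_const (open) Finite_Cartesian_Product.mat

text \<open>
  All indices are 0-based: the rows of a diagram with k columns are 0, ..., k - 1 (top) and
  0', ..., (k - 1)' (bottom), and matrix indices run over 0, ..., N - 1, as in
  \<^theory>\<open>Jordan_Normal_Form.Matrix\<close>.
\<close>

section \<open>Partitions\<close>

datatype point = Top nat | Bot nat

definition points :: "nat \<Rightarrow> point set" where
  "points k = Top ` {..<k} \<union> Bot ` {..<k}"

definition partitions :: "nat \<Rightarrow> point set set set" where
  "partitions k = {p. partition_on (points k) p}"

abbreviation nc :: "point set set \<Rightarrow> nat" where
  "nc p \<equiv> card p"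

text \<open>\<open>coarser k p p'\<close> says that \<open>p'\<close> is coarser than \<open>p\<close>.\<close>

abbreviation coarser :: "nat \<Rightarrow> point set set \<Rightarrow> point set set \<Rightarrow> bool" where
  "coarser k p p' \<equiv> refines (points k) p p'"

definition is_join :: "nat \<Rightarrow> point set set \<Rightarrow> point set set \<Rightarrow> point set set \<Rightarrow> bool" where
  "is_join k p p' q \<longleftrightarrow>
     coarser k p q \<and> coarser k p' q \<and> (\<forall>r. coarser k p r \<and> coarser k p' r \<longrightarrow> coarser k q r)"

definition part_join :: "nat \<Rightarrow> point set set \<Rightarrow> point set set \<Rightarrow> point set set" where
  "part_join k p p' = (THE q. is_join k p p' q)"

definition id_part :: "nat \<Rightarrow> point set set" where
  "id_part k = (\<lambda>i. {Top i, Bot i}) ` {..<k}"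

definition cycles_of :: "nat \<Rightarrow> point set set \<Rightarrow> point set set" where
  "cycles_of k p = part_join k p (id_part k)"

fun flip :: "point \<Rightarrow> point" where
  "flip (Top i) = Bot i"
| "flip (Bot i) = Top i"

definition transp :: "point set set \<Rightarrow> point set set" where
  "transp p = (\<lambda>b. flip ` b) ` p"

fun shift :: "nat \<Rightarrow> point \<Rightarrow> point" where
  "shift k (Top i) = Top (k + i)"
| "shift k (Bot i) = Bot (k + i)"

text \<open>\<open>ptensor k p p'\<close> is \<open>p \<otimes> p'\<close> for \<open>p \<in> partitions k\<close>.\<close>

definition ptensor :: "nat \<Rightarrow> point set set \<Rightarrow> point set set \<Rightarrow> point set set" where
  "ptensor k p p' = p \<union> (\<lambda>b. shift k ` b) ` p'"

definition perm_part :: "nat \<Rightarrow> (nat \<Rightarrow> nat) \<Rightarrow> point set set" where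
  "perm_part k \<sigma> = (\<lambda>i. {Top i, Bot (\<sigma> i)}) ` {..<k}"

datatype kind = kS | kB | kBs | kH | kP

fun parts :: "kind \<Rightarrow> nat \<Rightarrow> point set set set" where
  "parts kS k = {perm_part k \<sigma> | \<sigma>. \<sigma> permutes {..<k}}"
| "parts kB k = {p \<in> partitions k. \<forall>b\<in>p. card b = 2}"
| "parts kBs k = {p \<in> partitions k. \<forall>b\<in>p. card b \<le> 2}"
| "parts kH k = {p \<in> partitions k. \<forall>b\<in>p. even (card b)}"
| "parts kP k = partitions k"

definition pdist :: "nat \<Rightarrow> point set set \<Rightarrow> point set set \<Rightarrow> real" where
  "pdist k p p' = (real (nc p) + real (nc p')) / 2 - real (nc (part_join k p p'))"

definition geo_le :: "nat \<Rightarrow> point set set \<Rightarrow> point set set \<Rightarrow> bool" where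
  "geo_le k p p' \<longleftrightarrow> pdist k (id_part k) p + pdist k p p' = pdist k (id_part k) p'"


section \<open>Tensor products of matrices and the representation of partitions\<close>

definition matrix_unit :: "nat \<Rightarrow> nat \<Rightarrow> nat \<Rightarrow> complex mat" where
  "matrix_unit N i j = Matrix.mat N N (\<lambda>(a, b). if a = i \<and> b = j then 1 else 0)"

definition kron :: "complex mat \<Rightarrow> complex mat \<Rightarrow> complex mat" where
  "kron A B = Matrix.mat (dim_row A * dim_row B) (dim_col A * dim_col B)
     (\<lambda>(i, j). A $$ (i div dim_row B, j div dim_col B) * B $$ (i mod dim_row B, j mod dim_col B))"

definition kron_list :: "complex mat list \<Rightarrow> complex mat" where
  "kron_list As = foldr kron As (1\<^sub>m 1)"

definition tr :: "complex mat \<Rightarrow> complex" where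
  "tr A = (\<Sum>i<dim_row A. A $$ (i, i))"

definition Ker :: "nat \<Rightarrow> (point \<Rightarrow> nat) \<Rightarrow> point set set" where
  "Ker k I = (\<lambda>a. {b \<in> points k. I b = I a}) ` points k"

text \<open>
  The sum of matrices over multi-indices is taken entrywise, since the matrix type has no
  dimension-independent zero.
\<close>

definition rho :: "nat \<Rightarrow> nat \<Rightarrow> point set set \<Rightarrow> complex mat" where
  "rho N k p = Matrix.mat (N ^ k) (N ^ k) (\<lambda>ab.
     \<Sum>I \<in> {I \<in> points k \<rightarrow>\<^sub>E {..<N}. coarser k p (Ker k I)}.
       kron_list (map (\<lambda>l. matrix_unit N (I (Bot l)) (I (Top l))) [0..<k]) $$ ab)"


section \<open>Groups of matrices\<close>

definition unitary_group :: "nat \<Rightarrow> complex mat set" where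
  "unitary_group N = {g \<in> carrier_mat N N. mat_adjoint g * g = 1\<^sub>m N}"

definition orthogonal_group :: "nat \<Rightarrow> complex mat set" where
  "orthogonal_group N = {g \<in> carrier_mat N N.
     (\<forall>i<N. \<forall>j<N. g $$ (i, j) \<in> \<real>) \<and> transpose_mat g * g = 1\<^sub>m N}"

fun matrix_group :: "kind \<Rightarrow> nat \<Rightarrow> complex mat set" where
  "matrix_group kS N = unitary_group N"
| "matrix_group kB N = orthogonal_group N"
| "matrix_group kH N = {Matrix.mat N N (\<lambda>(i, j). if i = \<sigma> j then \<epsilon> j else 0) | \<sigma> \<epsilon>.
     \<sigma> permutes {..<N} \<and> (\<forall>j<N. \<epsilon> j = 1 \<or> \<epsilon> j = -1)}"
| "matrix_group kBs N = {g \<in> orthogonal_group N.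
     (\<forall>i<N. (\<Sum>j<N. g $$ (i, j)) = 1) \<and> (\<forall>j<N. (\<Sum>i<N. g $$ (i, j)) = 1)}"
| "matrix_group kP N = {Matrix.mat N N (\<lambda>(i, j). if i = \<sigma> j then 1 else 0) | \<sigma>.
     \<sigma> permutes {..<N}}"


section \<open>Random matrices\<close>

text \<open>The Borel sigma-algebra of the space of complex N x N matrices.\<close>

definition mat_borel :: "nat \<Rightarrow> complex mat measure" where
  "mat_borel N = vimage_algebra (carrier_mat N N)
     (\<lambda>A. \<lambda>ij \<in> {..<N} \<times> {..<N}. A $$ ij) (PiM ({..<N} \<times> {..<N}) (\<lambda>_. borel))"

definition random_matrix :: "'w measure \<Rightarrow> nat \<Rightarrow> ('w \<Rightarrow> complex mat) \<Rightarrow> bool" where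
  "random_matrix \<Omega> N X \<longleftrightarrow> X \<in> measurable \<Omega> (mat_borel N) \<and>
     (\<forall>i<N. \<forall>j<N. \<forall>n. integrable \<Omega> (\<lambda>\<omega>. cmod (X \<omega> $$ (i, j)) ^ n))"

definition invariant_family ::
    "kind \<Rightarrow> 'w measure \<Rightarrow> nat \<Rightarrow> 'i set \<Rightarrow> ('i \<Rightarrow> 'w \<Rightarrow> complex mat) \<Rightarrow> bool" where
  "invariant_family A \<Omega> N J L \<longleftrightarrow>
     (\<forall>g \<in> matrix_group A N. \<forall>js \<in> lists J.
        distr \<Omega> (PiM {..<length js} (\<lambda>_. mat_borel N))
          (\<lambda>\<omega>. \<lambda>l \<in> {..<length js}. g * L (js ! l) \<omega> * the (mat_inverse g)) =
        distr \<Omega> (PiM {..<length js} (\<lambda>_. mat_borel N))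
          (\<lambda>\<omega>. \<lambda>l \<in> {..<length js}. L (js ! l) \<omega>))"

definition independent_families ::
    "'w measure \<Rightarrow> nat \<Rightarrow> 'i set \<Rightarrow> ('i \<Rightarrow> 'w \<Rightarrow> complex mat) \<Rightarrow>
     'i set \<Rightarrow> ('i \<Rightarrow> 'w \<Rightarrow> complex mat) \<Rightarrow> bool" where
  "independent_families \<Omega> N I M J L \<longleftrightarrow>
     prob_space.indep_var \<Omega>
       (PiM I (\<lambda>_. mat_borel N)) (\<lambda>\<omega>. \<lambda>i \<in> I. M i \<omega>)
       (PiM J (\<lambda>_. mat_borel N)) (\<lambda>\<omega>. \<lambda>j \<in> J. L j \<omega>)"


section \<open>Moments, cumulants and asymptotic freeness\<close>

definition moment :: "'w measure \<Rightarrow> nat \<Rightarrow> point set set \<Rightarrow> ('w \<Rightarrow> complex mat) list \<Rightarrow> complex" where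
  "moment \<Omega> N p Bs =
     (\<integral>\<omega>. tr (kron_list (map (\<lambda>B. B \<omega>) Bs) * rho N (length Bs) (transp p)) \<partial>\<Omega>)
       / of_nat (N ^ nc (cycles_of (length Bs) p))"

abbreviation moment_seq ::
    "(nat \<Rightarrow> 'w measure) \<Rightarrow> (nat \<Rightarrow> 'i \<Rightarrow> 'w \<Rightarrow> complex mat) \<Rightarrow> point set set \<Rightarrow> 'i list \<Rightarrow> nat \<Rightarrow> complex"
  where "moment_seq \<Omega> B p ts N \<equiv> moment (\<Omega> N) N p (map (B N) ts)"

definition converges_in_distribution ::
    "kind \<Rightarrow> (nat \<Rightarrow> 'w measure) \<Rightarrow> 'i set \<Rightarrow> (nat \<Rightarrow> 'i \<Rightarrow> 'w \<Rightarrow> complex mat) \<Rightarrow> bool" where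
  "converges_in_distribution A \<Omega> T B \<longleftrightarrow>
     (\<forall>ts \<in> lists T. \<forall>p \<in> parts A (length ts). convergent (moment_seq \<Omega> B p ts))"

definition limit_moment ::
    "(nat \<Rightarrow> 'w measure) \<Rightarrow> (nat \<Rightarrow> 'i \<Rightarrow> 'w \<Rightarrow> complex mat) \<Rightarrow> point set set \<Rightarrow> 'i list \<Rightarrow> complex" where
  "limit_moment \<Omega> B p ts = lim (moment_seq \<Omega> B p ts)"

text \<open>
  The value outside \<^term>\<open>parts A k\<close> is fixed to 0 only to make the cumulant function unique.
\<close>

definition is_cumulants ::
    "kind \<Rightarrow> nat \<Rightarrow> (point set set \<Rightarrow> complex) \<Rightarrow> (point set set \<Rightarrow> complex) \<Rightarrow> bool" where
  "is_cumulants A k m \<kappa> \<longleftrightarrow>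
     (\<forall>p \<in> parts A k. m p = (\<Sum>p' \<in> {p' \<in> parts A k. geo_le k p' p}. \<kappa> p')) \<and>
     (\<forall>p. p \<notin> parts A k \<longrightarrow> \<kappa> p = 0)"

definition cumulant ::
    "kind \<Rightarrow> (nat \<Rightarrow> 'w measure) \<Rightarrow> (nat \<Rightarrow> 'i \<Rightarrow> 'w \<Rightarrow> complex mat) \<Rightarrow> point set set \<Rightarrow> 'i list \<Rightarrow> complex"
  where "cumulant A \<Omega> B p ts =
    (THE \<kappa>. is_cumulants A (length ts) (\<lambda>q. limit_moment \<Omega> B q ts) \<kappa>) p"

definition joint_family ::
    "'i set \<Rightarrow> (nat \<Rightarrow> 'i \<Rightarrow> 'w \<Rightarrow> complex mat) \<Rightarrow> (nat \<Rightarrow> 'i \<Rightarrow> 'w \<Rightarrow> complex mat) \<Rightarrow>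
     nat \<Rightarrow> 'i \<Rightarrow> 'w \<Rightarrow> complex mat" where
  "joint_family I M L N t = (if t \<in> I then M N t else L N t)"

text \<open>
  The index sets are assumed to be disjoint wherever this is used.  A cycle contains the
  column s iff it contains its top (equivalently bottom) point.
\<close>

definition asymptotically_free ::
    "kind \<Rightarrow> (nat \<Rightarrow> 'w measure) \<Rightarrow> 'i set \<Rightarrow> (nat \<Rightarrow> 'i \<Rightarrow> 'w \<Rightarrow> complex mat) \<Rightarrow>
     'i set \<Rightarrow> (nat \<Rightarrow> 'i \<Rightarrow> 'w \<Rightarrow> complex mat) \<Rightarrow> bool" where
  "asymptotically_free A \<Omega> I M J L \<longleftrightarrow>
     converges_in_distribution A \<Omega> (I \<union> J) (joint_family I M L) \<and>
     (\<forall>ts \<in> lists (I \<union> J). \<forall>p \<in> parts A (length ts).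
        (\<exists>c \<in> cycles_of (length ts) p. \<exists>s<length ts. \<exists>t<length ts.
           Top s \<in> c \<and> Top t \<in> c \<and> ts ! s \<in> I \<and> ts ! t \<in> J) \<longrightarrow>
        cumulant A \<Omega> (joint_family I M L) p ts = 0) \<and>
     (\<forall>is \<in> lists I. \<forall>js \<in> lists J. \<forall>p\<^sub>1 \<in> parts A (length is). \<forall>p\<^sub>2 \<in> parts A (length js).
        cumulant A \<Omega> (joint_family I M L) (ptensor (length is) p\<^sub>1 p\<^sub>2) (is @ js) =
        cumulant A \<Omega> M p\<^sub>1 is * cumulant A \<Omega> L p\<^sub>2 js)"


section \<open>The definite descriptions are well defined\<close>

lemma finite_points [simp]: "finite (points k)"
  by (simp add: points_def)

lemma partition_perm_part:
  assumes "\<sigma> permutes {..<k}"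
  shows "perm_part k \<sigma> \<in> partitions k"
proof -
  have im: "\<sigma> ` {..<k} = {..<k}" using assms by (rule permutes_image)
  have inj: "\<sigma> i = \<sigma> j \<longleftrightarrow> i = j" for i j using permutes_inj[OF assms] by (auto dest: injD)
  have "\<Union> (perm_part k \<sigma>) = Top ` {..<k} \<union> Bot ` (\<sigma> ` {..<k})"
    unfolding perm_part_def by auto
  then show ?thesis
    unfolding partitions_def points_def partition_on_def disjoint_def im
    by (auto simp: perm_part_def inj)
qed

lemma partition_id_part: "id_part k \<in> partitions k"
  using partition_perm_part[OF permutes_id] by (simp add: id_part_def perm_part_def)

lemma parts_subset: "parts A k \<subseteq> partitions k"
proof
  fix p assume "p \<in> parts A k"
  then show "p \<in> partitions k"
  proof (cases A)
    case kS
    then show ?thesis using \<open>p \<in> parts A k\<close> partition_perm_part by fastforce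
  qed simp_all
qed

lemma finite_partitions: "finite (partitions k)"
proof (rule finite_subset)
  show "partitions k \<subseteq> Pow (Pow (points k))"
    unfolding partitions_def partition_on_def by auto
qed simp

lemma ex_is_join:
  assumes "p \<in> partitions k" "p' \<in> partitions k"
  shows "\<exists>!q. is_join k p p' q"
proof (rule ex_ex1I)
  let ?X = "{q. coarser k p q \<and> coarser k p' q}"
  have X: "partition_on (points k) q" if "q \<in> ?X" for q
    using that by (auto simp: refines_def)
  have pX: "(if points k = {} then {} else {points k}) \<in> ?X"
    using assms partition_on_space[of "points k"]
    unfolding partitions_def refines_def partition_on_def by (auto simp: disjoint_def)
  then have ne: "?X \<noteq> {}" by blast
  have "is_join k p p' (common_refinement ?X)"
    unfolding is_join_def
  proof (intro conjI allI impI)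
    show "coarser k p (common_refinement ?X)"
      using assms X ne by (intro common_refinement_coarsest) (auto simp: partitions_def)
    show "coarser k p' (common_refinement ?X)"
      using assms X ne by (intro common_refinement_coarsest) (auto simp: partitions_def)
    show "coarser k (common_refinement ?X) r" if "coarser k p r \<and> coarser k p' r" for r
      using that X by (intro refines_common_refinement) auto
  qed
  then show "\<exists>q. is_join k p p' q" ..
  show "q = r" if "is_join k p p' q" "is_join k p p' r" for q r
    using that unfolding is_join_def by (meson refines_asym)
qed

lemma is_join_join:
  assumes "p \<in> partitions k" "p' \<in> partitions k"
  shows "is_join k p p' (part_join k p p')"
  unfolding part_join_def by (rule theI'[OF ex_is_join[OF assms]])

lemma refines_card:
  assumes "finite X" "refines X p q"
  shows "card q \<le> card p" "card q = card p \<Longrightarrow> q = p"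
proof -
  have P: "partition_on X p" and Q: "partition_on X q"
    and sub: "\<And>b. b \<in> p \<Longrightarrow> \<exists>c\<in>q. b \<subseteq> c"
    using assms(2) by (auto simp: refines_def)
  obtain g where g: "\<And>b. b \<in> p \<Longrightarrow> g b \<in> q \<and> b \<subseteq> g b" using sub by metis
  have fin: "finite p" using P assms(1) by (rule finite_elements[rotated])
  have below: "\<exists>b\<in>p. x \<in> b \<and> g b = c" if "c \<in> q" "x \<in> c" for c x
  proof -
    have "x \<in> X" using that Q by (auto simp: partition_on_def)
    then obtain b where b: "b \<in> p" "x \<in> b" using P by (auto simp: partition_on_def)
    then have "x \<in> g b" "g b \<in> q" using g by auto
    then have "g b = c" using Q that by (auto simp: partition_on_def disjoint_def)
    then show ?thesis using b by auto
  qed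
  have surj: "g ` p = q"
  proof
    show "g ` p \<subseteq> q" using g by auto
    show "q \<subseteq> g ` p"
    proof
      fix c assume c: "c \<in> q"
      then obtain x where "x \<in> c" using Q by (metis all_not_in_conv partition_on_def)
      then show "c \<in> g ` p" using below c by blast
    qed
  qed
  then show "card q \<le> card p" using fin card_image_le by blast
  assume "card q = card p"
  then have inj: "inj_on g p" using surj fin by (auto intro: eq_card_imp_inj_on)
  have "g b = b" if "b \<in> p" for b
  proof
    show "b \<subseteq> g b" using g that by auto
    show "g b \<subseteq> b" using below[of "g b"] g that inj by (metis inj_onD subsetI)
  qed
  then show "q = p" using surj by simp
qed

lemma pdist_pos:
  assumes "p \<in> partitions k" "q \<in> partitions k" "p \<noteq> q"
  shows "pdist k p q > 0"
proof -
  have J: "coarser k p (part_join k p q)" "coarser k q (part_join k p q)"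
    using is_join_join[OF assms(1,2)] by (auto simp: is_join_def)
  note c = refines_card[OF finite_points J(1)] refines_card[OF finite_points J(2)]
  have "card (part_join k p q) < card p \<or> card (part_join k p q) < card q"
    using c assms(3) by (metis le_neq_implies_less)
  then show ?thesis using c by (auto simp: pdist_def)
qed

lemma geo_le_refl:
  assumes p: "p \<in> partitions k"
  shows "geo_le k p p"
proof -
  have P: "coarser k p p" using p unfolding partitions_def by (intro refines_refl) simp
  have "is_join k p p (part_join k p p)" using p p by (rule is_join_join)
  then have "coarser k p (part_join k p p)" "coarser k (part_join k p p) p"
    using P unfolding is_join_def by simp_all
  then have "part_join k p p = p" using refines_asym by metis
  then show ?thesis unfolding geo_le_def pdist_def by simp
qed

lemma ex_triangular_inverse:
  fixes f :: "'a \<Rightarrow> real" and m :: "'a \<Rightarrow> complex"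
  assumes fin: "finite X"
    and refl: "\<And>p. p \<in> X \<Longrightarrow> R p p"
    and less: "\<And>p q. p \<in> X \<Longrightarrow> q \<in> X \<Longrightarrow> R q p \<Longrightarrow> q \<noteq> p \<Longrightarrow> f q < f p"
  shows "\<exists>!\<kappa>. (\<forall>p\<in>X. m p = (\<Sum>q\<in>{q\<in>X. R q p}. \<kappa> q)) \<and> (\<forall>p. p \<notin> X \<longrightarrow> \<kappa> p = 0)"
proof (rule ex_ex1I)
  define r where "r = {(q, p). p \<in> X \<and> q \<in> X \<and> R q p \<and> q \<noteq> p}"
  have wf: "wf r"
  proof (rule finite_acyclic_wf)
    show "finite r" by (rule finite_subset[of _ "X \<times> X"]) (use fin in \<open>auto simp: r_def\<close>)
    show "acyclic r" by (rule acyclicI_order[where f = "\<lambda>p. - f p"]) (auto simp: r_def intro: less)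
  qed
  have split: "(\<Sum>q\<in>{q\<in>X. R q p}. g q) = g p + (\<Sum>q\<in>{q\<in>X. R q p \<and> q \<noteq> p}. g q)"
    if "p \<in> X" for p and g :: "'a \<Rightarrow> complex"
  proof -
    have "{q\<in>X. R q p} = insert p {q\<in>X. R q p \<and> q \<noteq> p}" using that refl by auto
    then show ?thesis using fin by simp
  qed
  define F where "F = (\<lambda>\<kappa> p. if p \<in> X then m p - (\<Sum>q\<in>{q\<in>X. R q p \<and> q \<noteq> p}. \<kappa> q) else (0::complex))"
  define \<kappa> where "\<kappa> = wfrec r F"
  have rec: "\<kappa> p = F \<kappa> p" for p
  proof -
    have "\<kappa> p = F (cut \<kappa> r p) p" unfolding \<kappa>_def by (rule wfrec[OF wf])
    also have "\<dots> = F \<kappa> p" unfolding F_def by (auto intro!: sum.cong simp: cut_apply r_def)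
    finally show ?thesis .
  qed
  have "m p = (\<Sum>q\<in>{q\<in>X. R q p}. \<kappa> q)" if "p \<in> X" for p
  proof -
    have "\<kappa> p = m p - (\<Sum>q\<in>{q\<in>X. R q p \<and> q \<noteq> p}. \<kappa> q)"
      using rec[of p] that unfolding F_def by metis
    then show ?thesis using split[OF that, of \<kappa>] by (metis diff_add_cancel)
  qed
  moreover have "\<kappa> p = 0" if "p \<notin> X" for p
    using rec[of p] that unfolding F_def by metis
  ultimately have "(\<forall>p\<in>X. m p = (\<Sum>q\<in>{q\<in>X. R q p}. \<kappa> q)) \<and> (\<forall>p. p \<notin> X \<longrightarrow> \<kappa> p = 0)"
    by blast
  then show "\<exists>\<kappa>. (\<forall>p\<in>X. m p = (\<Sum>q\<in>{q\<in>X. R q p}. \<kappa> q)) \<and> (\<forall>p. p \<notin> X \<longrightarrow> \<kappa> p = 0)"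
    by (rule exI[of _ \<kappa>])
  fix \<kappa>1 \<kappa>2
  assume k1: "(\<forall>p\<in>X. m p = (\<Sum>q\<in>{q\<in>X. R q p}. \<kappa>1 q)) \<and> (\<forall>p. p \<notin> X \<longrightarrow> \<kappa>1 p = 0)"
    and k2: "(\<forall>p\<in>X. m p = (\<Sum>q\<in>{q\<in>X. R q p}. \<kappa>2 q)) \<and> (\<forall>p. p \<notin> X \<longrightarrow> \<kappa>2 p = 0)"
  have "\<kappa>1 p = \<kappa>2 p" for p
    using wf
  proof (induction p)
    case (less p)
    show ?case
    proof (cases "p \<in> X")
      case True
      have "(\<Sum>q\<in>{q\<in>X. R q p \<and> q \<noteq> p}. \<kappa>1 q) = (\<Sum>q\<in>{q\<in>X. R q p \<and> q \<noteq> p}. \<kappa>2 q)"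
        by (rule sum.cong) (use True less in \<open>auto simp: r_def\<close>)
      then show ?thesis using k1 k2 True split[of p \<kappa>1] split[of p \<kappa>2] by simp
    qed (use k1 k2 in auto)
  qed
  then show "\<kappa>1 = \<kappa>2" by auto
qed

lemma ex1_is_cumulants: "\<exists>!\<kappa>. is_cumulants A k m \<kappa>"
  unfolding is_cumulants_def
proof (rule ex_triangular_inverse[where f = "pdist k (id_part k)"])
  show "finite (parts A k)"
    using parts_subset finite_partitions by (rule finite_subset)
  show "geo_le k p p" if "p \<in> parts A k" for p
    using that parts_subset geo_le_refl by blast
  show "pdist k (id_part k) q < pdist k (id_part k) p"
    if "p \<in> parts A k" "q \<in> parts A k" "geo_le k q p" "q \<noteq> p" for p q
    using that pdist_pos[of q k p] parts_subset[of A k] unfolding geo_le_def by force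
qed

lemma cumulant_sum:
  assumes "p \<in> parts A (length ts)"
  shows "limit_moment \<Omega> B p ts =
    (\<Sum>p' \<in> {p' \<in> parts A (length ts). geo_le (length ts) p' p}. cumulant A \<Omega> B p' ts)"
proof -
  have "is_cumulants A (length ts) (\<lambda>q. limit_moment \<Omega> B q ts) (\<lambda>p. cumulant A \<Omega> B p ts)"
    unfolding cumulant_def by (rule theI'[OF ex1_is_cumulants])
  then show ?thesis using assms unfolding is_cumulants_def by simp
qed

end

theory Submission
  imports Defs
begin

text \<open>
  The expectation of a tensor product of the \<open>L\<^sub>j\<close> is invariant under the group, hence for large \<open>N\<close>
  a combination of the tensors \<open>\<rho>\<^sub>N(p)\<close> with \<open>p \<in> \<A>\<^sub>k\<close>.  This first fundamental theorem has an
  elementary proof when \<open>N > 2k + 1\<close>: an invariant tensor depends only on the kernel of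
  the index, and diagonal matrices together with one reflection of three coordinates express it
  through its values at kernels in \<open>\<A>\<^sub>k\<close>.  Rescaled coefficients are cumulants at finite \<open>N\<close>:
  they give the moments through the matrix with entries \<open>N\<close> to the power minus the defect of the
  triangle inequality, which tends to the incidence matrix of the order, so they converge to
  the asymptotic cumulants.  In a joint moment, the expectation of the \<open>M\<^sub>i\<close> is paired with an
  invariant tensor only, so it may be replaced by a combination of the \<open>\<rho>\<^sub>N(p)\<close> with the same moments.
  The joint moments are then expanded over glued pairs \<open>p\<^sub>1 \<otimes> p\<^sub>2\<close>, where all exponents add up, and
  uniqueness of cumulants gives the theorem.
\<close>

section \<open>Functions constant on blocks\<close>

text \<open>The blocks of a join are never computed. A function is constant on the blocks of
  \<open>part_join k p q\<close> iff it is constant on those of \<open>p\<close> and on those of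
  \<open>q\<close>, so the inequality and the additivity needed for \<open>nc\<close> of joins come
  from counting such functions with two values and comparing powers of 2. No integration over the
  groups occurs either: each reduction of an invariant tensor uses the invariance equation of one
  explicit matrix. Permutation and diagonal matrices are monomial and leave a single term in that
  equation. They cannot remove blocks of size at least 3 in the unitary, orthogonal and bistochastic
  cases; this takes a matrix that mixes coordinates. If P projects m coordinates onto their constant
  vectors, then 2P - 1 is orthogonal with row sums 1, so it lies in all three groups; its entries
  are 2/m off the diagonal and 2/m - 1 on it. For m = 2 this is a mere transposition, hence three
  coordinates.\<close>

definition multi :: "nat \<Rightarrow> nat \<Rightarrow> (point \<Rightarrow> nat) set" where
  "multi k N = points k \<rightarrow>\<^sub>E {..<N}"

definition const_on :: "point set set \<Rightarrow> (point \<Rightarrow> nat) \<Rightarrow> bool" where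
  "const_on p x \<longleftrightarrow> (\<forall>b\<in>p. \<forall>i\<in>b. \<forall>j\<in>b. x i = x j)"

lemma finite_multi [simp]: "finite (multi k N)"
  by (simp add: multi_def finite_PiE)

lemma multi_less: "x \<in> multi k N \<Longrightarrow> i \<in> points k \<Longrightarrow> x i < N"
  by (auto simp: multi_def)

lemma partition_Ker: "partition_on (points k) (Ker k x)"
  by (auto simp: Ker_def partition_on_def disjoint_def)

lemma Ker_in_partitions: "Ker k x \<in> partitions k"
  by (simp add: partitions_def partition_Ker)

lemma coarser_Ker:
  assumes "p \<in> partitions k"
  shows "coarser k p (Ker k x) \<longleftrightarrow> const_on p x"
proof
  assume "coarser k p (Ker k x)"
  then have "\<exists>a. b \<subseteq> {j \<in> points k. x j = x a}" if "b \<in> p" for b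
    using that by (auto simp: refines_def Ker_def)
  then show "const_on p x" unfolding const_on_def by (metis (mono_tags, lifting) mem_Collect_eq subsetD)
next
  assume c: "const_on p x"
  have P: "partition_on (points k) p" using assms by (simp add: partitions_def)
  have "\<exists>c\<in>Ker k x. b \<subseteq> c" if "b \<in> p" for b
  proof -
    have "b \<noteq> {}" using P that by (auto simp: partition_on_def)
    then obtain i where i: "i \<in> b" by blast
    have "b \<subseteq> points k" using P that by (auto simp: partition_on_def)
    moreover have "x j = x i" if "j \<in> b" for j
      using c \<open>b \<in> p\<close> i that unfolding const_on_def by metis
    ultimately have "b \<subseteq> {j \<in> points k. x j = x i}" by auto
    then show ?thesis using i \<open>b \<subseteq> points k\<close> unfolding Ker_def by blast
  qed
  then show "coarser k p (Ker k x)" using P partition_Ker by (simp add: refines_def)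
qed

lemma const_on_part_join:
  assumes "p \<in> partitions k" "q \<in> partitions k"
  shows "const_on (part_join k p q) x \<longleftrightarrow> const_on p x \<and> const_on q x"
proof -
  have J: "is_join k p q (part_join k p q)" using is_join_join[OF assms] .
  then have P: "part_join k p q \<in> partitions k"
    by (auto simp: is_join_def refines_def partitions_def)
  have "coarser k (part_join k p q) (Ker k x) \<longleftrightarrow> coarser k p (Ker k x) \<and> coarser k q (Ker k x)"
    using J unfolding is_join_def by (meson refines_trans)
  then show ?thesis using coarser_Ker P assms by simp
qed

lemma part_join_partitions:
  assumes "p \<in> partitions k" "q \<in> partitions k"
  shows "part_join k p q \<in> partitions k"
  using is_join_join[OF assms] by (auto simp: is_join_def refines_def partitions_def)

lemma finite_partition: "p \<in> partitions k \<Longrightarrow> finite p"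
  using finite_elements[OF finite_points] by (simp add: partitions_def)

lemma block_subset: "p \<in> partitions k \<Longrightarrow> b \<in> p \<Longrightarrow> b \<subseteq> points k"
  by (auto simp: partitions_def partition_on_def)

lemma block_nonempty: "p \<in> partitions k \<Longrightarrow> b \<in> p \<Longrightarrow> b \<noteq> {}"
  by (auto simp: partitions_def partition_on_def)

lemma finite_block: "p \<in> partitions k \<Longrightarrow> b \<in> p \<Longrightarrow> finite b"
  by (rule finite_subset[OF block_subset finite_points])

lemma prod_points_blocks:
  fixes f :: "point \<Rightarrow> 'a :: comm_monoid_mult"
  assumes "p \<in> partitions k"
  shows "(\<Prod>i\<in>points k. f i) = (\<Prod>b\<in>p. \<Prod>i\<in>b. f i)"
proof -
  have "\<Union> p = points k" "disjoint p" using assms by (auto simp: partitions_def partition_on_def)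
  then have "prod f (points k) = prod f (\<Union> p)" by simp
  also have "\<dots> = (prod \<circ> prod) f p"
    by (rule prod.Union_disjoint)
      (use \<open>disjoint p\<close> finite_block[OF assms] in \<open>auto simp: disjoint_def\<close>)
  finally show ?thesis by simp
qed

text \<open>An index constant on the blocks is a free choice of one value per block, so a sum of
  products factors over the blocks. With entries of a group element as factors this reduces
  invariance to single blocks; with constant factors it counts the indices.\<close>

lemma sum_const_on:
  fixes h :: "point \<Rightarrow> nat \<Rightarrow> 'a :: comm_semiring_1"
  assumes p: "p \<in> partitions k"
  shows "(\<Sum>x\<in>{x \<in> multi k N. const_on p x}. \<Prod>i\<in>points k. h i (x i)) =
         (\<Prod>b\<in>p. \<Sum>z<N. \<Prod>i\<in>b. h i z)"
proof -
  have P: "partition_on (points k) p" using p by (simp add: partitions_def)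
  have "\<exists>!b. b \<in> p \<and> i \<in> b" if "i \<in> points k" for i
    using P that by (auto simp: partition_on_def disjoint_def)
  then obtain blk where blk: "\<And>i. i \<in> points k \<Longrightarrow> blk i \<in> p \<and> i \<in> blk i"
    by metis
  have blk_eq: "blk i = b" if "b \<in> p" "i \<in> b" for i b
    using blk[of i] that P by (auto simp: partition_on_def disjoint_def)
  obtain rep where rep: "\<And>b. b \<in> p \<Longrightarrow> rep b \<in> b"
    using block_nonempty[OF p] by (metis all_not_in_conv)
  have sub: "\<And>b. b \<in> p \<Longrightarrow> b \<subseteq> points k" using block_subset[OF p] .
  have "(\<Prod>b\<in>p. \<Sum>z<N. \<Prod>i\<in>b. h i z) = (\<Sum>f\<in>p \<rightarrow>\<^sub>E {..<N}. \<Prod>b\<in>p. \<Prod>i\<in>b. h i (f b))"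
    by (rule prod_sum_PiE) (use finite_partition[OF p] in auto)
  also have "\<dots> = (\<Sum>x\<in>{x \<in> multi k N. const_on p x}. \<Prod>i\<in>points k. h i (x i))"
  proof (rule sum.reindex_bij_witness[where i = "\<lambda>x. \<lambda>b\<in>p. x (rep b)"
        and j = "\<lambda>f. \<lambda>i\<in>points k. f (blk i)"])
    fix f assume f: "f \<in> p \<rightarrow>\<^sub>E {..<N}"
    show "(\<lambda>b\<in>p. (\<lambda>i\<in>points k. f (blk i)) (rep b)) = f"
      using f by (intro ext) (auto simp: blk_eq rep subsetD[OF sub rep] extensional_def PiE_def)
    show "(\<lambda>i\<in>points k. f (blk i)) \<in> {x \<in> multi k N. const_on p x}"
    proof -
      have "(\<lambda>i\<in>points k. f (blk i)) \<in> multi k N" using f blk by (auto simp: multi_def)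
      moreover have "(\<lambda>i\<in>points k. f (blk i)) i = f b" if "b \<in> p" "i \<in> b" for b i
        using that sub[of b] by (auto simp: blk_eq)
      then have "const_on p (\<lambda>i\<in>points k. f (blk i))" by (simp add: const_on_def)
      ultimately show ?thesis by simp
    qed
    have "(\<Prod>i\<in>points k. h i ((\<lambda>i\<in>points k. f (blk i)) i)) =
          (\<Prod>i\<in>points k. h i (f (blk i)))" by (rule prod.cong) auto
    also have "\<dots> = (\<Prod>b\<in>p. \<Prod>i\<in>b. h i (f (blk i)))" by (rule prod_points_blocks[OF p])
    also have "\<dots> = (\<Prod>b\<in>p. \<Prod>i\<in>b. h i (f b))" by (intro prod.cong) (auto simp: blk_eq)
    finally show "(\<Prod>i\<in>points k. h i ((\<lambda>i\<in>points k. f (blk i)) i)) =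
          (\<Prod>b\<in>p. \<Prod>i\<in>b. h i (f b))" .
  next
    fix x assume x: "x \<in> {x \<in> multi k N. const_on p x}"
    show "(\<lambda>b\<in>p. x (rep b)) \<in> p \<rightarrow>\<^sub>E {..<N}"
      using x rep sub by (auto simp: multi_def PiE_iff)
    have "x (rep (blk i)) = x i" if "i \<in> points k" for i
      using x blk[OF that] rep unfolding const_on_def by blast
    then show "(\<lambda>i\<in>points k. (\<lambda>b\<in>p. x (rep b)) (blk i)) = x"
      using x blk by (intro ext) (auto simp: multi_def PiE_def extensional_def)
  qed
  finally show ?thesis by simp
qed

lemma card_const_on:
  assumes "p \<in> partitions k"
  shows "card {x \<in> multi k N. const_on p x} = N ^ nc p"
proof -
  have "card {x \<in> multi k N. const_on p x} =
      (\<Sum>x\<in>{x \<in> multi k N. const_on p x}. \<Prod>i\<in>points k. 1)" by simp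
  also have "\<dots> = (\<Prod>b\<in>p. \<Sum>z<N. \<Prod>i\<in>b. 1)" by (rule sum_const_on[OF assms])
  finally show ?thesis by simp
qed

lemma card_const_on_join:
  assumes "p \<in> partitions k" "q \<in> partitions k"
  shows "card {x \<in> multi k N. const_on p x \<and> const_on q x} = N ^ nc (part_join k p q)"
  using card_const_on[OF part_join_partitions[OF assms], of N]
  by (simp add: const_on_part_join[OF assms])

section \<open>Semimodularity of the block count, hence the triangle inequality of d\<close>

definition add2 :: "nat \<Rightarrow> (point \<Rightarrow> nat) \<Rightarrow> (point \<Rightarrow> nat) \<Rightarrow> point \<Rightarrow> nat" where
  "add2 k x y = (\<lambda>i\<in>points k. (x i + y i) mod 2)"

lemma add2_multi: "add2 k x y \<in> multi k 2"
  by (auto simp: add2_def multi_def)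

lemma const_on_add2:
  assumes "p \<in> partitions k" "const_on p x" "const_on p y"
  shows "const_on p (add2 k x y)"
  unfolding const_on_def
proof (intro ballI)
  fix b i j assume b: "b \<in> p" "i \<in> b" "j \<in> b"
  then have "i \<in> points k" "j \<in> points k" using block_subset[OF assms(1)] by auto
  moreover have "x i = x j" "y i = y j" using assms(2,3) b unfolding const_on_def by blast+
  ultimately show "add2 k x y i = add2 k x y j" by (simp add: add2_def)
qed

lemma add2_cancel:
  assumes "x \<in> multi k 2" "y \<in> multi k 2" "add2 k x z = add2 k y z"
  shows "x = y"
proof
  fix i
  show "x i = y i"
  proof (cases "i \<in> points k")
    case True
    then have "(x i + z i) mod 2 = (y i + z i) mod 2" "x i < 2" "y i < 2"
      using fun_cong[OF assms(3), of i] multi_less[OF assms(1)] multi_less[OF assms(2)]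
      by (simp_all add: add2_def)
    then have "x i = 0 \<or> x i = 1" "y i = 0 \<or> y i = 1" "even (x i) = even (y i)"
      by (auto simp: mod2_eq_if split: if_splits)
    then show ?thesis by auto
  qed (use assms in \<open>auto simp: multi_def PiE_def extensional_def\<close>)
qed

lemma mod2_swap: "(a + b) mod 2 = (c + d) mod 2 \<Longrightarrow> (a + c) mod 2 = (b + d) mod 2" for a :: nat
  by (auto simp: mod2_eq_if split: if_splits)

text \<open>
  The functions to \<open>\<int>/2\<close> that are constant on the blocks of a partition form a group of order
  \<open>2 ^ nc\<close>, and the sum of the groups of \<open>q\<close> and \<open>r\<close> lies in the group of any partition
  that is finer than both.
\<close>

lemma nc_join_semimodular:
  assumes "p \<in> partitions k" "q \<in> partitions k" "r \<in> partitions k"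
  shows "nc (part_join k p q) + nc (part_join k p r) \<le> nc p + nc (part_join k q r)"
proof -
  let ?A = "{x \<in> multi k 2. const_on p x}"
  let ?B = "{x \<in> multi k 2. const_on p x \<and> const_on q x}"
  let ?C = "{x \<in> multi k 2. const_on p x \<and> const_on r x}"
  let ?D = "{x \<in> multi k 2. const_on q x \<and> const_on r x}"
  let ?F = "\<lambda>z. {u \<in> ?B \<times> ?C. add2 k (fst u) (snd u) = z}"
  \<comment> \<open>Relative to a fixed point \<open>(x0, y0)\<close> of a fibre of the addition,
    both components of a point move by the same amount, because \<open>x + y = x0 + y0\<close> gives
    \<open>x + x0 = y + y0\<close> mod 2. The left side is constant on the blocks of
    \<open>q\<close> and the right side on those of \<open>r\<close>, so this shift embeds the fibre
    into \<open>?D\<close>.\<close>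
  have fibre: "card (?F z) \<le> card ?D" for z
  proof (cases "?F z = {}")
    case True
    then show ?thesis by (simp only: card.empty)
  next
    case False
    then obtain x0 y0 where 0: "x0 \<in> ?B" "y0 \<in> ?C" "add2 k x0 y0 = z" by auto
    have swap: "add2 k x x0 = add2 k y y0" if "add2 k x y = z" for x y
    proof
      fix i
      have "add2 k x y i = add2 k x0 y0 i" using that 0 by simp
      then have "i \<in> points k \<Longrightarrow> (x i + x0 i) mod 2 = (y i + y0 i) mod 2"
        unfolding add2_def by (intro mod2_swap[of "x i" "y i" "x0 i" "y0 i"]) simp
      then show "add2 k x x0 i = add2 k y y0 i" by (simp add: add2_def)
    qed
    show ?thesis
    proof (rule card_inj_on_le[where f = "\<lambda>u. add2 k (fst u) x0"])
      show "inj_on (\<lambda>u. add2 k (fst u) x0) (?F z)"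
      proof (rule inj_onI)
        fix u u' assume u: "u \<in> ?F z" "u' \<in> ?F z"
          and eq: "add2 k (fst u) x0 = add2 k (fst u') x0"
        have m: "fst u \<in> multi k 2" "fst u' \<in> multi k 2" "snd u \<in> multi k 2" "snd u' \<in> multi k 2"
          and z: "add2 k (fst u) (snd u) = z" "add2 k (fst u') (snd u') = z"
          using u by (simp_all add: mem_Times_iff)
        have "fst u = fst u'" using m(1,2) eq by (rule add2_cancel)
        moreover have "add2 k (snd u) y0 = add2 k (snd u') y0"
          using swap[OF z(1)] swap[OF z(2)] eq by metis
        with m(3,4) have "snd u = snd u'" by (rule add2_cancel)
        ultimately show "u = u'" by (rule prod_eqI)
      qed
      show "(\<lambda>u. add2 k (fst u) x0) ` ?F z \<subseteq> ?D"
      proof clarify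
        fix x y assume xy: "x \<in> multi k 2" "const_on p x" "const_on q x" "y \<in> multi k 2"
          "const_on p y" "const_on r y" and z: "z = add2 k (fst (x, y)) (snd (x, y))"
        have "const_on q (add2 k x x0)" using xy 0 by (intro const_on_add2 assms) auto
        moreover have "const_on r (add2 k y y0)" using xy 0 by (intro const_on_add2 assms) auto
        ultimately show "add2 k (fst (x, y)) x0 \<in> multi k 2 \<and> const_on q (add2 k (fst (x, y)) x0) \<and>
            const_on r (add2 k (fst (x, y)) x0)"
          using swap[of x y] z add2_multi by simp
      qed
    qed simp
  qed
  have "card (?B \<times> ?C) = card (\<Union>z\<in>?A. ?F z)"
  proof (rule arg_cong[where f = card], intro equalityI subsetI)
    fix u assume u: "u \<in> ?B \<times> ?C"
    then have "add2 k (fst u) (snd u) \<in> ?A"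
      using add2_multi const_on_add2[OF assms(1)] by auto
    then show "u \<in> (\<Union>z\<in>?A. ?F z)" using u by blast
  qed auto
  also have "\<dots> \<le> (\<Sum>z\<in>?A. card (?F z))" by (rule card_UN_le) simp
  also have "\<dots> \<le> card ?A * card ?D" using sum_bounded_above[of ?A, OF fibre] by simp
  finally have "card ?B * card ?C \<le> card ?A * card ?D" by (simp only: card_cartesian_product)
  then have "(2::nat) ^ (nc (part_join k p q) + nc (part_join k p r)) \<le>
      2 ^ (nc p + nc (part_join k q r))"
    using card_const_on_join[OF assms(1,2), of 2] card_const_on_join[OF assms(1,3), of 2]
      card_const_on_join[OF assms(2,3), of 2] card_const_on[OF assms(1), of 2]
    by (simp only: power_add)
  then show ?thesis by (rule power_le_imp_le_exp[rotated]) simp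
qed

section \<open>The five sets of partitions, described block by block\<close>

fun block_ok :: "kind \<Rightarrow> point set \<Rightarrow> bool" where
  "block_ok kS b \<longleftrightarrow> (\<exists>i j. b = {Top i, Bot j})"
| "block_ok kB b \<longleftrightarrow> card b = 2"
| "block_ok kBs b \<longleftrightarrow> card b \<le> 2"
| "block_ok kH b \<longleftrightarrow> even (card b)"
| "block_ok kP b \<longleftrightarrow> True"

text \<open>A partition into pairs of a top and a bottom point is the graph of a map on columns, and
  disjointness of the blocks makes this map injective. Being a permutation thereby becomes a
  condition on single blocks, as for the other four kinds.\<close>

lemma perm_part_blocks:
  "{perm_part k \<sigma> | \<sigma>. \<sigma> permutes {..<k}} = {p \<in> partitions k. \<forall>b\<in>p. \<exists>i j. b = {Top i, Bot j}}"
proof (intro equalityI subsetI)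
  fix p assume "p \<in> {perm_part k \<sigma> | \<sigma>. \<sigma> permutes {..<k}}"
  then obtain \<sigma> where "p = perm_part k \<sigma>" "\<sigma> permutes {..<k}" by auto
  then show "p \<in> {p \<in> partitions k. \<forall>b\<in>p. \<exists>i j. b = {Top i, Bot j}}"
    using partition_perm_part[of \<sigma> k] by (auto simp: perm_part_def)
next
  fix p assume "p \<in> {p \<in> partitions k. \<forall>b\<in>p. \<exists>i j. b = {Top i, Bot j}}"
  then have p: "p \<in> partitions k" and b: "\<And>b. b \<in> p \<Longrightarrow> \<exists>i j. b = {Top i, Bot j}" by auto
  have U: "\<Union>p = points k" and disj: "\<And>b c. b \<in> p \<Longrightarrow> c \<in> p \<Longrightarrow> b \<inter> c \<noteq> {} \<Longrightarrow> b = c"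
    using p by (auto simp: partitions_def partition_on_def disjoint_def)
  have "\<exists>j. {Top i, Bot j} \<in> p" if "i < k" for i
  proof -
    have "Top i \<in> \<Union>p" using that U by (simp add: points_def)
    then obtain c where c: "c \<in> p" "Top i \<in> c" by blast
    then obtain i' j where "c = {Top i', Bot j}" using b by blast
    then show ?thesis using c by auto
  qed
  then obtain s where s: "\<And>i. i < k \<Longrightarrow> {Top i, Bot (s i)} \<in> p" by metis
  have sk: "s i < k" if "i < k" for i
  proof -
    have "Bot (s i) \<in> points k" using s[OF that] U by blast
    then show ?thesis by (auto simp: points_def)
  qed
  have inj: "inj_on s {..<k}"
  proof (rule inj_onI)
    fix i j assume ij: "i \<in> {..<k}" "j \<in> {..<k}" "s i = s j"
    then have "{Top i, Bot (s i)} = {Top j, Bot (s j)}"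
      using s[of i] s[of j] by (intro disj) auto
    then show "i = j" by (auto simp: doubleton_eq_iff)
  qed
  \<comment> \<open>\<open>permutes\<close> requires the identity outside the set, whereas
    \<open>s\<close> is arbitrary there.\<close>
  define \<sigma> where "\<sigma> i = (if i < k then s i else i)" for i
  have "bij_betw s {..<k} {..<k}"
    using inj sk endo_inj_surj[of "{..<k}" s] by (auto simp: bij_betw_def)
  then have "bij_betw \<sigma> {..<k} {..<k}"
    by (rule bij_betw_cong[THEN iffD1, rotated]) (simp add: \<sigma>_def)
  then have perm: "\<sigma> permutes {..<k}" by (rule bij_imp_permutes) (simp add: \<sigma>_def)
  have "p = perm_part k \<sigma>"
  proof
    show "perm_part k \<sigma> \<subseteq> p" using s by (auto simp: perm_part_def \<sigma>_def)
    show "p \<subseteq> perm_part k \<sigma>"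
    proof
      fix c assume c: "c \<in> p"
      then obtain i j where ij: "c = {Top i, Bot j}" using b by blast
      then have "Top i \<in> points k" using c U by blast
      then have "i < k" by (auto simp: points_def)
      then have "c = {Top i, Bot (s i)}" using s c ij by (intro disj) auto
      then show "c \<in> perm_part k \<sigma>" using \<open>i < k\<close> by (auto simp: perm_part_def \<sigma>_def)
    qed
  qed
  then show "p \<in> {perm_part k \<sigma> | \<sigma>. \<sigma> permutes {..<k}}" using perm by blast
qed

lemma parts_iff: "p \<in> parts A k \<longleftrightarrow> p \<in> partitions k \<and> (\<forall>b\<in>p. block_ok A b)"
proof (cases A)
  case kS
  then show ?thesis using perm_part_blocks[of k] by (simp add: set_eq_iff)
qed auto

lemma finite_parts [simp]: "finite (parts A k)"
  using finite_subset[OF parts_subset finite_partitions] .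

section \<open>The groups\<close>

lemma mat_adjoint_index [simp]:
  assumes "g \<in> carrier_mat N N" "a < N" "b < N"
  shows "mat_adjoint g $$ (a, b) = cnj (g $$ (b, a) :: complex)"
  using assms by (simp add: mat_adjoint_def mat_of_rows_index)

lemma mat_adjoint_carrier: "g \<in> carrier_mat N N \<Longrightarrow> mat_adjoint g \<in> carrier_mat N N"
  using carrier_matD[of g N N] by (intro carrier_matI) (simp_all add: mat_adjoint_def)

lemma unitary_group_iff:
  "g \<in> unitary_group N \<longleftrightarrow> g \<in> carrier_mat N N \<and>
     (\<forall>a<N. \<forall>b<N. (\<Sum>z<N. cnj (g $$ (z, a)) * g $$ (z, b)) = of_bool (a = b))"
proof -
  have "mat_adjoint g * g = 1\<^sub>m N \<longleftrightarrow>
      (\<forall>a<N. \<forall>b<N. (\<Sum>z<N. cnj (g $$ (z, a)) * g $$ (z, b)) = of_bool (a = b))"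
    if g: "g \<in> carrier_mat N N"
  proof -
    have dims: "dim_row (mat_adjoint g * g) = N" "dim_col (mat_adjoint g * g) = N"
      using g mat_adjoint_carrier[OF g] by auto
    have "(mat_adjoint g * g) $$ (a, b) = (\<Sum>z<N. cnj (g $$ (z, a)) * g $$ (z, b))"
      if "a < N" "b < N" for a b
      using g that mat_adjoint_carrier[OF g] 
      by (auto simp: scalar_prod_def atLeast0LessThan intro!: sum.cong)
    then show ?thesis using dims by (auto simp: mat_eq_iff of_bool_def)
  qed
  then show ?thesis by (auto simp: unitary_group_def)
qed

lemma unitary_group_rows:
  assumes "g \<in> unitary_group N" "a < N" "b < N"
  shows "(\<Sum>z<N. g $$ (a, z) * cnj (g $$ (b, z))) = of_bool (a = b)"
proof -
  have g: "g \<in> carrier_mat N N" "mat_adjoint g * g = 1\<^sub>m N"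
    using assms(1) by (auto simp: unitary_group_def)
  then have "g * mat_adjoint g = 1\<^sub>m N"
    using mat_mult_left_right_inverse[OF mat_adjoint_carrier[OF g(1)] g(1)] by simp
  then have "(g * mat_adjoint g) $$ (a, b) = of_bool (a = b)" using assms by simp
  moreover have "(g * mat_adjoint g) $$ (a, b) = (\<Sum>z<N. g $$ (a, z) * cnj (g $$ (b, z)))"
    using g assms mat_adjoint_carrier[OF g(1)]
    by (auto simp: scalar_prod_def atLeast0LessThan intro!: sum.cong)
  ultimately show ?thesis by simp
qed

text \<open>\<open>mat_inverse\<close> returns an option. The adjoint is a two-sided inverse, which
  excludes \<open>None\<close> and determines the value. Conjugation in the definition of invariance
  thus becomes polynomial in the entries of \<open>g\<close> and their conjugates.\<close>

lemma mat_inverse_unitary: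
  assumes "g \<in> unitary_group N"
  shows "the (mat_inverse g) = mat_adjoint g"
proof -
  have g: "g \<in> carrier_mat N N" "mat_adjoint g * g = 1\<^sub>m N"
    using assms by (auto simp: unitary_group_def)
  have r: "g * mat_adjoint g = 1\<^sub>m N"
    using mat_mult_left_right_inverse[OF mat_adjoint_carrier[OF g(1)] g(1) g(2)] .
  show ?thesis
  proof (cases "mat_inverse g")
    case None
    then have "g \<notin> Units (ring_mat TYPE(complex) N ())" by (rule mat_inverse(1)[OF g(1)])
    then show ?thesis using g r mat_adjoint_carrier[OF g(1)]
      by (auto simp: Units_def ring_mat_def)
  next
    case (Some B)
    then have B: "g * B = 1\<^sub>m N" "B \<in> carrier_mat N N" using mat_inverse(2)[OF g(1)] by auto
    have "B = (mat_adjoint g * g) * B" using g B by simp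
    also have "\<dots> = mat_adjoint g * (g * B)"
      using g(1) B(2) mat_adjoint_carrier[OF g(1)] by (intro assoc_mult_mat)
    also have "\<dots> = mat_adjoint g" using B mat_adjoint_carrier[OF g(1)] by simp
    finally show ?thesis using Some by simp
  qed
qed

lemma orthogonal_group_columns:
  assumes "g \<in> orthogonal_group N" "a < N" "b < N"
  shows "(\<Sum>z<N. g $$ (z, a) * g $$ (z, b)) = of_bool (a = b)"
proof -
  have g: "g \<in> carrier_mat N N" "transpose_mat g * g = 1\<^sub>m N"
    using assms(1) by (auto simp: orthogonal_group_def)
  have "(transpose_mat g * g) $$ (a, b) = (\<Sum>z<N. g $$ (z, a) * g $$ (z, b))"
    using g(1) assms by (auto simp: scalar_prod_def atLeast0LessThan intro!: sum.cong)
  then have "(\<Sum>z<N. g $$ (z, a) * g $$ (z, b)) = (1\<^sub>m N) $$ (a, b)"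
    using g(2) by simp
  then show ?thesis using assms by simp
qed

lemma orthogonal_groupI:
  assumes "g \<in> carrier_mat N N" "\<And>i j. i < N \<Longrightarrow> j < N \<Longrightarrow> g $$ (i, j) \<in> \<real>"
    and "\<And>a b. a < N \<Longrightarrow> b < N \<Longrightarrow> (\<Sum>z<N. g $$ (z, a) * g $$ (z, b)) = of_bool (a = b)"
  shows "g \<in> orthogonal_group N"
proof -
  have "(transpose_mat g * g) $$ (a, b) = (\<Sum>z<N. g $$ (z, a) * g $$ (z, b))"
    if "a < N" "b < N" for a b
    using assms(1) that by (auto simp: scalar_prod_def atLeast0LessThan intro!: sum.cong)
  then have "transpose_mat g * g = 1\<^sub>m N"
    using assms(1,3) by (intro eq_matI) auto
  then show ?thesis using assms by (auto simp: orthogonal_group_def)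
qed

lemma orthogonal_subset_unitary: "orthogonal_group N \<subseteq> unitary_group N"
proof
  fix g assume g: "g \<in> orthogonal_group N"
  have "(\<Sum>z<N. cnj (g $$ (z, a)) * g $$ (z, b)) = of_bool (a = b)" if "a < N" "b < N" for a b
  proof -
    have "(\<Sum>z<N. cnj (g $$ (z, a)) * g $$ (z, b)) = (\<Sum>z<N. g $$ (z, a) * g $$ (z, b))"
      using g that by (intro sum.cong) (auto simp: orthogonal_group_def Reals_cnj_iff)
    then show ?thesis using orthogonal_group_columns[OF g that] by simp
  qed
  then show "g \<in> unitary_group N" using g by (auto simp: unitary_group_iff orthogonal_group_def)
qed

lemma permutes_eq_iff: "\<sigma> permutes S \<Longrightarrow> \<sigma> i = \<sigma> j \<longleftrightarrow> i = j"
  by (metis permutes_inj injD)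

lemma signed_permutation_orthogonal:
  assumes "\<sigma> permutes {..<N}" "\<And>j. j < N \<Longrightarrow> \<epsilon> j = 1 \<or> \<epsilon> j = -1"
  shows "Matrix.mat N N (\<lambda>(i, j). if i = \<sigma> j then \<epsilon> j else 0) \<in> orthogonal_group N"
proof (rule orthogonal_groupI)
  let ?g = "Matrix.mat N N (\<lambda>(i, j). if i = \<sigma> j then \<epsilon> j else 0) :: complex mat"
  fix a b assume ab: "a < N" "b < N"
  have \<sigma>: "\<sigma> a < N" "\<sigma> b < N" using ab permutes_in_image[OF assms(1)] by auto
  have "(\<Sum>z<N. ?g $$ (z, a) * ?g $$ (z, b)) =
      (\<Sum>z<N. if z = \<sigma> a then (if a = b then \<epsilon> a * \<epsilon> a else 0) else 0)"
    using ab permutes_eq_iff[OF assms(1)] by (intro sum.cong) auto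
  also have "\<dots> = (if a = b then \<epsilon> a * \<epsilon> a else 0)" using \<sigma> by simp
  also have "\<dots> = of_bool (a = b)" using assms(2)[OF ab(1)] by auto
  finally show "(\<Sum>z<N. ?g $$ (z, a) * ?g $$ (z, b)) = of_bool (a = b)" .
qed (use assms(2) in \<open>auto, metis Reals_1 Reals_minus\<close>)

lemma matrix_group_subset_unitary: "matrix_group A N \<subseteq> unitary_group N"
proof (cases A)
  case kH
  show ?thesis
  proof
    fix g assume "g \<in> matrix_group A N"
    then obtain \<sigma> \<epsilon> where "g = Matrix.mat N N (\<lambda>(i, j). if i = \<sigma> j then \<epsilon> j else 0)"
      "\<sigma> permutes {..<N}" "\<And>j. j < N \<Longrightarrow> \<epsilon> j = 1 \<or> \<epsilon> j = -1"
      using kH by auto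
    then show "g \<in> unitary_group N"
      using signed_permutation_orthogonal[of \<sigma> N \<epsilon>] orthogonal_subset_unitary by blast
  qed
next
  case kP
  have "Matrix.mat N N (\<lambda>(i, j). if i = \<sigma> j then 1 else 0 :: complex) \<in> unitary_group N"
    if "\<sigma> permutes {..<N}" for \<sigma>
    using signed_permutation_orthogonal[OF that, of "\<lambda>_. 1"] orthogonal_subset_unitary by auto
  then show ?thesis using kP by auto
qed (use orthogonal_subset_unitary in auto)

text \<open>
  The matrix \<open>g B g\<^sup>*\<close> transforms by \<open>g\<close> in its row index, carried by a bottom point, and by the
  conjugate of \<open>g\<close> in its column index, carried by a top point.
\<close>

definition twist :: "complex mat \<Rightarrow> point \<Rightarrow> nat \<Rightarrow> nat \<Rightarrow> complex" where
  "twist g i a b = (case i of Top _ \<Rightarrow> cnj (g $$ (a, b)) | Bot _ \<Rightarrow> g $$ (a, b))"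

definition tensor_act :: "nat \<Rightarrow> complex mat \<Rightarrow> (point \<Rightarrow> nat) \<Rightarrow> (point \<Rightarrow> nat) \<Rightarrow> complex" where
  "tensor_act k g x y = (\<Prod>i\<in>points k. twist g i (x i) (y i))"

definition invariant_tensor :: "kind \<Rightarrow> nat \<Rightarrow> nat \<Rightarrow> ((point \<Rightarrow> nat) \<Rightarrow> complex) \<Rightarrow> bool" where
  "invariant_tensor A k N T \<longleftrightarrow> (\<forall>g\<in>matrix_group A N. \<forall>x\<in>multi k N.
     T x = (\<Sum>y\<in>multi k N. tensor_act k g x y * T y))"

definition ind :: "point set set \<Rightarrow> (point \<Rightarrow> nat) \<Rightarrow> complex" where
  "ind p x = of_bool (const_on p x)"

lemma twist_Reals:
  "g $$ (a, b) \<in> \<real> \<Longrightarrow> twist g i a b = g $$ (a, b)"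
  by (auto simp: twist_def Reals_cnj_iff split: point.split)

text \<open>A real matrix acts alike on top and bottom points, so a pair in any position yields the
  inner product of two rows.\<close>

lemma block_sum_two:
  assumes g: "g \<in> orthogonal_group N" and b: "card b = 2" and x: "\<And>i. i \<in> b \<Longrightarrow> x i < N"
  shows "(\<Sum>z<N. \<Prod>i\<in>b. twist g i (x i) z) = of_bool (\<forall>i\<in>b. \<forall>j\<in>b. x i = x j)"
proof -
  obtain i j where ij: "b = {i, j}" "i \<noteq> j" using b by (auto simp: card_2_iff)
  have "(\<Sum>z<N. \<Prod>i\<in>b. twist g i (x i) z) = (\<Sum>z<N. g $$ (x i, z) * cnj (g $$ (x j, z)))"
    using g x ij by (intro sum.cong) (auto simp: orthogonal_group_def twist_Reals Reals_cnj_iff)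
  also have "\<dots> = of_bool (x i = x j)"
    using g x ij orthogonal_subset_unitary by (intro unitary_group_rows) auto
  also have "(x i = x j) = (\<forall>i\<in>b. \<forall>j\<in>b. x i = x j)"
    by (simp add: ij(1) eq_commute)
  finally show ?thesis .
qed

text \<open>Only a \<open>z\<close> whose image under \<open>\<sigma>\<close> equals every value of
  \<open>x\<close> on the block survives, and it contributes the sign to the power
  \<open>card b\<close>. Asking that this power be 1 covers even blocks with signs as well as
  arbitrary blocks with all signs equal to 1.\<close>

lemma block_sum_signed:
  assumes \<sigma>: "\<sigma> permutes {..<N}" and \<epsilon>: "\<And>j. j < N \<Longrightarrow> \<epsilon> j \<in> \<real>" "\<And>j. j < N \<Longrightarrow> \<epsilon> j ^ card b = 1"
    and b: "b \<noteq> {}" "finite b" and x: "\<And>i. i \<in> b \<Longrightarrow> x i < N"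
  shows "(\<Sum>z<N. \<Prod>i\<in>b. twist (Matrix.mat N N (\<lambda>(i, j). if i = \<sigma> j then \<epsilon> j else 0)) i (x i) z) =
    of_bool (\<forall>i\<in>b. \<forall>j\<in>b. x i = x j)" (is "(\<Sum>z<N. \<Prod>i\<in>b. twist ?g i (x i) z) = _")
proof -
  have tw: "twist ?g i (x i) z = (if x i = \<sigma> z then \<epsilon> z else 0)" if "i \<in> b" "z < N" for i z
    using that x \<epsilon>(1) by (subst twist_Reals) auto
  obtain c where c: "c \<in> b" using b by auto
  obtain w where w: "w < N" "x c = \<sigma> w"
    using x[OF c] permutes_image[OF \<sigma>] by (metis imageE lessThan_iff)
  show ?thesis
  proof (cases "\<forall>i\<in>b. \<forall>j\<in>b. x i = x j")
    case True
    have "(\<Sum>z<N. \<Prod>i\<in>b. twist ?g i (x i) z) = (\<Sum>z<N. if z = w then 1 else 0)"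
    proof (intro sum.cong refl)
      fix z assume z: "z \<in> {..<N}"
      have "x i = x c" if "i \<in> b" for i using True c that by blast
      then have "(\<Prod>i\<in>b. twist ?g i (x i) z) = (\<Prod>i\<in>b. if x c = \<sigma> z then \<epsilon> z else 0)"
        using z by (intro prod.cong refl, subst tw) simp_all
      also have "\<dots> = (if z = w then 1 else 0)"
        using \<epsilon>(2) z b w permutes_eq_iff[OF \<sigma>] by auto
      finally show "(\<Prod>i\<in>b. twist ?g i (x i) z) = (if z = w then 1 else 0)" .
    qed
    then have "(\<Sum>z<N. \<Prod>i\<in>b. twist ?g i (x i) z) = 1" using w by simp
    also have "1 = (of_bool (\<forall>i\<in>b. \<forall>j\<in>b. x i = x j) :: complex)"
      unfolding of_bool_def by (rule if_P[OF True, symmetric])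
    finally show ?thesis .
  next
    case False
    have "(\<Prod>i\<in>b. twist ?g i (x i) z) = 0" if "z < N" for z
    proof -
      obtain i where "i \<in> b" "x i \<noteq> \<sigma> z" using False by metis
      then show ?thesis using b tw that by (intro prod_zero) auto
    qed
    then show ?thesis using False by simp
  qed
qed

text \<open>Here the kinds are matched with the groups: orthonormal rows deal with pairs (for the
  unitary group only with one point in each row of the diagram, where one factor is conjugated), row
  sums 1 with singletons, even powers of signs with even blocks, and permutation matrices with all
  blocks.\<close>

lemma block_sum:
  assumes g: "g \<in> matrix_group A N" and ok: "block_ok A b"
    and b: "b \<noteq> {}" "finite b" and x: "\<And>i. i \<in> b \<Longrightarrow> x i < N"
  shows "(\<Sum>z<N. \<Prod>i\<in>b. twist g i (x i) z) = of_bool (\<forall>i\<in>b. \<forall>j\<in>b. x i = x j)"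
proof (cases A)
  case kS
  then obtain i j where ij: "b = {Top i, Bot j}" using ok by auto
  have "(\<Sum>z<N. \<Prod>i\<in>b. twist g i (x i) z) =
      (\<Sum>z<N. g $$ (x (Bot j), z) * cnj (g $$ (x (Top i), z)))"
    by (simp add: ij twist_def mult.commute)
  also have "\<dots> = of_bool (x (Bot j) = x (Top i))"
    using g x kS ij by (intro unitary_group_rows) auto
  also have "(x (Bot j) = x (Top i)) = (\<forall>i\<in>b. \<forall>j\<in>b. x i = x j)"
    by (simp add: ij(1) eq_commute)
  finally show ?thesis .
next
  case kB
  then show ?thesis using g ok x by (intro block_sum_two) auto
next
  case kBs
  then have o: "g \<in> orthogonal_group N" "\<And>i. i < N \<Longrightarrow> (\<Sum>j<N. g $$ (i, j)) = 1"
    using g by auto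
  consider "card b = 2" | "card b = 1" using kBs ok b
    by (metis block_ok.simps(3) card_0_eq le_Suc_eq le_zero_eq numeral_2_eq_2 One_nat_def)
  then show ?thesis
  proof cases
    case 1
    then show ?thesis using o x by (intro block_sum_two)
  next
    case 2
    then obtain i where i: "b = {i}" by (auto simp: card_1_singleton_iff)
    have "(\<Sum>z<N. \<Prod>i\<in>b. twist g i (x i) z) = (\<Sum>z<N. g $$ (x i, z))"
      using o x i by (intro sum.cong) (auto simp: twist_Reals orthogonal_group_def)
    then show ?thesis using o x i by auto
  qed
next
  case kH
  then obtain \<sigma> \<epsilon> where g': "g = Matrix.mat N N (\<lambda>(i, j). if i = \<sigma> j then \<epsilon> j else 0)"
    and \<sigma>: "\<sigma> permutes {..<N}" and \<epsilon>: "\<And>j. j < N \<Longrightarrow> \<epsilon> j = 1 \<or> \<epsilon> j = -1"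
    using g by auto
  have "\<epsilon> j \<in> \<real>" "\<epsilon> j ^ card b = 1" if "j < N" for j
    using \<epsilon>[OF that] ok kH by auto
  then show ?thesis unfolding g' using \<sigma> b x by (intro block_sum_signed)
next
  case kP
  then obtain \<sigma> where g': "g = Matrix.mat N N (\<lambda>(i, j). if i = \<sigma> j then 1 else 0)"
    and \<sigma>: "\<sigma> permutes {..<N}"
    using g by auto
  show ?thesis unfolding g'
    using block_sum_signed[OF \<sigma>, of "\<lambda>_. 1" b x] b x by simp
qed

lemma sum_ind:
  fixes f :: "(point \<Rightarrow> nat) \<Rightarrow> complex"
  shows "(\<Sum>x\<in>multi k N. f x * ind p x) = (\<Sum>x\<in>{x \<in> multi k N. const_on p x}. f x)"
proof -
  have "(\<Sum>x\<in>multi k N. f x * ind p x) = (\<Sum>x\<in>multi k N. if const_on p x then f x else 0)"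
    by (intro sum.cong) (auto simp: ind_def)
  then show ?thesis by (simp only: sum.inter_filter[OF finite_multi])
qed

lemma prod_of_bool:
  "finite S \<Longrightarrow> (\<Prod>b\<in>S. of_bool (P b)) = (of_bool (\<forall>b\<in>S. P b) :: complex)"
  by (induction S rule: finite_induct) auto

text \<open>This is the easy half of the first fundamental theorem: the action factors over the
  blocks, and \<open>block_sum\<close> reproduces the indicator of each block.\<close>

lemma ind_invariant:
  assumes "p \<in> parts A k"
  shows "invariant_tensor A k N (ind p)"
  unfolding invariant_tensor_def
proof (intro ballI)
  fix g x assume g: "g \<in> matrix_group A N" and x: "x \<in> multi k N"
  have p: "p \<in> partitions k" and ok: "\<And>b. b \<in> p \<Longrightarrow> block_ok A b"
    using assms by (auto simp: parts_iff)
  have "(\<Sum>y\<in>multi k N. tensor_act k g x y * ind p y) = (\<Prod>b\<in>p. \<Sum>z<N. \<Prod>i\<in>b. twist g i (x i) z)"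
    unfolding sum_ind tensor_act_def by (rule sum_const_on[OF p])
  also have "\<dots> = (\<Prod>b\<in>p. of_bool (\<forall>i\<in>b. \<forall>j\<in>b. x i = x j))"
  proof (intro prod.cong refl block_sum[OF g ok])
    fix b i assume "b \<in> p" "i \<in> b"
    then show "x i < N" by (intro multi_less[OF x] subsetD[OF block_subset[OF p]])
  qed (use block_nonempty[OF p] finite_block[OF p] in auto)
  also have "\<dots> = ind p x"
    unfolding ind_def const_on_def by (rule prod_of_bool[OF finite_partition[OF p]])
  finally show "ind p x = (\<Sum>y\<in>multi k N. tensor_act k g x y * ind p y)" by simp
qed

section \<open>Invariant tensors\<close>

lemma card_points: "card (points k) = 2 * k"
proof -
  have "card (points k) = card (Top ` {..<k}) + card (Bot ` {..<k})"
    unfolding points_def by (intro card_Un_disjoint) auto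
  also have "\<dots> = 2 * k" by (simp add: card_image inj_on_def)
  finally show ?thesis .
qed

lemma multi_ext:
  assumes "x \<in> multi k N" "y \<in> multi k N" "\<And>i. i \<in> points k \<Longrightarrow> x i = y i"
  shows "x = y"
  using assms unfolding multi_def by (rule PiE_ext)

section \<open>Monomial matrices: permutations and diagonal matrices\<close>

lemma tensor_act_eq_0:
  assumes "i \<in> points k" "g $$ (x i, y i) = 0"
  shows "tensor_act k g x y = 0"
  unfolding tensor_act_def
proof (rule prod_zero)
  show "\<exists>i\<in>points k. twist g i (x i) (y i) = 0"
    using assms by (intro bexI[of _ i]) (auto simp: twist_def split: point.split)
qed simp

text \<open>The entries of \<open>g\<close> vanish off the graph of \<open>\<sigma>\<close>, so in
  the invariance equation at the permuted index only the term \<open>y = x\<close> remains.\<close>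

lemma invariant_monomial:
  assumes T: "invariant_tensor A k N T" and g: "g \<in> matrix_group A N"
    and \<sigma>: "\<sigma> permutes {..<N}" and z: "\<And>a b. a < N \<Longrightarrow> b < N \<Longrightarrow> a \<noteq> \<sigma> b \<Longrightarrow> g $$ (a, b) = 0"
    and x: "x \<in> multi k N"
  shows "T (\<lambda>i\<in>points k. \<sigma> (x i)) = (\<Prod>i\<in>points k. twist g i (\<sigma> (x i)) (x i)) * T x"
proof -
  let ?x = "\<lambda>i\<in>points k. \<sigma> (x i)"
  have x': "?x \<in> multi k N"
    using multi_less[OF x] permutes_in_image[OF \<sigma>] by (auto simp: multi_def)
  have "T ?x = (\<Sum>y\<in>multi k N. tensor_act k g ?x y * T y)"
    using T g x' unfolding invariant_tensor_def by blast
  also have "\<dots> = (\<Sum>y\<in>multi k N. if y = x then tensor_act k g ?x x * T x else 0)"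
  proof (intro sum.cong refl)
    fix y assume y: "y \<in> multi k N"
    show "tensor_act k g ?x y * T y = (if y = x then tensor_act k g ?x x * T x else 0)"
    proof (cases "y = x")
      case False
      then obtain i where i: "i \<in> points k" "y i \<noteq> x i" using multi_ext[OF y x] by blast
      then have "\<sigma> (x i) \<noteq> \<sigma> (y i)" using permutes_eq_iff[OF \<sigma>] by metis
      then have "g $$ (?x i, y i) = 0"
        using i multi_less[OF y i(1)] multi_less[OF x' i(1)] z by simp
      then show ?thesis using tensor_act_eq_0[OF i(1)] False by simp
    qed simp
  qed
  also have "\<dots> = tensor_act k g ?x x * T x" using x by simp
  also have "tensor_act k g ?x x = (\<Prod>i\<in>points k. twist g i (\<sigma> (x i)) (x i))"
    unfolding tensor_act_def by (intro prod.cong) auto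
  finally show ?thesis .
qed

definition perm_mat :: "nat \<Rightarrow> (nat \<Rightarrow> nat) \<Rightarrow> complex mat" where
  "perm_mat N \<sigma> = Matrix.mat N N (\<lambda>(i, j). if i = \<sigma> j then 1 else 0)"

lemma perm_mat_in_group:
  assumes \<sigma>: "\<sigma> permutes {..<N}"
  shows "perm_mat N \<sigma> \<in> matrix_group A N"
proof -
  have o: "perm_mat N \<sigma> \<in> orthogonal_group N"
    using signed_permutation_orthogonal[OF \<sigma>, of "\<lambda>_. 1"] by (simp add: perm_mat_def)
  show ?thesis
  proof (cases A)
    case kBs
    have "(\<Sum>j<N. perm_mat N \<sigma> $$ (i, j)) = 1" if "i < N" for i
    proof -
      have "i \<in> \<sigma> ` {..<N}" using that permutes_image[OF \<sigma>] by simp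
      then obtain w where w: "w < N" "i = \<sigma> w" by blast
      have "(\<Sum>j<N. perm_mat N \<sigma> $$ (i, j)) = (\<Sum>j<N. if j = w then 1 else 0)"
        using that w permutes_eq_iff[OF \<sigma>] by (intro sum.cong) (auto simp: perm_mat_def)
      then show ?thesis using w by simp
    qed
    moreover have "(\<Sum>i<N. perm_mat N \<sigma> $$ (i, j)) = 1" if "j < N" for j
    proof -
      have "\<sigma> j < N" using that permutes_in_image[OF \<sigma>] by auto
      moreover have "(\<Sum>i<N. perm_mat N \<sigma> $$ (i, j)) = (\<Sum>i<N. if i = \<sigma> j then 1 else 0)"
        using that by (intro sum.cong) (auto simp: perm_mat_def)
      ultimately show ?thesis by simp
    qed
    ultimately show ?thesis using kBs o by simp
  next
    case kH
    have "\<exists>\<sigma>' \<epsilon>. perm_mat N \<sigma> = Matrix.mat N N (\<lambda>(i, j). if i = \<sigma>' j then \<epsilon> j else 0) \<and>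
        \<sigma>' permutes {..<N} \<and> (\<forall>j<N. \<epsilon> j = 1 \<or> \<epsilon> j = - 1)"
      by (rule exI[of _ \<sigma>], rule exI[of _ "\<lambda>_. 1"]) (simp add: perm_mat_def \<sigma>)
    then show ?thesis using kH by auto
  next
    case kP
    then show ?thesis using \<sigma> by (auto simp: perm_mat_def)
  qed (use o orthogonal_subset_unitary in auto)
qed

lemma invariant_permute:
  assumes T: "invariant_tensor A k N T" and \<sigma>: "\<sigma> permutes {..<N}" and x: "x \<in> multi k N"
  shows "T (\<lambda>i\<in>points k. \<sigma> (x i)) = T x"
proof -
  have "T (\<lambda>i\<in>points k. \<sigma> (x i)) =
      (\<Prod>i\<in>points k. twist (perm_mat N \<sigma>) i (\<sigma> (x i)) (x i)) * T x"
    by (rule invariant_monomial[OF T perm_mat_in_group[OF \<sigma>] \<sigma> _ x]) (auto simp: perm_mat_def)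
  also have "(\<Prod>i\<in>points k. twist (perm_mat N \<sigma>) i (\<sigma> (x i)) (x i)) = 1"
  proof (intro prod.neutral ballI)
    fix i assume "i \<in> points k"
    then have "x i < N" "\<sigma> (x i) < N"
      using multi_less[OF x] permutes_in_image[OF \<sigma>, of "x i"] by auto
    then show "twist (perm_mat N \<sigma>) i (\<sigma> (x i)) (x i) = 1"
      by (cases i) (auto simp: perm_mat_def twist_def)
  qed
  finally show ?thesis by (simp only: mult_1)
qed

definition diag_at :: "nat \<Rightarrow> nat \<Rightarrow> complex \<Rightarrow> complex mat" where
  "diag_at N v c = Matrix.mat N N (\<lambda>(i, j). if i = j then (if j = v then c else 1) else 0)"

text \<open>A diagonal matrix sends no index to another one, so the equation says that
  \<open>T x\<close> equals a scalar times itself. Wherever that scalar differs from 1,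
  \<open>T x\<close> vanishes.\<close>

lemma invariant_diag:
  assumes T: "invariant_tensor A k N T" and g: "diag_at N v c \<in> matrix_group A N"
    and x: "x \<in> multi k N"
  shows "T x = (\<Prod>i\<in>{i \<in> points k. x i = v}. case i of Top _ \<Rightarrow> cnj c | Bot _ \<Rightarrow> c) * T x"
proof -
  have "T (\<lambda>i\<in>points k. id (x i)) = (\<Prod>i\<in>points k. twist (diag_at N v c) i (id (x i)) (x i)) * T x"
    by (rule invariant_monomial[OF T g permutes_id _ x]) (auto simp: diag_at_def)
  also have "(\<lambda>i\<in>points k. id (x i)) = x" using x by (auto simp: multi_def PiE_def extensional_def)
  also have "(\<Prod>i\<in>points k. twist (diag_at N v c) i (id (x i)) (x i)) =
      (\<Prod>i\<in>points k. if x i = v then (case i of Top _ \<Rightarrow> cnj c | Bot _ \<Rightarrow> c) else 1)"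
    using multi_less[OF x]
    by (intro prod.cong refl) (auto simp: diag_at_def twist_def split: point.split)
  also have "\<dots> = (\<Prod>i\<in>{i \<in> points k. x i = v}. case i of Top _ \<Rightarrow> cnj c | Bot _ \<Rightarrow> c)"
    by (rule prod.inter_filter[symmetric]) simp
  finally show ?thesis .
qed

lemma sign_in_group:
  assumes "A = kS \<or> A = kB \<or> A = kH"
  shows "diag_at N v (-1) \<in> matrix_group A N"
proof -
  have "diag_at N v (-1) = Matrix.mat N N (\<lambda>(i, j). if i = id j then (if j = v then -1 else 1) else 0)"
    by (simp add: diag_at_def)
  then have o: "diag_at N v (-1) \<in> orthogonal_group N"
    using signed_permutation_orthogonal[OF permutes_id, of N "\<lambda>j. if j = v then -1 else 1"] by simp
  have "\<exists>\<sigma> \<epsilon>. diag_at N v (-1) = Matrix.mat N N (\<lambda>(i, j). if i = \<sigma> j then \<epsilon> j else 0) \<and>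
      \<sigma> permutes {..<N} \<and> (\<forall>j<N. \<epsilon> j = 1 \<or> \<epsilon> j = - 1)"
    by (rule exI[of _ id], rule exI[of _ "\<lambda>j. if j = v then -1 else 1"])
      (simp add: diag_at_def permutes_id)
  then have "diag_at N v (-1) \<in> matrix_group kH N" by simp
  then show ?thesis using assms o subsetD[OF orthogonal_subset_unitary o] by (elim disjE) simp_all
qed

lemma diag_at_unitary:
  assumes "cnj c * c = 1"
  shows "diag_at N v c \<in> unitary_group N"
proof -
  have "(\<Sum>z<N. cnj (diag_at N v c $$ (z, a)) * diag_at N v c $$ (z, b)) = of_bool (a = b)"
    if "a < N" "b < N" for a b
  proof -
    have "(\<Sum>z<N. cnj (diag_at N v c $$ (z, a)) * diag_at N v c $$ (z, b)) =
        (\<Sum>z<N. if z = a then of_bool (a = b) else 0)"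
      using that assms by (intro sum.cong) (auto simp: diag_at_def)
    then show ?thesis using that by simp
  qed
  then show ?thesis by (simp add: unitary_group_iff diag_at_def)
qed

lemma Ker_block:
  assumes "b \<in> Ker k x"
  obtains v where "v \<in> x ` points k" "b = {i \<in> points k. x i = v}"
  using assms unfolding Ker_def by blast

lemma invariant_odd_block:
  assumes T: "invariant_tensor A k N T" and A: "A = kS \<or> A = kB \<or> A = kH"
    and x: "x \<in> multi k N" and b: "b \<in> Ker k x" "odd (card b)"
  shows "T x = 0"
proof -
  obtain v where v: "b = {i \<in> points k. x i = v}" using b Ker_block by metis
  have "T x = (\<Prod>i\<in>b. case i of Top _ \<Rightarrow> cnj (-1) | Bot _ \<Rightarrow> -1) * T x"
    unfolding v by (rule invariant_diag[OF T sign_in_group[OF A] x])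
  also have "(\<Prod>i\<in>b. case i of Top _ \<Rightarrow> cnj (-1) | Bot _ \<Rightarrow> -1) = (\<Prod>i\<in>b. -1 :: complex)"
    by (intro prod.cong refl) (simp split: point.split)
  also have "\<dots> = -1" using b by simp
  finally show ?thesis by simp
qed

lemma invariant_unbalanced_block:
  assumes T: "invariant_tensor kS k N T"
    and x: "x \<in> multi k N" and b: "b \<in> Ker k x" "card b = 2" "\<not> (\<exists>i j. b = {Top i, Bot j})"
  shows "T x = 0"
proof -
  obtain v where v: "b = {i \<in> points k. x i = v}" using b Ker_block by metis
  obtain i j where ij: "b = {i, j}" "i \<noteq> j" using b(2) by (auto simp: card_2_iff)
  \<comment> \<open>The imaginary unit tells the rows apart: two bottom points give its square, two
    top points the square of its conjugate, both -1, whereas a top and a bottom point would give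
    1.\<close>
  have "T x = (\<Prod>i\<in>b. case i of Top _ \<Rightarrow> cnj \<i> | Bot _ \<Rightarrow> \<i>) * T x"
    unfolding v by (rule invariant_diag[OF T _ x]) (simp add: diag_at_unitary)
  also have "(\<Prod>i\<in>b. case i of Top _ \<Rightarrow> cnj \<i> | Bot _ \<Rightarrow> \<i>) = -1"
    using b(3) ij by (cases i; cases j) (auto simp: insert_commute)
  finally show ?thesis by simp
qed

text \<open>One matrix that mixes coordinates and serves the unitary, orthogonal and bistochastic groups alike.\<close>

definition reflection :: "nat \<Rightarrow> nat set \<Rightarrow> complex mat" where
  "reflection N E = Matrix.mat N N (\<lambda>(a, b).
     (if a = b then 1 - 2 * of_bool (a \<in> E) else 0) + 2/3 * of_bool (a \<in> E) * of_bool (b \<in> E))"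

text \<open>On the coordinates in \<open>E\<close> the matrix is 2P - 1 with P the orthogonal
  projection onto (1, 1, 1), and it is the identity elsewhere. So it is real symmetric, squares to
  the identity and fixes the all-ones vector, which gives orthogonality and the row and column
  sums.\<close>

lemma reflection_in_group:
  assumes E: "E \<subseteq> {..<N}" "card E = 3" and A: "A = kS \<or> A = kB \<or> A = kBs"
  shows "reflection N E \<in> matrix_group A N"
proof -
  define ch :: "nat \<Rightarrow> complex" where "ch a = of_bool (a \<in> E)" for a
  have sumch: "(\<Sum>z<N. ch z) = 3"
    using E by (simp add: ch_def of_bool_def sum.If_cases Int_absorb1)
  let ?g = "\<lambda>a b. (if a = b then 1 - 2 * ch a else 0) + 2/3 * ch a * ch b"
  have g: "reflection N E $$ (a, b) = ?g a b" if "a < N" "b < N" for a b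
    using that by (simp add: reflection_def ch_def)
  have row: "(\<Sum>z<N. ?g a z) = 1" if "a < N" for a
    using that by (simp add: sum.distrib sum_distrib_left[symmetric] sum_divide_distrib[symmetric] sumch)
  have orth: "(\<Sum>z<N. ?g z a * ?g z b) = of_bool (a = b)" if "a < N" "b < N" for a b
  proof -
    have "(\<Sum>z<N. ?g z a * ?g z b) =
        (\<Sum>z<N. (if z = a then (1 - 2 * ch a) * ?g a b else 0) +
           2/3 * ch a * (if z = b then (1 - 2 * ch b) * ch b else 0) +
           4/9 * ch a * ch b * ch z)"
    proof (intro sum.cong refl)
      fix z
      have "ch c = 0 \<or> ch c = 1" for c by (simp add: ch_def)
      from this[of a] this[of b] this[of z]
      show "?g z a * ?g z b = (if z = a then (1 - 2 * ch a) * ?g a b else 0) +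
           2/3 * ch a * (if z = b then (1 - 2 * ch b) * ch b else 0) + 4/9 * ch a * ch b * ch z"
        by auto
    qed
    also have "\<dots> = (1 - 2 * ch a) * ?g a b + 2/3 * ch a * ((1 - 2 * ch b) * ch b) + 4/9 * ch a * ch b * 3"
      using that
      by (simp add: sum.distrib sum_distrib_left[symmetric] sum_divide_distrib[symmetric] sumch)
    also have "\<dots> = of_bool (a = b)"
      by (auto simp: ch_def)
    finally show ?thesis .
  qed
  have o: "reflection N E \<in> orthogonal_group N"
  proof (rule orthogonal_groupI)
    show "(\<Sum>z<N. reflection N E $$ (z, a) * reflection N E $$ (z, b)) = of_bool (a = b)"
      if "a < N" "b < N" for a b
      using orth[OF that] that by (simp add: g)
    show "reflection N E $$ (i, j) \<in> \<real>" if "i < N" "j < N" for i j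
      using that by (simp add: g ch_def)
  qed (simp add: reflection_def)
  have "(\<Sum>z<N. reflection N E $$ (a, z)) = 1" if "a < N" for a
    using row[OF that] that by (simp add: g)
  moreover have "(\<Sum>z<N. reflection N E $$ (z, a)) = 1" if "a < N" for a
  proof -
    have "(\<Sum>z<N. reflection N E $$ (z, a)) = (\<Sum>z<N. ?g a z)"
      using that by (intro sum.cong refl) (simp add: g)
    then show ?thesis using row[OF that] by simp
  qed
  ultimately show ?thesis using A o subsetD[OF orthogonal_subset_unitary o] by auto
qed

text \<open>
  Split one point off the block \<open>b\<close>, giving it the fresh value \<open>w\<close>.  In the invariance equation
  of the reflection at the resulting index, all terms but those constant on \<open>b\<close> are
  indexed by finer kernels, and the remaining coefficients do not cancel because \<open>card b \<ge> 3\<close>.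
\<close>

lemma invariant_large_block:
  assumes T: "invariant_tensor A k N T" and A: "A = kS \<or> A = kB \<or> A = kBs"
    and x: "x \<in> multi k N" and N: "card (x ` points k) + 2 \<le> N"
    and b: "b \<in> Ker k x" "card b \<ge> 3"
    and finer: "\<And>y. y \<in> multi k N \<Longrightarrow> card (y ` points k) > card (x ` points k) \<Longrightarrow> T y = 0"
  shows "T x = 0"
proof -
  obtain v where v: "v \<in> x ` points k" "b = {i \<in> points k. x i = v}" using b Ker_block by metis
  have im: "x ` points k \<subseteq> {..<N}" using multi_less[OF x] by auto
  have "card ({..<N} - x ` points k) \<ge> 2"
    using N im by (simp add: card_Diff_subset)
  then obtain E' where "E' \<subseteq> {..<N} - x ` points k" "card E' = 2"
    using obtain_subset_with_card_n by metis
  then obtain u w where uw: "u < N" "w < N" "u \<noteq> w" "u \<notin> x ` points k" "w \<notin> x ` points k"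
    by (auto simp: card_2_iff)
  have vN: "v < N" using v im by auto
  define E where "E = {u, v, w}"
  have ne: "v \<noteq> u" "v \<noteq> w" using uw v(1) by auto
  then have E: "E \<subseteq> {..<N}" "card E = 3" using uw vN by (auto simp: E_def)
  let ?g = "reflection N E"
  have gE: "?g $$ (a, c) = (if a = c then -1/3 else 2/3)" if "a \<in> E" "c \<in> E" for a c
    using that subsetD[OF E(1)] by (auto simp: reflection_def)
  have gz: "?g $$ (a, c) = (if a = c then 1 else 0)" if "a < N" "c < N" "a \<notin> E \<or> c \<notin> E" for a c
    using that by (auto simp: reflection_def)
  obtain s where s: "s \<in> b" using b by fastforce
  have sp: "s \<in> points k" "x s = v" using s v by auto
  define x' where "x' = x(s := w)"
  have x': "x' \<in> multi k N" using x sp uw by (auto simp: x'_def multi_def)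
  define z where "z = (\<lambda>c. \<lambda>i\<in>points k. if x i = v then c else x i)"
  have z: "z c \<in> multi k N" if "c \<in> E" for c
    using that E multi_less[OF x] by (auto simp: z_def multi_def)
  have Tz: "T (z c) = T x" if "c \<in> E" for c
  proof -
    have c: "c = v \<or> c \<notin> x ` points k" using that uw by (auto simp: E_def)
    have tr: "Transposition.transpose v c permutes {..<N}"
      using that E vN by (intro permutes_swap_id) auto
    have "z c = (\<lambda>i\<in>points k. Transposition.transpose v c (x i))"
      unfolding z_def using c by (intro restrict_ext) (auto simp: Transposition.transpose_def)
    then show ?thesis using invariant_permute[OF T tr x] by simp
  qed
  have split: "x ` points k = insert v (x ` (points k - b))" "v \<notin> x ` (points k - b)"
    using v by auto
  have cardsplit: "card (x ` points k) = card (x ` (points k - b)) + 1"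
    using card_insert_disjoint[OF _ split(2)] split(1) by simp
  \<comment> \<open>The values on \<open>b\<close> lie in \<open>E\<close> and avoid all values
    taken off \<open>b\<close>. One value on \<open>b\<close> is replaced by at least two, so the
    number of values grows.\<close>
  have nonconst: "card (y ` points k) > card (x ` points k)"
    if y: "y ` b \<subseteq> E" "\<not> (\<exists>c. \<forall>i\<in>b. y i = c)" "\<And>i. i \<in> points k - b \<Longrightarrow> y i = x i" for y
  proof -
    have bp: "b \<subseteq> points k" using v by auto
    have fin: "finite (y ` b)" by (rule finite_imageI[OF finite_subset[OF bp finite_points]])
    have dis: "x ` (points k - b) \<inter> y ` b = {}"
    proof -
      have "x ` (points k - b) \<inter> E = {}" using uw split by (auto simp: E_def)
      then show ?thesis using y(1) by blast
    qed
    have "card (y ` b) \<ge> 2"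
    proof (rule ccontr)
      assume "\<not> card (y ` b) \<ge> 2"
      then have "card (y ` b) \<le> Suc 0" by simp
      then have "\<And>i. i \<in> b \<Longrightarrow> y i = y s" using card_le_Suc0_iff_eq[OF fin] s by blast
      then show False using y(2) by blast
    qed
    moreover have "y ` points k = x ` (points k - b) \<union> y ` b"
    proof -
      have "y ` points k = y ` (points k - b) \<union> y ` b" using bp by blast
      also have "y ` (points k - b) = x ` (points k - b)" using y(3) by (intro image_cong) auto
      finally show ?thesis .
    qed
    then have "card (y ` points k) = card (x ` (points k - b)) + card (y ` b)"
      using dis fin by (simp add: card_Un_disjoint)
    ultimately show ?thesis using cardsplit by simp
  qed
  have finb: "finite b" using v by simp
  have other: "\<exists>t\<in>b. t \<noteq> s"
  proof (rule ccontr)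
    assume "\<not> (\<exists>t\<in>b. t \<noteq> s)"
    then have "b = {s}" using s by blast
    then show False using b by simp
  qed
  have "T x' = 0"
  proof (rule finer[OF x'], rule nonconst)
    show "x' ` b \<subseteq> E" using v by (auto simp: x'_def E_def)
    show "\<not> (\<exists>c. \<forall>i\<in>b. x' i = c)"
    proof
      assume "\<exists>c. \<forall>i\<in>b. x' i = c"
      then obtain c where c: "\<forall>i\<in>b. x' i = c" by blast
      obtain t where t: "t \<in> b" "t \<noteq> s" using other by blast
      have "x' t = v" using t v by (simp add: x'_def)
      moreover have "x' s = w" by (simp add: x'_def)
      ultimately show False using c t s ne by metis
    qed
    show "x' i = x i" if "i \<in> points k - b" for i using that s by (auto simp: x'_def)
  qed
  moreover have "T x' = (\<Sum>y\<in>multi k N. tensor_act k ?g x' y * T y)"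
    using T reflection_in_group[OF E A] x' unfolding invariant_tensor_def by blast
  moreover have "(\<Sum>y\<in>multi k N. tensor_act k ?g x' y * T y) = (\<Sum>y\<in>z ` E. tensor_act k ?g x' y * T y)"
  proof (rule sum.mono_neutral_right)
    show "z ` E \<subseteq> multi k N" using z by auto
    show "\<forall>y\<in>multi k N - z ` E. tensor_act k ?g x' y * T y = 0"
    proof (rule ballI, rule ccontr)
      fix y assume y: "y \<in> multi k N - z ` E" and nz: "tensor_act k ?g x' y * T y \<noteq> 0"
      \<comment> \<open>A non-zero coefficient needs a non-zero entry at every point. Off
        \<open>b\<close> the index \<open>x'\<close> avoids \<open>E\<close>, where the matrix is
        the identity, so \<open>y\<close> agrees with \<open>x\<close>; on \<open>b\<close> it stays
        inside \<open>E\<close>.\<close>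
      have ent: "?g $$ (x' i, y i) \<noteq> 0" if "i \<in> points k" for i
        using nz tensor_act_eq_0[of i k ?g x' y] that by auto
      have yN: "y i < N" "x' i < N" if "i \<in> points k" for i
        using y multi_less[OF x'] multi_less that by auto
      have off: "y i = x i" if "i \<in> points k - b" for i
      proof -
        have "x' i = x i" using that s by (auto simp: x'_def)
        moreover have "x i \<notin> E" using that uw v by (auto simp: E_def)
        ultimately show ?thesis using ent[of i] gz[of "x' i" "y i"] yN[of i] that
          by (auto split: if_splits)
      qed
      have on: "y i \<in> E" if "i \<in> b" for i
      proof -
        have "x' i \<in> E" "i \<in> points k" using that v by (auto simp: x'_def E_def)
        then show ?thesis using ent[of i] gz[of "x' i" "y i"] yN[of i] by metis
      qed
      have "\<not> card (y ` points k) > card (x ` points k)" using nz y finer by auto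
      then obtain c where c: "\<And>i. i \<in> b \<Longrightarrow> y i = c" using nonconst[of y] on off by blast
      then have "c \<in> E" using s on by blast
      moreover have "y = z c"
      proof (rule multi_ext)
        show "y i = z c i" if "i \<in> points k" for i
          using that c[of i] off[of i] v by (auto simp: z_def)
      qed (use y z[OF \<open>c \<in> E\<close>] in auto)
      ultimately show False using y by blast
    qed
  qed simp
  moreover have "inj_on z E"
  proof (rule inj_onI)
    fix c d assume "z c = z d"
    then have "z c s = z d s" by simp
    then show "c = d" using sp by (simp add: z_def)
  qed
  then have "(\<Sum>y\<in>z ` E. tensor_act k ?g x' y * T y) = (\<Sum>c\<in>E. tensor_act k ?g x' (z c) * T x)"
    by (subst sum.reindex) (auto simp: Tz)
  moreover have "tensor_act k ?g x' (z c) = ?g $$ (w, c) * ?g $$ (v, c) ^ (card b - 1)"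
    if c: "c \<in> E" for c
  proof -
    have re: "twist ?g i a d = ?g $$ (a, d)" if "a < N" "d < N" for i a d
      using reflection_in_group[OF E, of kB] that
      by (intro twist_Reals) (auto simp: orthogonal_group_def)
    have lt: "x' i < N" "z c i < N" if "i \<in> points k" for i
      using multi_less x' z[OF c] that by auto
    have "tensor_act k ?g x' (z c) = (\<Prod>i\<in>points k. ?g $$ (x' i, z c i))"
      unfolding tensor_act_def using lt by (intro prod.cong refl re) auto
    also have "\<dots> = (\<Prod>i\<in>b. ?g $$ (x' i, z c i))"
    proof (rule prod.mono_neutral_right)
      show "\<forall>i\<in>points k - b. ?g $$ (x' i, z c i) = 1"
      proof
        fix i assume i: "i \<in> points k - b"
        have "x' i = x i" using i s by (auto simp: x'_def)
        moreover have "z c i = x i" using i v by (auto simp: z_def)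
        moreover have "x i \<notin> E" using i uw v by (auto simp: E_def)
        ultimately show "?g $$ (x' i, z c i) = 1"
          using gz[of "x i" "x i"] multi_less[OF x] i by auto
      qed
    qed (use v in auto)
    also have "\<dots> = ?g $$ (x' s, z c s) * (\<Prod>i\<in>b - {s}. ?g $$ (x' i, z c i))"
      by (rule prod.remove[OF finb s])
    also have "(\<Prod>i\<in>b - {s}. ?g $$ (x' i, z c i)) = (\<Prod>i\<in>b - {s}. ?g $$ (v, c))"
      using v by (intro prod.cong refl) (auto simp: x'_def z_def)
    also have "\<dots> = ?g $$ (v, c) ^ (card b - 1)" using s finb by simp
    also have "?g $$ (x' s, z c s) = ?g $$ (w, c)" using sp by (simp add: x'_def z_def)
    finally show ?thesis .
  qed
  then have "(\<Sum>c\<in>E. tensor_act k ?g x' (z c) * T x) =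
      (\<Sum>c\<in>E. ?g $$ (w, c) * ?g $$ (v, c) ^ (card b - 1)) * T x"
    by (simp add: sum_distrib_right)
  \<comment> \<open>With m = \<open>card b\<close> the three terms for \<open>u\<close>,
    \<open>v\<close>, \<open>w\<close> add up to 1/3 (2/3)^(m-1) + 2/3 (-1/3)^(m-1). The first
    summand dominates exactly when 2 < 2^(m-1), that is from m = 3 on. For m = 2 the sum is the
    inner product of the rows \<open>w\<close> and \<open>v\<close>, hence 0, as it must be because
    pairs are allowed.\<close>
  moreover have "(\<Sum>c\<in>E. ?g $$ (w, c) * ?g $$ (v, c) ^ (card b - 1)) \<noteq> 0"
  proof -
    have m: "card b - 1 = Suc (Suc (card b - 3))" using b by simp
    have "(\<Sum>c\<in>E. ?g $$ (w, c) * ?g $$ (v, c) ^ (card b - 1)) =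
      2/3 * (2/3) ^ (card b - 1) + 2/3 * (-1/3) ^ (card b - 1) - 1/3 * (2/3) ^ (card b - 1)"
      using uw ne by (simp add: E_def gE[unfolded E_def])
    also have "\<dots> = complex_of_real (1/3 * (2/3) ^ (card b - 1) + 2/3 * (-1/3) ^ (card b - 1))"
      by (simp add: field_simps)
    also have "\<dots> \<noteq> 0"
    proof -
      have "\<bar>2/3 * (-1/3) ^ (card b - 1)\<bar> = (2/3 * (1/3) ^ (card b - 1) :: real)"
        by (simp add: abs_mult power_abs)
      also have "\<dots> < 1/3 * (2/3) ^ (card b - 1)"
      proof -
        have "(1::real) \<le> 2 ^ (card b - 3)" by simp
        then have "(2::real) < 2 ^ (card b - 1)" unfolding m power_Suc by linarith
        then have "2 * (1/3) ^ (card b - 1) < (2 ^ (card b - 1) * (1/3) ^ (card b - 1) :: real)"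
          by simp
        also have "\<dots> = (2/3) ^ (card b - 1)" by (simp add: power_mult_distrib[symmetric])
        finally show ?thesis by simp
      qed
      finally have "1/3 * (2/3) ^ (card b - 1) + 2/3 * (-1/3) ^ (card b - 1) \<noteq> (0::real)" by linarith
      then show ?thesis unfolding of_real_eq_0_iff .
    qed
    finally show ?thesis .
  qed
  ultimately show ?thesis by simp
qed

text \<open>For \<open>kP\<close> every kernel is admissible, and for \<open>kH\<close> an
  inadmissible kernel has an odd block. In the other cases blocks of size at least 3 are handled by
  the reflection, and the remaining singletons and pairs by diagonal matrices. An index takes at
  most \<open>2 * k\<close> values, so the bound on \<open>N\<close> leaves two of them
  free.\<close>

lemma invariant_tensor_vanishes:
  assumes T: "invariant_tensor A k N T" and N: "2 * k + 2 \<le> N"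
    and zero: "\<And>x. x \<in> multi k N \<Longrightarrow> Ker k x \<in> parts A k \<Longrightarrow> T x = 0"
    and x: "x \<in> multi k N"
  shows "T x = 0"
proof -
  have cle: "card (y ` points k) \<le> 2 * k" for y :: "point \<Rightarrow> nat"
    using card_image_le[of "points k" y] by (simp add: card_points)
  have bad: "\<exists>b\<in>Ker k y. \<not> block_ok A b" if "Ker k y \<notin> parts A k" for y
    using that Ker_in_partitions by (auto simp: parts_iff)
  have ne: "b \<noteq> {}" "finite b" if "b \<in> Ker k y" for b y
    using that block_nonempty[OF Ker_in_partitions] finite_block[OF Ker_in_partitions] by auto
  consider "A = kP" | "A = kH" | "A = kS \<or> A = kB \<or> A = kBs" by (cases A) auto
  then show ?thesis
  proof cases
    case 1
    then show ?thesis using zero[OF x] Ker_in_partitions by simp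
  next
    case 2
    show ?thesis
    proof (cases "Ker k x \<in> parts A k")
      case False
      then show ?thesis using bad 2 invariant_odd_block[OF T _ x] by auto
    qed (use zero x in auto)
  next
    case 3
    show ?thesis using x
    \<comment> \<open>The measure drops as the number of values grows: finer kernels are settled
      before coarser ones, as the reflection requires.\<close>
    proof (induction "2 * k - card (x ` points k)" arbitrary: x rule: less_induct)
      case less
      show ?case
      proof (cases "\<exists>b\<in>Ker k x. card b \<ge> 3")
        case True
        then obtain b where b: "b \<in> Ker k x" "card b \<ge> 3" by blast
        show ?thesis
        proof (rule invariant_large_block[OF T 3 less.prems _ b])
          show "card (x ` points k) + 2 \<le> N" using cle[of x] N by simp
          show "T y = 0" if "y \<in> multi k N" "card (x ` points k) < card (y ` points k)" for y
            by (rule less.hyps) (use that cle[of y] in auto)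
        qed
      next
        case False
        show ?thesis
        proof (cases "Ker k x \<in> parts A k")
          case True
          then show ?thesis using zero less.prems by auto
        next
          case nin: False
          then obtain b where b: "b \<in> Ker k x" "\<not> block_ok A b" using bad by blast
          have "card b \<le> 2" "card b \<noteq> 0" using False b ne[OF b(1)] by auto
          then consider "card b = 1" | "card b = 2" by linarith
          then show ?thesis
          proof cases
            case 1
            then have "A \<noteq> kBs" using b by auto
            then show ?thesis using 1 3 b invariant_odd_block[OF T _ less.prems b(1)] by auto
          next
            case 2
            then have "A = kS" using b 3 by auto
            then show ?thesis using invariant_unbalanced_block[of k N T x b] T less.prems b 2 by auto
          qed
        qed
      qed
    qed
  qed
qed

section \<open>Invariant tensors as combinations of indicators\<close>

lemma ex_Ker_eq:
  assumes q: "q \<in> partitions k" and N: "2 * k \<le> N"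
  shows "\<exists>x\<in>multi k N. Ker k x = q"
proof -
  have U: "\<Union>q = points k" and disj: "\<And>b c i. b \<in> q \<Longrightarrow> c \<in> q \<Longrightarrow> i \<in> b \<Longrightarrow> i \<in> c \<Longrightarrow> b = c"
    using q by (auto simp: partitions_def partition_on_def disjoint_def)
  have "\<exists>i. i \<in> b" if "b \<in> q" for b using block_nonempty[OF q that] by auto
  then obtain rep where rep: "\<And>b. b \<in> q \<Longrightarrow> rep b \<in> b" by metis
  have "card q \<le> card (points k)"
  proof (rule card_inj_on_le[of rep])
    show "inj_on rep q" using rep disj by (metis inj_onI)
    show "rep ` q \<subseteq> points k" using rep U by auto
  qed simp
  then have cq: "card q \<le> N" using N by (simp add: card_points)
  obtain f where f: "bij_betw f q {..<card q}"
    using ex_bij_betw_finite_nat[OF finite_partition[OF q]] by (auto simp: atLeast0LessThan)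
  have "\<exists>b. b \<in> q \<and> i \<in> b" if "i \<in> points k" for i using U that by blast
  then obtain blk where blk: "\<And>i. i \<in> points k \<Longrightarrow> blk i \<in> q \<and> i \<in> blk i" by metis
  define x where "x = (\<lambda>i\<in>points k. f (blk i))"
  have fl: "f b < card q" if "b \<in> q" for b using f that by (auto simp: bij_betw_def)
  have "x i < N" if "i \<in> points k" for i
    using fl[of "blk i"] blk[OF that] that cq by (simp add: x_def)
  then have x: "x \<in> multi k N" unfolding multi_def by (auto simp: x_def)
  have sets: "{j \<in> points k. x j = x i} = blk i" if i: "i \<in> points k" for i
  proof (intro equalityI subsetI)
    fix j assume "j \<in> {j \<in> points k. x j = x i}"
    then have j: "j \<in> points k" "f (blk j) = f (blk i)" using i by (auto simp: x_def)
    then have "blk j = blk i" using f blk[OF i] blk[of j] by (auto simp: bij_betw_def inj_on_def)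
    then show "j \<in> blk i" using blk[of j] j by auto
  next
    fix j assume j: "j \<in> blk i"
    then have "j \<in> points k" using blk[OF i] U by blast
    moreover have "blk j = blk i" using disj[of "blk j" "blk i" j] blk[OF i] blk[OF \<open>j \<in> points k\<close>] j by auto
    ultimately show "j \<in> {j \<in> points k. x j = x i}" using i by (simp add: x_def)
  qed
  have "Ker k x = blk ` points k" unfolding Ker_def using sets by (intro image_cong refl) auto
  also have "\<dots> = q"
  proof
    show "q \<subseteq> blk ` points k"
    proof
      fix b assume b: "b \<in> q"
      then have "rep b \<in> points k" using rep U by blast
      moreover have "blk (rep b) = b" using disj[of _ b "rep b"] blk[OF \<open>rep b \<in> points k\<close>] rep b by auto
      ultimately show "b \<in> blk ` points k" by force
    qed
  qed (use blk in auto)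
  finally show ?thesis using x by blast
qed

lemma Ker_eq_iff:
  assumes "Ker k x = Ker k y" "i \<in> points k" "j \<in> points k"
  shows "x i = x j \<longleftrightarrow> y i = y j"
proof -
  have one: "u i = u j" if "Ker k u' = Ker k u" "u' i = u' j" for u u' :: "point \<Rightarrow> nat"
  proof -
    have "{l \<in> points k. u' l = u' i} \<in> Ker k u" using that(1) assms by (auto simp: Ker_def)
    then obtain a where "{l \<in> points k. u' l = u' i} = {l \<in> points k. u l = u a}"
      unfolding Ker_def by blast
    then have "i \<in> {l \<in> points k. u l = u a}" "j \<in> {l \<in> points k. u l = u a}"
      using that(2) assms by auto
    then show ?thesis by simp
  qed
  show ?thesis using one[of x y] one[of y x] assms(1) by auto
qed

text \<open>Equal kernels induce a bijection between the two sets of values. Their complements in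
  \<open>{..<N}\<close> have equal size, so the bijection extends to a permutation of
  \<open>{..<N}\<close>, whose matrix lies in every group.\<close>

lemma invariant_Ker:
  assumes T: "invariant_tensor A k N T" and x: "x \<in> multi k N" and y: "y \<in> multi k N"
    and K: "Ker k x = Ker k y"
  shows "T x = T y"
proof -
  define h where "h a = y (SOME i. i \<in> points k \<and> x i = a)" for a
  have h: "h (x i) = y i" if "i \<in> points k" for i
  proof -
    have "(SOME j. j \<in> points k \<and> x j = x i) \<in> points k \<and> x (SOME j. j \<in> points k \<and> x j = x i) = x i"
      by (rule someI[of _ i]) (use that in simp)
    then show ?thesis unfolding h_def using Ker_eq_iff[OF K _ that] by blast
  qed
  let ?X = "x ` points k" and ?Y = "y ` points k"
  have sub: "?X \<subseteq> {..<N}" "?Y \<subseteq> {..<N}" using multi_less[OF x] multi_less[OF y] by auto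
  have inj: "inj_on h ?X"
  proof (rule inj_onI)
    fix a c assume "a \<in> ?X" "c \<in> ?X" and e: "h a = h c"
    then obtain i j where "i \<in> points k" "j \<in> points k" "a = x i" "c = x j" by blast
    then show "a = c" using e h Ker_eq_iff[OF K] by auto
  qed
  have bh: "bij_betw h ?X ?Y"
    unfolding bij_betw_def using inj h by (auto simp: image_image)
  then have "card ?X = card ?Y" by (rule bij_betw_same_card)
  then have "card ({..<N} - ?X) = card ({..<N} - ?Y)" using sub by (simp add: card_Diff_subset)
  then obtain h' where h': "bij_betw h' ({..<N} - ?X) ({..<N} - ?Y)"
    using finite_same_card_bij[of "{..<N} - ?X" "{..<N} - ?Y"] by auto
  define \<sigma> where "\<sigma> a = (if a \<in> ?X then h a else if a < N then h' a else a)" for a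
  have "bij_betw \<sigma> ?X ?Y"
    by (rule bij_betw_cong[THEN iffD1, OF _ bh]) (simp add: \<sigma>_def)
  moreover have "bij_betw \<sigma> ({..<N} - ?X) ({..<N} - ?Y)"
    by (rule bij_betw_cong[THEN iffD1, OF _ h']) (simp add: \<sigma>_def)
  ultimately have "bij_betw \<sigma> (?X \<union> ({..<N} - ?X)) (?Y \<union> ({..<N} - ?Y))"
    by (rule bij_betw_combine) auto
  then have "bij_betw \<sigma> {..<N} {..<N}" using sub by (simp add: Un_absorb1)
  then have \<sigma>: "\<sigma> permutes {..<N}"
    by (rule bij_imp_permutes) (use sub in \<open>auto simp: \<sigma>_def\<close>)
  have "y = (\<lambda>i\<in>points k. \<sigma> (x i))"
    using y h by (intro ext) (auto simp: \<sigma>_def multi_def PiE_def extensional_def)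
  then show ?thesis using invariant_permute[OF T \<sigma> x] by simp
qed

lemma invariant_diff_sum:
  assumes "invariant_tensor A k N T" "\<And>p. p \<in> P \<Longrightarrow> invariant_tensor A k N (S p)"
  shows "invariant_tensor A k N (\<lambda>x. T x - (\<Sum>p\<in>P. c p * S p x))"
  unfolding invariant_tensor_def
proof (intro ballI)
  fix g x assume gx: "g \<in> matrix_group A N" "x \<in> multi k N"
  have fixed: "(\<Sum>y\<in>multi k N. tensor_act k g x y * V y) = V x" if "invariant_tensor A k N V" for V
    using that gx unfolding invariant_tensor_def by metis
  have "(\<Sum>y\<in>multi k N. tensor_act k g x y * (T y - (\<Sum>p\<in>P. c p * S p y))) =
     (\<Sum>y\<in>multi k N. tensor_act k g x y * T y) -
     (\<Sum>p\<in>P. c p * (\<Sum>y\<in>multi k N. tensor_act k g x y * S p y))"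
    by (simp add: right_diff_distrib sum_subtractf sum_distrib_left mult.left_commute)
      (rule sum.swap)
  also have "\<dots> = T x - (\<Sum>p\<in>P. c p * S p x)"
    by (simp add: fixed assms)
  finally show "T x - (\<Sum>p\<in>P. c p * S p x) =
     (\<Sum>y\<in>multi k N. tensor_act k g x y * (T y - (\<Sum>p\<in>P. c p * S p y)))" by simp
qed

text \<open>One index per admissible kernel suffices to determine the coefficients, since the value
  of the combination at a kernel involves only finer partitions: a triangular system. The difference
  is invariant and vanishes at all admissible kernels, hence everywhere.\<close>

theorem invariant_tensor_span:
  assumes T: "invariant_tensor A k N T" and N: "2 * k + 2 \<le> N"
  shows "\<exists>c. \<forall>x\<in>multi k N. T x = (\<Sum>p\<in>parts A k. c p * ind p x)"
proof -
  have "\<exists>x. q \<in> parts A k \<longrightarrow> x \<in> multi k N \<and> Ker k x = q" for q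
    using ex_Ker_eq[of q k N] subsetD[OF parts_subset, of q A k] N by auto
  then obtain xs where xs: "\<And>q. q \<in> parts A k \<Longrightarrow> xs q \<in> multi k N \<and> Ker k (xs q) = q" by metis
  have "\<exists>!\<kappa>. (\<forall>q\<in>parts A k. T (xs q) = (\<Sum>p\<in>{p\<in>parts A k. coarser k p q}. \<kappa> p)) \<and>
      (\<forall>p. p \<notin> parts A k \<longrightarrow> \<kappa> p = 0)"
  proof (rule ex_triangular_inverse[where f = "\<lambda>p. - real (card p)"])
    show "coarser k p p" if "p \<in> parts A k" for p
      using subsetD[OF parts_subset that] by (intro refines_refl) (simp add: partitions_def)
    show "- real (card q) < - real (card p)"
      if "p \<in> parts A k" "q \<in> parts A k" "coarser k q p" "q \<noteq> p" for p q
      using refines_card[OF finite_points that(3)] that(4) by (metis le_neq_implies_less neg_less_iff_less of_nat_less_iff)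
  qed simp
  then obtain c where c: "\<And>q. q \<in> parts A k \<Longrightarrow> T (xs q) = (\<Sum>p\<in>{p\<in>parts A k. coarser k p q}. c p)"
    by metis
  let ?S = "\<lambda>x. T x - (\<Sum>p\<in>parts A k. c p * ind p x)"
  have S: "invariant_tensor A k N ?S" by (rule invariant_diff_sum[OF T ind_invariant])
  have "?S x = 0" if x: "x \<in> multi k N" for x
  proof (rule invariant_tensor_vanishes[OF S N _ x])
    fix x assume x: "x \<in> multi k N" and q: "Ker k x \<in> parts A k"
    have "(\<Sum>p\<in>parts A k. c p * ind p x) = (\<Sum>p\<in>parts A k. if coarser k p (Ker k x) then c p else 0)"
      using parts_subset[of A k] coarser_Ker by (intro sum.cong) (auto simp: ind_def)
    also have "\<dots> = T (xs (Ker k x))" using c[OF q] by (simp only: sum.inter_filter[OF finite_parts])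
    also have "\<dots> = T x" using invariant_Ker[OF T _ x] xs[OF q] by blast
    finally show "?S x = 0" by simp
  qed
  then show ?thesis by (intro exI[of _ c]) simp
qed

section \<open>Splitting the columns\<close>

fun cmap :: "(nat \<Rightarrow> nat) \<Rightarrow> point \<Rightarrow> point" where
  "cmap \<alpha> (Top i) = Top (\<alpha> i)"
| "cmap \<alpha> (Bot i) = Bot (\<alpha> i)"

definition restr :: "(nat \<Rightarrow> nat) \<Rightarrow> nat \<Rightarrow> (point \<Rightarrow> nat) \<Rightarrow> point \<Rightarrow> nat" where
  "restr \<alpha> k x = (\<lambda>i\<in>points k. x (cmap \<alpha> i))"

text \<open>This extends \<open>ptensor\<close> to two sets of columns interleaved in any order, as
  the letters of the two families are in an arbitrary word.\<close>

definition glue :: "(nat \<Rightarrow> nat) \<Rightarrow> (nat \<Rightarrow> nat) \<Rightarrow> point set set \<Rightarrow> point set set \<Rightarrow> point set set" where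
  "glue \<alpha> \<beta> p q = image (cmap \<alpha>) ` p \<union> image (cmap \<beta>) ` q"

lemma points_iff: "Top i \<in> points k \<longleftrightarrow> i < k" "Bot i \<in> points k \<longleftrightarrow> i < k"
  by (auto simp: points_def)

lemma cmap_points: "cmap \<alpha> ` points k = Top ` \<alpha> ` {..<k} \<union> Bot ` \<alpha> ` {..<k}"
  by (simp add: points_def image_Un image_image)

lemma inj_on_cmap: "inj_on \<alpha> {..<k} \<Longrightarrow> inj_on (cmap \<alpha>) (points k)"
  by (auto simp: inj_on_def points_def)

lemma twist_cmap [simp]: "twist g (cmap \<alpha> i) = twist g i"
  by (cases i) (auto simp: twist_def fun_eq_iff)

lemma block_ok_cmap:
  assumes "block_ok A b" "inj_on (cmap \<alpha>) b"
  shows "block_ok A (cmap \<alpha> ` b)"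
proof (cases A)
  case kS
  then obtain i j where "b = {Top i, Bot j}" using assms by auto
  then have "cmap \<alpha> ` b = {Top (\<alpha> i), Bot (\<alpha> j)}" by simp
  then show ?thesis using kS by auto
qed (use assms in \<open>auto simp: card_image\<close>)

text \<open>The Gram matrix of the indicator tensors. At \<open>N = 2\<close> it converts identities
  between numbers of blocks into identities between sums over indices.\<close>

lemma nc_join_pairing:
  assumes "p \<in> partitions k" "q \<in> partitions k"
  shows "(\<Sum>x\<in>multi k N. ind p x * ind q x) = of_nat (N ^ nc (part_join k p q))"
proof -
  have "(\<Sum>x\<in>multi k N. ind p x * ind q x) =
      (\<Sum>x\<in>multi k N. if const_on p x \<and> const_on q x then 1 else 0)"
    by (intro sum.cong) (auto simp: ind_def)
  also have "\<dots> = of_nat (card {x \<in> multi k N. const_on p x \<and> const_on q x})"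
    by (simp add: sum.inter_filter[symmetric])
  finally show ?thesis using card_const_on_join[OF assms] by simp
qed

lemma tensor_act_unitary:
  assumes g: "g \<in> unitary_group N" and x: "x \<in> multi k N" and y: "y \<in> multi k N"
  shows "(\<Sum>w\<in>multi k N. cnj (tensor_act k g w x) * tensor_act k g w y) = of_bool (x = y)"
proof -
  have "(\<Sum>w\<in>multi k N. cnj (tensor_act k g w x) * tensor_act k g w y) =
      (\<Sum>w\<in>points k \<rightarrow>\<^sub>E {..<N}. \<Prod>i\<in>points k. cnj (twist g i (w i) (x i)) * twist g i (w i) (y i))"
    by (simp add: multi_def tensor_act_def prod.distrib)
  also have "\<dots> = (\<Prod>i\<in>points k. \<Sum>a<N. cnj (twist g i a (x i)) * twist g i a (y i))"
    by (rule prod_sum_PiE[symmetric]) auto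
  also have "\<dots> = (\<Prod>i\<in>points k. of_bool (x i = y i))"
  proof (intro prod.cong refl)
    fix i assume i: "i \<in> points k"
    have u: "(\<Sum>z<N. cnj (g $$ (z, a)) * g $$ (z, b)) = of_bool (a = b)" if "a < N" "b < N" for a b
      using g that by (simp add: unitary_group_iff)
    show "(\<Sum>a<N. cnj (twist g i a (x i)) * twist g i a (y i)) = of_bool (x i = y i)"
    proof (cases i)
      case (Top l)
      then have "(\<Sum>a<N. cnj (twist g i a (x i)) * twist g i a (y i)) =
          (\<Sum>a<N. cnj (g $$ (a, y i)) * g $$ (a, x i))"
        by (simp add: twist_def mult.commute)
      then show ?thesis using u multi_less[OF x i] multi_less[OF y i] by (simp add: eq_commute[of "y i"])
    next
      case (Bot l)
      then show ?thesis using u multi_less[OF x i] multi_less[OF y i] by (simp add: twist_def)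
    qed
  qed
  also have "\<dots> = of_bool (\<forall>i\<in>points k. x i = y i)" by (rule prod_of_bool) simp
  also have "(\<forall>i\<in>points k. x i = y i) = (x = y)" using multi_ext[OF x y] by blast
  finally show ?thesis .
qed

text \<open>The tensor action of \<open>g\<close> is unitary, so a vector fixed by it is fixed by
  its adjoint too. Orthonormality gives this directly for each \<open>g\<close>; closure of the
  group under inverses is not invoked.\<close>

lemma invariant_adjoint:
  assumes T: "invariant_tensor A k N T" and g: "g \<in> matrix_group A N" and x: "x \<in> multi k N"
  shows "T x = (\<Sum>w\<in>multi k N. cnj (tensor_act k g w x) * T w)"
proof -
  have u: "g \<in> unitary_group N" using g matrix_group_subset_unitary by blast
  have "(\<Sum>w\<in>multi k N. cnj (tensor_act k g w x) * T w) =
      (\<Sum>w\<in>multi k N. cnj (tensor_act k g w x) * (\<Sum>y\<in>multi k N. tensor_act k g w y * T y))"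
    using T g unfolding invariant_tensor_def by (intro sum.cong refl arg_cong2[of _ _ _ _ times]) blast
  also have "\<dots> = (\<Sum>y\<in>multi k N. (\<Sum>w\<in>multi k N. cnj (tensor_act k g w x) * tensor_act k g w y) * T y)"
    by (simp add: sum_distrib_left sum_distrib_right mult.assoc) (rule sum.swap)
  also have "\<dots> = (\<Sum>y\<in>multi k N. if y = x then T x else 0)"
    by (intro sum.cong refl) (auto simp: tensor_act_unitary[OF u x])
  also have "\<dots> = T x" using x by simp
  finally show ?thesis by simp
qed

lemma const_onD: "const_on p x \<Longrightarrow> b \<in> p \<Longrightarrow> i \<in> b \<Longrightarrow> j \<in> b \<Longrightarrow> x i = x j"
  unfolding const_on_def by (drule (1) bspec, drule (1) bspec, drule (1) bspec)

lemma const_on_image: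
  assumes "p \<in> partitions k'"
  shows "const_on (image (cmap \<gamma>) ` p) x \<longleftrightarrow> const_on p (restr \<gamma> k' x)"
proof -
  have r: "restr \<gamma> k' x i = x (cmap \<gamma> i)" if "b \<in> p" "i \<in> b" for b i
    using subsetD[OF block_subset[OF assms that(1)] that(2)] by (simp add: restr_def)
  show ?thesis
  proof
    assume c: "const_on (image (cmap \<gamma>) ` p) x"
    show "const_on p (restr \<gamma> k' x)"
      unfolding const_on_def
    proof (intro ballI)
      fix b i j assume b: "b \<in> p" "i \<in> b" "j \<in> b"
      then have "x (cmap \<gamma> i) = x (cmap \<gamma> j)"
        using const_onD[OF c, of "cmap \<gamma> ` b"] by simp
      then show "restr \<gamma> k' x i = restr \<gamma> k' x j" using r b by simp
    qed
  next
    assume c: "const_on p (restr \<gamma> k' x)"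
    show "const_on (image (cmap \<gamma>) ` p) x"
      unfolding const_on_def
    proof (intro ballI)
      fix b i j assume b: "b \<in> image (cmap \<gamma>) ` p" "i \<in> b" "j \<in> b"
      then obtain c where "c \<in> p" "b = cmap \<gamma> ` c" by blast
      moreover then obtain i' j' where "i = cmap \<gamma> i'" "j = cmap \<gamma> j'" "i' \<in> c" "j' \<in> c"
        using b by blast
      ultimately show "x i = x j"
        using const_onD[OF c, of c i' j'] r[of c i'] r[of c j'] by simp
    qed
  qed
qed

lemma part_join_self: "p \<in> partitions k' \<Longrightarrow> part_join k' p p = p"
proof -
  assume p: "p \<in> partitions k'"
  have P: "coarser k' p p" using p unfolding partitions_def by (intro refines_refl) simp
  have "is_join k' p p (part_join k' p p)" using p p by (rule is_join_join)
  then have "coarser k' p (part_join k' p p)" "coarser k' (part_join k' p p) p"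
    using P unfolding is_join_def by simp_all
  then show "part_join k' p p = p" using refines_asym by metis
qed

locale column_split =
  fixes k k1 k2 :: nat and \<alpha> \<beta> :: "nat \<Rightarrow> nat"
  assumes inj_\<alpha>: "inj_on \<alpha> {..<k1}" and inj_\<beta>: "inj_on \<beta> {..<k2}"
    and disj: "\<alpha> ` {..<k1} \<inter> \<beta> ` {..<k2} = {}"
    and cover: "\<alpha> ` {..<k1} \<union> \<beta> ` {..<k2} = {..<k}"
begin

lemma cmap_cover: "cmap \<alpha> ` points k1 \<union> cmap \<beta> ` points k2 = points k"
  unfolding cmap_points unfolding points_def cover[symmetric] by auto

lemma cmap_disj: "cmap \<alpha> ` points k1 \<inter> cmap \<beta> ` points k2 = {}"
  using disj unfolding cmap_points by auto

lemma cmap_in: "i \<in> points k1 \<Longrightarrow> cmap \<alpha> i \<in> points k" "i \<in> points k2 \<Longrightarrow> cmap \<beta> i \<in> points k"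
  using cmap_cover by blast+

lemmas inj_cmap = inj_on_cmap[OF inj_\<alpha>] inj_on_cmap[OF inj_\<beta>]

definition merge :: "(point \<Rightarrow> nat) \<Rightarrow> (point \<Rightarrow> nat) \<Rightarrow> point \<Rightarrow> nat" where
  "merge y z = (\<lambda>i\<in>points k. if i \<in> cmap \<alpha> ` points k1
     then y (inv_into (points k1) (cmap \<alpha>) i) else z (inv_into (points k2) (cmap \<beta>) i))"

lemma merge_cmap:
  "i \<in> points k1 \<Longrightarrow> merge y z (cmap \<alpha> i) = y i"
  "i \<in> points k2 \<Longrightarrow> merge y z (cmap \<beta> i) = z i"
proof -
  show "merge y z (cmap \<alpha> i) = y i" if "i \<in> points k1"
    using that cmap_in inj_cmap by (simp add: merge_def)
  show "merge y z (cmap \<beta> i) = z i" if i: "i \<in> points k2"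
  proof -
    have "cmap \<beta> i \<notin> cmap \<alpha> ` points k1" using i cmap_disj by blast
    then show ?thesis using i cmap_in inj_cmap by (simp add: merge_def)
  qed
qed

lemma points_cases:
  assumes "i \<in> points k"
  obtains j where "j \<in> points k1" "i = cmap \<alpha> j" | j where "j \<in> points k2" "i = cmap \<beta> j"
  using assms cmap_cover by blast

lemma merge_multi:
  assumes "y \<in> multi k1 N" "z \<in> multi k2 N"
  shows "merge y z \<in> multi k N"
proof -
  have "merge y z i < N" if "i \<in> points k" for i
    using that
    by (cases i rule: points_cases) (simp_all add: merge_cmap multi_less[OF assms(1)] multi_less[OF assms(2)])
  then show ?thesis by (auto simp: multi_def merge_def)
qed

lemma restr_multi:
  assumes "x \<in> multi k N"
  shows "restr \<alpha> k1 x \<in> multi k1 N" "restr \<beta> k2 x \<in> multi k2 N"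
  using multi_less[OF assms] cmap_in by (auto simp: restr_def multi_def)

lemma restr_merge:
  assumes "y \<in> multi k1 N" "z \<in> multi k2 N"
  shows "restr \<alpha> k1 (merge y z) = y" "restr \<beta> k2 (merge y z) = z"
  using assms merge_cmap by (auto simp: restr_def multi_def PiE_def extensional_def)

lemma merge_restr:
  assumes "x \<in> multi k N"
  shows "merge (restr \<alpha> k1 x) (restr \<beta> k2 x) = x"
proof (rule multi_ext[OF merge_multi[OF restr_multi[OF assms]] assms])
  fix i assume "i \<in> points k"
  then show "merge (restr \<alpha> k1 x) (restr \<beta> k2 x) i = x i"
    by (cases i rule: points_cases) (simp_all add: merge_cmap restr_def)
qed

lemma sum_multi:
  fixes H :: "_ \<Rightarrow> 'b :: comm_monoid_add"
  shows "(\<Sum>x\<in>multi k N. H x) = (\<Sum>y\<in>multi k1 N. \<Sum>z\<in>multi k2 N. H (merge y z))"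
proof -
  have "(\<Sum>x\<in>multi k N. H x) = (\<Sum>u\<in>multi k1 N \<times> multi k2 N. H (merge (fst u) (snd u)))"
    by (rule sum.reindex_bij_witness[where i = "\<lambda>u. merge (fst u) (snd u)"
          and j = "\<lambda>x. (restr \<alpha> k1 x, restr \<beta> k2 x)"])
      (auto simp: merge_restr restr_merge intro: restr_multi merge_multi)
  also have "\<dots> = (\<Sum>y\<in>multi k1 N. \<Sum>z\<in>multi k2 N. H (merge y z))"
    by (simp add: sum.cartesian_product case_prod_beta)
  finally show ?thesis .
qed

lemma prod_points_split:
  fixes f :: "point \<Rightarrow> 'b :: comm_monoid_mult"
  shows "(\<Prod>i\<in>points k. f i) = (\<Prod>i\<in>points k1. f (cmap \<alpha> i)) * (\<Prod>i\<in>points k2. f (cmap \<beta> i))"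
proof -
  have "(\<Prod>i\<in>points k. f i) = (\<Prod>i\<in>cmap \<alpha> ` points k1. f i) * (\<Prod>i\<in>cmap \<beta> ` points k2. f i)"
    unfolding cmap_cover[symmetric] using cmap_disj by (intro prod.union_disjoint) auto
  then show ?thesis by (simp add: prod.reindex inj_cmap)
qed

lemma tensor_act_split:
  assumes "y \<in> multi k1 N" "z \<in> multi k2 N" "y' \<in> multi k1 N" "z' \<in> multi k2 N"
  shows "tensor_act k g (merge y z) (merge y' z') = tensor_act k1 g y y' * tensor_act k2 g z z'"
  unfolding tensor_act_def prod_points_split by (simp add: merge_cmap)

lemma const_on_glue:
  assumes "p \<in> partitions k1" "q \<in> partitions k2"
  shows "const_on (glue \<alpha> \<beta> p q) x \<longleftrightarrow> const_on p (restr \<alpha> k1 x) \<and> const_on q (restr \<beta> k2 x)"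
proof -
  have "const_on (glue \<alpha> \<beta> p q) x \<longleftrightarrow>
      const_on (image (cmap \<alpha>) ` p) x \<and> const_on (image (cmap \<beta>) ` q) x"
    unfolding glue_def const_on_def by (rule ball_Un)
  then show ?thesis using const_on_image assms by simp
qed

lemma ind_glue:
  assumes "p \<in> partitions k1" "q \<in> partitions k2" "y \<in> multi k1 N" "z \<in> multi k2 N"
  shows "ind (glue \<alpha> \<beta> p q) (merge y z) = ind p y * ind q z"
  using const_on_glue[OF assms(1,2), of "merge y z"] restr_merge[OF assms(3,4)]
  by (simp add: ind_def)

lemma glue_partition:
  assumes "p \<in> partitions k1" "q \<in> partitions k2"
  shows "glue \<alpha> \<beta> p q \<in> partitions k"
proof -
  have "{} \<notin> image (cmap \<alpha>) ` p" "{} \<notin> image (cmap \<beta>) ` q"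
    using block_nonempty assms by blast+
  then have *: "partition_on (cmap \<alpha> ` points k1) (image (cmap \<alpha>) ` p)"
    "partition_on (cmap \<beta> ` points k2) (image (cmap \<beta>) ` q)"
    using assms partition_on_inj_image[OF _ inj_cmap(1), of p]
      partition_on_inj_image[OF _ inj_cmap(2), of q] by (simp_all add: partitions_def)
  have "disjnt b c" if "b \<in> image (cmap \<alpha>) ` p" "c \<in> image (cmap \<beta>) ` q" for b c
  proof -
    have "b \<subseteq> cmap \<alpha> ` points k1" "c \<subseteq> cmap \<beta> ` points k2"
      using that partition_onD1[OF *(1)] partition_onD1[OF *(2)] by auto
    then show ?thesis using cmap_disj by (auto simp: disjnt_def)
  qed
  then have "partition_on (points k) (glue \<alpha> \<beta> p q)"
  proof (intro partition_onI)
    show "\<Union>(glue \<alpha> \<beta> p q) = points k"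
      using partition_onD1[OF *(1)] partition_onD1[OF *(2)] cmap_cover by (simp add: glue_def)
    show "{} \<notin> glue \<alpha> \<beta> p q"
      using partition_onD3[OF *(1)] partition_onD3[OF *(2)] unfolding glue_def by blast
    fix b c assume dis: "\<And>b c. b \<in> image (cmap \<alpha>) ` p \<Longrightarrow> c \<in> image (cmap \<beta>) ` q \<Longrightarrow> disjnt b c"
      and bc: "b \<in> glue \<alpha> \<beta> p q" "c \<in> glue \<alpha> \<beta> p q" "b \<noteq> c"
    have "disjnt b c" if "b \<in> r" "c \<in> r" "partition_on X r" for r X
      using pairwiseD[OF partition_onD2[OF that(3)] that(1,2) bc(3)] .
    note same = this
    consider "b \<in> image (cmap \<alpha>) ` p" "c \<in> image (cmap \<alpha>) ` p"
      | "b \<in> image (cmap \<alpha>) ` p" "c \<in> image (cmap \<beta>) ` q"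
      | "b \<in> image (cmap \<beta>) ` q" "c \<in> image (cmap \<alpha>) ` p"
      | "b \<in> image (cmap \<beta>) ` q" "c \<in> image (cmap \<beta>) ` q"
      using bc(1,2) unfolding glue_def by blast
    then show "disjnt b c"
    proof cases
      case 1
      then show ?thesis using *(1) by (rule same)
    next
      case 2
      then show ?thesis by (rule dis)
    next
      case 3
      then show ?thesis using dis disjnt_sym by metis
    next
      case 4
      then show ?thesis using *(2) by (rule same)
    qed
  qed
  then show ?thesis by (simp add: partitions_def)
qed

lemma glue_parts:
  assumes "p \<in> parts A k1" "q \<in> parts A k2"
  shows "glue \<alpha> \<beta> p q \<in> parts A k"
proof -
  have pq: "p \<in> partitions k1" "q \<in> partitions k2" using assms by (auto simp: parts_iff)
  have "block_ok A b" if b: "b \<in> glue \<alpha> \<beta> p q" for b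
  proof -
    consider c where "c \<in> p" "b = cmap \<alpha> ` c" | c where "c \<in> q" "b = cmap \<beta> ` c"
      using b unfolding glue_def by blast
    then show ?thesis
    proof cases
      case 1
      then show ?thesis
        using assms block_ok_cmap[of A c \<alpha>] inj_on_subset[OF inj_cmap(1) block_subset[OF pq(1)]]
        by (auto simp: parts_iff)
    next
      case 2
      then show ?thesis
        using assms block_ok_cmap[of A c \<beta>] inj_on_subset[OF inj_cmap(2) block_subset[OF pq(2)]]
        by (auto simp: parts_iff)
    qed
  qed
  then show ?thesis using glue_partition[OF pq] by (simp add: parts_iff)
qed

text \<open>Indicators of glued partitions are products of indicators, so at \<open>N = 2\<close>
  their pairing is a product of two pairings, and the exponents of 2 add up.\<close>

lemma nc_join_glue:
  assumes "p \<in> partitions k1" "q \<in> partitions k2" "p' \<in> partitions k1" "q' \<in> partitions k2"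
  shows "nc (part_join k (glue \<alpha> \<beta> p q) (glue \<alpha> \<beta> p' q')) =
    nc (part_join k1 p p') + nc (part_join k2 q q')"
proof -
  have "(of_nat (2 ^ nc (part_join k (glue \<alpha> \<beta> p q) (glue \<alpha> \<beta> p' q'))) :: complex) =
      (\<Sum>y\<in>multi k1 2. \<Sum>z\<in>multi k2 2. (ind p y * ind p' y) * (ind q z * ind q' z))"
    unfolding nc_join_pairing[OF glue_partition[OF assms(1,2)] glue_partition[OF assms(3,4)], symmetric]
      sum_multi
    by (intro sum.cong refl) (simp add: ind_glue[OF assms(1,2)] ind_glue[OF assms(3,4)])
  also have "\<dots> = (\<Sum>y\<in>multi k1 2. ind p y * ind p' y) * (\<Sum>z\<in>multi k2 2. ind q z * ind q' z)"
    by (simp only: sum_product)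
  also have "\<dots> = of_nat (2 ^ (nc (part_join k1 p p') + nc (part_join k2 q q')))"
    using assms by (simp add: nc_join_pairing power_add)
  finally have "(2::nat) ^ nc (part_join k (glue \<alpha> \<beta> p q) (glue \<alpha> \<beta> p' q')) =
      2 ^ (nc (part_join k1 p p') + nc (part_join k2 q q'))"
    by (simp only: of_nat_eq_iff)
  then show ?thesis by (simp only: power_inject_exp one_less_numeral_iff semiring_norm)
qed

lemma nc_glue:
  assumes "p \<in> partitions k1" "q \<in> partitions k2"
  shows "nc (glue \<alpha> \<beta> p q) = nc p + nc q"
  using nc_join_glue[OF assms assms] assms glue_partition[OF assms] by (simp add: part_join_self)

lemma glue_id: "glue \<alpha> \<beta> (id_part k1) (id_part k2) = id_part k"
proof -
  have "glue \<alpha> \<beta> (id_part k1) (id_part k2) = (\<lambda>i. {Top i, Bot i}) ` (\<alpha> ` {..<k1} \<union> \<beta> ` {..<k2})"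
    unfolding glue_def id_part_def by (simp add: image_Un image_image)
  then show ?thesis by (simp add: cover id_part_def)
qed

text \<open>Each block stays within the columns of one factor and is non-empty, so inclusion in the
  columns of \<open>\<alpha>\<close> or of \<open>\<beta>\<close> tells from which factor it
  comes.\<close>

lemma glue_inj:
  assumes "p \<in> partitions k1" "q \<in> partitions k2" "p' \<in> partitions k1" "q' \<in> partitions k2"
    and eq: "glue \<alpha> \<beta> p q = glue \<alpha> \<beta> p' q'"
  shows "p = p' \<and> q = q'"
proof -
  have P: "{b \<in> glue \<alpha> \<beta> r s. b \<subseteq> cmap \<alpha> ` points k1} = image (cmap \<alpha>) ` r"
    "{b \<in> glue \<alpha> \<beta> r s. b \<subseteq> cmap \<beta> ` points k2} = image (cmap \<beta>) ` s"
    if r: "r \<in> partitions k1" and s: "s \<in> partitions k2" for r s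
  proof -
    have 1: "cmap \<alpha> ` b \<subseteq> cmap \<alpha> ` points k1 \<and> cmap \<alpha> ` b \<noteq> {}" if "b \<in> r" for b
      using block_subset[OF r that] block_nonempty[OF r that] by auto
    have 2: "cmap \<beta> ` b \<subseteq> cmap \<beta> ` points k2 \<and> cmap \<beta> ` b \<noteq> {}" if "b \<in> s" for b
      using block_subset[OF s that] block_nonempty[OF s that] by auto
    have sep: "{b \<in> B \<union> C. b \<subseteq> X} = B" "{b \<in> B \<union> C. b \<subseteq> Y} = C"
      if "\<And>b. b \<in> B \<Longrightarrow> b \<subseteq> X \<and> b \<noteq> {}" "\<And>b. b \<in> C \<Longrightarrow> b \<subseteq> Y \<and> b \<noteq> {}" "X \<inter> Y = {}"
      for B C X Y using that by blast+
    note S = sep[of "image (cmap \<alpha>) ` r" "cmap \<alpha> ` points k1" "image (cmap \<beta>) ` s" "cmap \<beta> ` points k2"]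
    show "{b \<in> glue \<alpha> \<beta> r s. b \<subseteq> cmap \<alpha> ` points k1} = image (cmap \<alpha>) ` r"
      unfolding glue_def by (rule S(1)) (use 1 2 cmap_disj in blast)+
    show "{b \<in> glue \<alpha> \<beta> r s. b \<subseteq> cmap \<beta> ` points k2} = image (cmap \<beta>) ` s"
      unfolding glue_def by (rule S(2)) (use 1 2 cmap_disj in blast)+
  qed
  have i: "inj_on (image (cmap \<alpha>)) (Pow (points k1))" "inj_on (image (cmap \<beta>)) (Pow (points k2))"
    using inj_cmap by (auto intro: inj_on_image_Pow)
  have sub: "p \<subseteq> Pow (points k1)" "p' \<subseteq> Pow (points k1)" "q \<subseteq> Pow (points k2)" "q' \<subseteq> Pow (points k2)"
    using assms block_subset by blast+
  have "image (cmap \<alpha>) ` p = image (cmap \<alpha>) ` p'" "image (cmap \<beta>) ` q = image (cmap \<beta>) ` q'"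
    using P[OF assms(1,2)] P[OF assms(3,4)] eq by metis+
  then show ?thesis using inj_on_image_eq_iff[OF i(1) sub(1,2)] inj_on_image_eq_iff[OF i(2) sub(3,4)] by simp
qed

text \<open>Colour the columns of the first factor 0 and those of the second 1. The colouring is
  constant on the blocks of the glued partition and of the identity, hence on every cycle, so no
  cycle meets both factors.\<close>

lemma cycles_of_glue:
  assumes "p \<in> partitions k1" "q \<in> partitions k2" "c \<in> cycles_of k (glue \<alpha> \<beta> p q)"
    and "i < k1" "j < k2" "Top (\<alpha> i) \<in> c"
  shows "Top (\<beta> j) \<notin> c"
proof
  assume "Top (\<beta> j) \<in> c"
  define x where "x = merge (\<lambda>_. 0) (\<lambda>_. 1)"
  have r: "restr \<alpha> k1 x = (\<lambda>i\<in>points k1. 0)" "restr \<beta> k2 x = (\<lambda>i\<in>points k2. 1)"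
    unfolding restr_def x_def by (auto simp: merge_cmap)
  have c0: "const_on p' (\<lambda>i\<in>points k'. a)" if "p' \<in> partitions k'" for p' k' a
    using block_subset[OF that] unfolding const_on_def by (simp add: subset_iff)
  have "const_on (glue \<alpha> \<beta> p q) x" "const_on (glue \<alpha> \<beta> (id_part k1) (id_part k2)) x"
    using const_on_glue assms(1,2) partition_id_part r c0 by simp_all
  then have "const_on (cycles_of k (glue \<alpha> \<beta> p q)) x"
    unfolding cycles_of_def glue_id
    using const_on_part_join[OF glue_partition[OF assms(1,2)] partition_id_part] by blast
  then have "x (Top (\<alpha> i)) = x (Top (\<beta> j))"
    using assms(3,6) \<open>Top (\<beta> j) \<in> c\<close> by (rule const_onD)
  moreover have "x (Top (\<alpha> i)) = 0"
    using merge_cmap(1)[of "Top i"] assms(4) by (simp add: x_def points_iff)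
  moreover have "x (Top (\<beta> j)) = 1"
    using merge_cmap(2)[of "Top j"] assms(5) by (simp add: x_def points_iff)
  ultimately show False by simp
qed

text \<open>
  Contracting an invariant tensor transforms its dual side, so it is the complex conjugate
  of the contraction that is invariant.
\<close>

lemma contraction_span:
  assumes T: "invariant_tensor A k2 N T" and p: "p \<in> parts A k" and N: "2 * k1 + 2 \<le> N"
  shows "\<exists>c. \<forall>y\<in>multi k1 N. (\<Sum>z\<in>multi k2 N. T z * ind p (merge y z)) = (\<Sum>q\<in>parts A k1. c q * ind q y)"
proof -
  define F where "F y = cnj (\<Sum>z\<in>multi k2 N. T z * ind p (merge y z))" for y
  have F: "F y = (\<Sum>z\<in>multi k2 N. cnj (T z) * ind p (merge y z))" for y
    by (simp add: F_def ind_def)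
  have "invariant_tensor A k1 N F"
    unfolding invariant_tensor_def
  proof (intro ballI)
    fix g y assume g: "g \<in> matrix_group A N" and y: "y \<in> multi k1 N"
    \<comment> \<open>Conjugating the adjoint form of invariance turns the action on
      \<open>T\<close> into the very factor that \<open>tensor_act\<close> contributes for the
      second set of columns. Together with the action on \<open>y\<close> it forms the action on the
      merged index, under which \<open>ind p\<close> is invariant.\<close>
    have cT: "cnj (T z) = (\<Sum>w\<in>multi k2 N. tensor_act k2 g w z * cnj (T w))" if "z \<in> multi k2 N" for z
      by (subst invariant_adjoint[OF T g that]) simp
    have "(\<Sum>y'\<in>multi k1 N. tensor_act k1 g y y' * F y') =
        (\<Sum>y'\<in>multi k1 N. \<Sum>z\<in>multi k2 N. \<Sum>w\<in>multi k2 N.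
          cnj (T w) * (tensor_act k1 g y y' * tensor_act k2 g w z * ind p (merge y' z)))"
    proof (rule sum.cong[OF refl])
      fix y' assume "y' \<in> multi k1 N"
      have "F y' = (\<Sum>z\<in>multi k2 N. (\<Sum>w\<in>multi k2 N. tensor_act k2 g w z * cnj (T w)) * ind p (merge y' z))"
        unfolding F by (intro sum.cong refl arg_cong2[of _ _ _ _ times] cT)
      then show "tensor_act k1 g y y' * F y' = (\<Sum>z\<in>multi k2 N. \<Sum>w\<in>multi k2 N.
          cnj (T w) * (tensor_act k1 g y y' * tensor_act k2 g w z * ind p (merge y' z)))"
        by (simp add: sum_distrib_left sum_distrib_right mult_ac)
    qed
    also have "\<dots> = (\<Sum>y'\<in>multi k1 N. \<Sum>w\<in>multi k2 N. \<Sum>z\<in>multi k2 N.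
          cnj (T w) * (tensor_act k1 g y y' * tensor_act k2 g w z * ind p (merge y' z)))"
      by (rule sum.cong[OF refl], rule sum.swap)
    also have "\<dots> = (\<Sum>w\<in>multi k2 N. \<Sum>y'\<in>multi k1 N. \<Sum>z\<in>multi k2 N.
          cnj (T w) * (tensor_act k1 g y y' * tensor_act k2 g w z * ind p (merge y' z)))"
      by (rule sum.swap)
    also have "\<dots> = (\<Sum>w\<in>multi k2 N. cnj (T w) * ind p (merge y w))"
    proof (intro sum.cong refl)
      fix w assume w: "w \<in> multi k2 N"
      have "ind p (merge y w) = (\<Sum>x\<in>multi k N. tensor_act k g (merge y w) x * ind p x)"
        using ind_invariant[OF p, of N] g merge_multi[OF y w] unfolding invariant_tensor_def by blast
      also have "\<dots> = (\<Sum>y'\<in>multi k1 N. \<Sum>z\<in>multi k2 N.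
          tensor_act k1 g y y' * tensor_act k2 g w z * ind p (merge y' z))"
        unfolding sum_multi using y w by (intro sum.cong refl) (simp add: tensor_act_split)
      finally show "(\<Sum>y'\<in>multi k1 N. \<Sum>z\<in>multi k2 N.
          cnj (T w) * (tensor_act k1 g y y' * tensor_act k2 g w z * ind p (merge y' z))) =
          cnj (T w) * ind p (merge y w)"
        by (simp add: sum_distrib_left)
    qed
    finally show "F y = (\<Sum>y'\<in>multi k1 N. tensor_act k1 g y y' * F y')" by (simp add: F)
  qed
  then obtain c where c: "\<And>y. y \<in> multi k1 N \<Longrightarrow> F y = (\<Sum>q\<in>parts A k1. c q * ind q y)"
    using invariant_tensor_span[OF _ N] by blast
  have "(\<Sum>z\<in>multi k2 N. T z * ind p (merge y z)) = (\<Sum>q\<in>parts A k1. cnj (c q) * ind q y)"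
    if "y \<in> multi k1 N" for y
  proof -
    have "(\<Sum>z\<in>multi k2 N. T z * ind p (merge y z)) = cnj (F y)" by (simp only: F_def complex_cnj_cnj)
    also have "\<dots> = (\<Sum>q\<in>parts A k1. cnj (c q) * ind q y)"
      unfolding c[OF that] by (simp add: ind_def)
    finally show ?thesis .
  qed
  then show ?thesis by (intro exI[of _ "\<lambda>q. cnj (c q)"] ballI)
qed

lemma joint_pairing:
  assumes T: "invariant_tensor A k2 N T" and p: "p \<in> parts A k" and N: "2 * k1 + 2 \<le> N"
    and cT: "\<And>z. z \<in> multi k2 N \<Longrightarrow> T z = (\<Sum>q\<in>parts A k2. c2 q * ind q z)"
    and cS: "\<And>r. r \<in> parts A k1 \<Longrightarrow> (\<Sum>y\<in>multi k1 N. S y * ind r y) =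
      (\<Sum>q\<in>parts A k1. c1 q * of_nat (N ^ nc (part_join k1 q r)))"
  shows "(\<Sum>x\<in>multi k N. S (restr \<alpha> k1 x) * T (restr \<beta> k2 x) * ind p x) =
    (\<Sum>q1\<in>parts A k1. \<Sum>q2\<in>parts A k2. c1 q1 * c2 q2 * of_nat (N ^ nc (part_join k (glue \<alpha> \<beta> q1 q2) p)))"
proof -
  let ?S = "\<lambda>y. \<Sum>q\<in>parts A k1. c1 q * ind q y"
  have part: "q \<in> parts A k' \<Longrightarrow> q \<in> partitions k'" for q k' by (simp add: parts_iff)
  obtain c where c: "\<And>y. y \<in> multi k1 N \<Longrightarrow>
      (\<Sum>z\<in>multi k2 N. T z * ind p (merge y z)) = (\<Sum>r\<in>parts A k1. c r * ind r y)"
    using contraction_span[OF T p N] by blast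
  have pair: "(\<Sum>y\<in>multi k1 N. S' y * (\<Sum>r\<in>parts A k1. c r * ind r y)) =
      (\<Sum>r\<in>parts A k1. c r * (\<Sum>y\<in>multi k1 N. S' y * ind r y))" for S'
    by (simp add: sum_distrib_left mult.left_commute) (rule sum.swap)
  have eqS: "(\<Sum>y\<in>multi k1 N. S y * ind r y) = (\<Sum>y\<in>multi k1 N. ?S y * ind r y)"
    if r: "r \<in> parts A k1" for r
  proof -
    have "(\<Sum>y\<in>multi k1 N. ?S y * ind r y) = (\<Sum>q\<in>parts A k1. c1 q * (\<Sum>y\<in>multi k1 N. ind q y * ind r y))"
      by (simp add: sum_distrib_left sum_distrib_right mult.assoc) (rule sum.swap)
    then show ?thesis using cS[OF r] r by (simp add: nc_join_pairing part)
  qed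
  have "(\<Sum>x\<in>multi k N. S (restr \<alpha> k1 x) * T (restr \<beta> k2 x) * ind p x) =
      (\<Sum>y\<in>multi k1 N. S y * (\<Sum>z\<in>multi k2 N. T z * ind p (merge y z)))"
    unfolding sum_multi by (simp add: restr_merge sum_distrib_left mult.assoc)
  also have "\<dots> = (\<Sum>y\<in>multi k1 N. S y * (\<Sum>r\<in>parts A k1. c r * ind r y))"
    by (intro sum.cong refl) (simp add: c)
  also have "\<dots> = (\<Sum>y\<in>multi k1 N. ?S y * (\<Sum>r\<in>parts A k1. c r * ind r y))"
    unfolding pair by (intro sum.cong refl) (simp add: eqS)
  \<comment> \<open>The contraction is unfolded again only after \<open>S\<close> has been replaced;
    now both factors are explicit combinations of indicators, and their products are indicators of
    glued partitions.\<close>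
  also have "\<dots> = (\<Sum>y\<in>multi k1 N. ?S y * (\<Sum>z\<in>multi k2 N. (\<Sum>q\<in>parts A k2. c2 q * ind q z) * ind p (merge y z)))"
    by (intro sum.cong refl arg_cong2[of _ _ _ _ times]) (simp only: c[symmetric], intro sum.cong refl arg_cong2[of _ _ _ _ times] cT)
  also have "\<dots> = (\<Sum>y\<in>multi k1 N. \<Sum>z\<in>multi k2 N. \<Sum>q1\<in>parts A k1. \<Sum>q2\<in>parts A k2.
      c1 q1 * c2 q2 * (ind q1 y * ind q2 z * ind p (merge y z)))"
  proof (rule sum.cong[OF refl])
    fix y
    have "?S y * ((\<Sum>q\<in>parts A k2. c2 q * ind q z) * P) = (\<Sum>q1\<in>parts A k1. \<Sum>q2\<in>parts A k2.
      c1 q1 * c2 q2 * (ind q1 y * ind q2 z * P))" for z P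
      unfolding mult.assoc[symmetric] sum_product
      by (simp add: sum_distrib_left sum_distrib_right mult_ac)
    then show "?S y * (\<Sum>z\<in>multi k2 N. (\<Sum>q\<in>parts A k2. c2 q * ind q z) * ind p (merge y z)) =
      (\<Sum>z\<in>multi k2 N. \<Sum>q1\<in>parts A k1. \<Sum>q2\<in>parts A k2.
        c1 q1 * c2 q2 * (ind q1 y * ind q2 z * ind p (merge y z)))"
      by (simp only: sum_distrib_left[of "?S y"])
  qed
  also have "\<dots> = (\<Sum>y\<in>multi k1 N. \<Sum>z\<in>multi k2 N. \<Sum>q1\<in>parts A k1. \<Sum>q2\<in>parts A k2.
      c1 q1 * c2 q2 * (ind (glue \<alpha> \<beta> q1 q2) (merge y z) * ind p (merge y z)))"
    by (intro sum.cong refl) (simp add: ind_glue part)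
  also have "\<dots> = (\<Sum>x\<in>multi k N. \<Sum>q1\<in>parts A k1. \<Sum>q2\<in>parts A k2.
      c1 q1 * c2 q2 * (ind (glue \<alpha> \<beta> q1 q2) x * ind p x))"
    by (simp only: sum_multi)
  also have "\<dots> = (\<Sum>q1\<in>parts A k1. \<Sum>x\<in>multi k N. \<Sum>q2\<in>parts A k2.
      c1 q1 * c2 q2 * (ind (glue \<alpha> \<beta> q1 q2) x * ind p x))"
    by (rule sum.swap)
  also have "\<dots> = (\<Sum>q1\<in>parts A k1. \<Sum>q2\<in>parts A k2. \<Sum>x\<in>multi k N.
      c1 q1 * c2 q2 * (ind (glue \<alpha> \<beta> q1 q2) x * ind p x))"
    by (rule sum.cong[OF refl], rule sum.swap)
  also have "\<dots> = (\<Sum>q1\<in>parts A k1. \<Sum>q2\<in>parts A k2.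
      c1 q1 * c2 q2 * of_nat (N ^ nc (part_join k (glue \<alpha> \<beta> q1 q2) p)))"
    unfolding sum_distrib_left[symmetric]
    by (intro sum.cong refl) (simp add: nc_join_pairing glue_partition part p)
  finally show ?thesis .
qed

end

section \<open>Traces of tensor products\<close>

lemma kron_carrier:
  "A \<in> carrier_mat n n \<Longrightarrow> B \<in> carrier_mat m m \<Longrightarrow> kron A B \<in> carrier_mat (n * m) (n * m)"
  by (simp add: kron_def)

lemma sum_lessThan_mult:
  fixes f :: "nat \<Rightarrow> nat \<Rightarrow> 'a :: comm_monoid_add"
  shows "(\<Sum>i<n * m. f (i div m) (i mod m)) = (\<Sum>a<n. \<Sum>b<m. f a b)"
proof -
  have "(\<Sum>i<n * m. f (i div m) (i mod m)) = (\<Sum>u\<in>{..<n} \<times> {..<m}. f (fst u) (snd u))"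
  proof (rule sum.reindex_bij_witness[where i = "\<lambda>u. fst u * m + snd u" and j = "\<lambda>i. (i div m, i mod m)"])
    fix i assume i: "i \<in> {..<n * m}"
    then have "m > 0" by (cases m) auto
    then show "(i div m, i mod m) \<in> {..<n} \<times> {..<m}"
      using i by (simp add: less_mult_imp_div_less)
  next
    fix u assume u: "u \<in> {..<n} \<times> {..<m}"
    have "fst u * m + snd u < (fst u + 1) * m" using u by auto
    also have "\<dots> \<le> n * m" using u by (intro mult_right_mono) auto
    finally show "fst u * m + snd u \<in> {..<n * m}" by simp
    show "((fst u * m + snd u) div m, (fst u * m + snd u) mod m) = u"
      using u by (cases u) auto
  qed simp_all
  then show ?thesis by (simp add: sum.cartesian_product case_prod_beta)
qed

lemma tr_mult:
  assumes "A \<in> carrier_mat n n" "B \<in> carrier_mat n n"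
  shows "tr (A * B) = (\<Sum>i<n. \<Sum>j<n. A $$ (i, j) * B $$ (j, i))"
  using assms unfolding tr_def
  by (auto simp: scalar_prod_def atLeast0LessThan intro!: sum.cong)

lemma tr_kron_mult:
  assumes "A \<in> carrier_mat n n" "C \<in> carrier_mat n n" "B \<in> carrier_mat m m" "D \<in> carrier_mat m m"
  shows "tr (kron A B * kron C D) = tr (A * C) * tr (B * D)"
proof -
  let ?f = "\<lambda>a a' b b'. A $$ (a, b) * B $$ (a', b') * (C $$ (b, a) * D $$ (b', a'))"
  have "tr (kron A B * kron C D) =
      (\<Sum>i<n * m. \<Sum>j<n * m. ?f (i div m) (i mod m) (j div m) (j mod m))"
    unfolding tr_mult[OF kron_carrier[OF assms(1,3)] kron_carrier[OF assms(2,4)]]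
    using assms by (intro sum.cong refl) (simp add: kron_def)
  also have "\<dots> = (\<Sum>i<n * m. \<Sum>b<n. \<Sum>b'<m. ?f (i div m) (i mod m) b b')"
    by (intro sum.cong refl sum_lessThan_mult)
  also have "\<dots> = (\<Sum>a<n. \<Sum>a'<m. \<Sum>b<n. \<Sum>b'<m. ?f a a' b b')"
    by (rule sum_lessThan_mult)
  also have "\<dots> = (\<Sum>a<n. \<Sum>b<n. \<Sum>a'<m. \<Sum>b'<m. ?f a a' b b')"
    by (rule sum.cong[OF refl], rule sum.swap)
  also have "\<dots> = (\<Sum>a<n. \<Sum>b<n. A $$ (a, b) * C $$ (b, a)) * (\<Sum>a'<m. \<Sum>b'<m. B $$ (a', b') * D $$ (b', a'))"
    unfolding sum_distrib_right by (unfold sum_distrib_left) (simp add: mult_ac)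
  finally show ?thesis by (simp add: tr_mult[OF assms(1,2)] tr_mult[OF assms(3,4)])
qed

lemma kron_list_Nil [simp]: "kron_list [] = 1\<^sub>m 1"
  and kron_list_Cons [simp]: "kron_list (A # As) = kron A (kron_list As)"
  by (simp_all add: kron_list_def)

lemma kron_list_carrier:
  "set As \<subseteq> carrier_mat N N \<Longrightarrow> kron_list As \<in> carrier_mat (N ^ length As) (N ^ length As)"
  by (induction As) (auto intro: kron_carrier)

lemma tr_kron_list_mult:
  assumes "length As = length Bs" "set As \<subseteq> carrier_mat N N" "set Bs \<subseteq> carrier_mat N N"
  shows "tr (kron_list As * kron_list Bs) = (\<Prod>l<length As. tr (As ! l * Bs ! l))"
  using assms
proof (induction As Bs rule: list_induct2)
  case Nil
  then show ?case by (simp add: tr_def)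
next
  case (Cons A As B Bs)
  then have "tr (kron A (kron_list As) * kron B (kron_list Bs)) =
      tr (A * B) * tr (kron_list As * kron_list Bs)"
    using kron_list_carrier[of As N] kron_list_carrier[of Bs N]
    by (intro tr_kron_mult[of _ N _ _ "N ^ length As"]) auto
  then show ?case using Cons by (simp add: prod.lessThan_Suc_shift del: prod.lessThan_Suc)
qed

lemma matrix_unit_carrier [simp]: "matrix_unit N i j \<in> carrier_mat N N"
  by (simp add: matrix_unit_def)

lemma tr_mult_matrix_unit:
  assumes "A \<in> carrier_mat N N" "i < N" "j < N"
  shows "tr (A * matrix_unit N i j) = A $$ (j, i)"
proof -
  have "tr (A * matrix_unit N i j) = (\<Sum>a<N. \<Sum>b<N. A $$ (a, b) * matrix_unit N i j $$ (b, a))"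
    by (rule tr_mult[OF assms(1)]) (simp add: matrix_unit_def)
  also have "\<dots> = (\<Sum>a<N. \<Sum>b<N. if b = i then (if a = j then A $$ (j, i) else 0) else 0)"
    by (intro sum.cong refl) (auto simp: matrix_unit_def)
  also have "\<dots> = A $$ (j, i)" using assms by simp
  finally show ?thesis .
qed

lemma flip_flip [simp]: "flip (flip i) = i"
  by (cases i) auto

lemma flip_points: "flip i \<in> points k \<longleftrightarrow> i \<in> points k"
  by (cases i) (auto simp: points_iff)

lemma transp_partition:
  assumes "p \<in> partitions k"
  shows "transp p \<in> partitions k"
proof -
  have inj: "inj_on flip (points k)" by (metis flip_flip inj_onI)
  have im: "flip ` points k = points k"
  proof
    show "points k \<subseteq> flip ` points k"
    proof
      fix i assume "i \<in> points k"
      then have "i = flip (flip i)" "flip i \<in> points k" by (simp_all add: flip_points)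
      then show "i \<in> flip ` points k" by (rule image_eqI)
    qed
  qed (auto simp: flip_points)
  have "{} \<notin> image flip ` p" using block_nonempty[OF assms] by blast
  then show ?thesis
    using partition_on_inj_image[OF _ inj, of p] assms
    by (simp add: partitions_def transp_def im)
qed

lemma const_on_transp:
  assumes "p \<in> partitions k"
  shows "const_on (transp p) x \<longleftrightarrow> const_on p (\<lambda>i\<in>points k. x (flip i))"
proof -
  have "const_on (transp p) x \<longleftrightarrow> const_on p (\<lambda>i. x (flip i))"
    unfolding transp_def const_on_def by (simp only: Ball_image_comp comp_def)
  also have "\<dots> \<longleftrightarrow> const_on p (\<lambda>i\<in>points k. x (flip i))"
    unfolding const_on_def
  proof (intro ball_cong refl)
    fix b i j assume "b \<in> p" "i \<in> b" "j \<in> b"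
    then have "i \<in> points k" "j \<in> points k" using block_subset[OF assms] by blast+
    then show "(x (flip i) = x (flip j)) =
      ((\<lambda>i\<in>points k. x (flip i)) i = (\<lambda>i\<in>points k. x (flip i)) j)" by simp
  qed
  finally show ?thesis .
qed

text \<open>Each summand of \<open>rho\<close> is a tensor product of matrix units, whose trace
  against the product of the \<open>As\<close> is a product of single entries. Exchanging the two
  rows of the index replaces the transposed partition by \<open>p\<close> and puts bottom values
  into row position.\<close>

lemma tr_kron_list_rho:
  assumes As: "set As \<subseteq> carrier_mat N N" and k: "length As = k" and p: "p \<in> partitions k"
  shows "tr (kron_list As * rho N k (transp p)) =
    (\<Sum>x\<in>multi k N. (\<Prod>l<k. (As ! l) $$ (x (Bot l), x (Top l))) * ind p x)"
proof -
  let ?E = "\<lambda>I. kron_list (map (\<lambda>l. matrix_unit N (I (Bot l)) (I (Top l))) [0..<k])"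
  let ?X = "{I \<in> multi k N. const_on (transp p) I}"
  let ?n = "N ^ k"
  have E: "?E I \<in> carrier_mat ?n ?n" for I
    using kron_list_carrier[of "map (\<lambda>l. matrix_unit N (I (Bot l)) (I (Top l))) [0..<k]" N]
    by (simp add: image_subset_iff)
  have K: "kron_list As \<in> carrier_mat ?n ?n" using kron_list_carrier[OF As] k by simp
  have X: "{I \<in> points k \<rightarrow>\<^sub>E {..<N}. coarser k (transp p) (Ker k I)} = ?X"
    using coarser_Ker[OF transp_partition[OF p]] by (auto simp: multi_def)
  have "tr (kron_list As * rho N k (transp p)) =
      (\<Sum>i<?n. \<Sum>j<?n. kron_list As $$ (i, j) * (\<Sum>I\<in>?X. ?E I $$ (j, i)))"
    by (subst tr_mult[OF K]) (auto simp: rho_def X intro!: sum.cong)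
  also have "\<dots> = (\<Sum>i<?n. \<Sum>I\<in>?X. \<Sum>j<?n. kron_list As $$ (i, j) * ?E I $$ (j, i))"
    unfolding sum_distrib_left by (intro sum.cong refl, rule sum.swap)
  also have "\<dots> = (\<Sum>I\<in>?X. tr (kron_list As * ?E I))"
    unfolding tr_mult[OF K E] by (rule sum.swap)
  also have "\<dots> = (\<Sum>I\<in>?X. \<Prod>l<k. (As ! l) $$ (I (Top l), I (Bot l)))"
  proof (rule sum.cong[OF refl])
    fix I assume I: "I \<in> ?X"
    have "tr (kron_list As * ?E I) = (\<Prod>l<k. tr (As ! l * matrix_unit N (I (Bot l)) (I (Top l))))"
      using As k by (subst tr_kron_list_mult[of _ _ N]) auto
    also have "\<dots> = (\<Prod>l<k. (As ! l) $$ (I (Top l), I (Bot l)))"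
    proof (intro prod.cong refl tr_mult_matrix_unit)
      fix l assume l: "l \<in> {..<k}"
      show "As ! l \<in> carrier_mat N N" using As k l by (auto simp: subset_iff)
      show "I (Bot l) < N" "I (Top l) < N"
        using I l multi_less[of I k N] by (auto simp: points_iff)
    qed
    finally show "tr (kron_list As * ?E I) = (\<Prod>l<k. (As ! l) $$ (I (Top l), I (Bot l)))" .
  qed
  also have "\<dots> = (\<Sum>x\<in>{x \<in> multi k N. const_on p x}. \<Prod>l<k. (As ! l) $$ (x (Bot l), x (Top l)))"
  proof -
    let ?r = "\<lambda>x. \<lambda>i\<in>points k. x (flip i)"
    have rr: "?r (?r x) = x" if "x \<in> multi k N" for x
      using that by (auto simp: multi_def PiE_def extensional_def flip_points)
    have rm: "?r x \<in> multi k N" if "x \<in> multi k N" for x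
      using multi_less[OF that] by (auto simp: multi_def flip_points)
    show ?thesis
    proof (rule sum.reindex_bij_witness[where i = ?r and j = ?r])
      fix x assume x: "x \<in> {x \<in> multi k N. const_on p x}"
      then have "const_on p (?r (?r x))" by (simp only: rr mem_Collect_eq)
      then show "?r x \<in> ?X" using rm x const_on_transp[OF p, of "?r x"] by blast
      show "?r (?r x) = x" using x rr by blast
    next
      fix x assume x: "x \<in> ?X"
      then show "?r x \<in> {x \<in> multi k N. const_on p x}" using rm const_on_transp[OF p] by blast
      show "?r (?r x) = x" using x rr by blast
      show "(\<Prod>l<k. (As ! l) $$ (?r x (Bot l), ?r x (Top l))) = (\<Prod>l<k. (As ! l) $$ (x (Top l), x (Bot l)))"
        by (intro prod.cong refl) (simp add: points_iff)
    qed
  qed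
  also have "\<dots> = (\<Sum>x\<in>multi k N. (\<Prod>l<k. (As ! l) $$ (x (Bot l), x (Top l))) * ind p x)"
    by (rule sum_ind[symmetric])
  finally show ?thesis .
qed

section \<open>Random matrices\<close>

lemma mat_borel_entry [measurable]:
  assumes "i < N" "j < N"
  shows "(\<lambda>A. A $$ (i, j)) \<in> borel_measurable (mat_borel N)"
proof -
  have "(\<lambda>A. \<lambda>ij \<in> {..<N} \<times> {..<N}. A $$ ij) \<in>
      measurable (mat_borel N) (PiM ({..<N} \<times> {..<N}) (\<lambda>_. borel :: complex measure))"
    unfolding mat_borel_def by (rule measurable_vimage_algebra1) (auto simp: space_PiM)
  then have "(\<lambda>A. (\<lambda>ij \<in> {..<N} \<times> {..<N}. A $$ ij) (i, j)) \<in> borel_measurable (mat_borel N)"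
    by (rule measurable_compose[OF _ measurable_component_singleton]) (use assms in auto)
  then show ?thesis using assms by simp
qed

lemma PiM_mat_borel_entry:
  assumes "l \<in> S" "i < N" "j < N"
  shows "(\<lambda>w. w l $$ (i, j)) \<in> borel_measurable (PiM S (\<lambda>_. mat_borel N))"
proof -
  have "(\<lambda>w. w l) \<in> measurable (PiM S (\<lambda>_. mat_borel N)) (mat_borel N)"
    by (rule measurable_component_singleton[OF assms(1)])
  then show ?thesis by (rule measurable_compose) (rule mat_borel_entry[OF assms(2,3)])
qed

lemma measurable_mat_borelI:
  assumes "\<And>\<omega>. \<omega> \<in> space M \<Longrightarrow> X \<omega> \<in> carrier_mat N N"
    and "\<And>i j. i < N \<Longrightarrow> j < N \<Longrightarrow> (\<lambda>\<omega>. X \<omega> $$ (i, j)) \<in> borel_measurable M"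
  shows "X \<in> measurable M (mat_borel N)"
  unfolding mat_borel_def
proof (rule measurable_vimage_algebra2)
  show "X \<in> space M \<rightarrow> carrier_mat N N" using assms(1) by auto
  show "(\<lambda>\<omega>. \<lambda>ij\<in>{..<N} \<times> {..<N}. X \<omega> $$ ij) \<in> measurable M (PiM ({..<N} \<times> {..<N}) (\<lambda>_. borel))"
    by (rule measurable_restrict) (use assms(2) in auto)
qed

lemma random_matrix_carrier:
  "random_matrix M N X \<Longrightarrow> \<omega> \<in> space M \<Longrightarrow> X \<omega> \<in> carrier_mat N N"
  unfolding random_matrix_def by (auto dest: measurable_space simp: mat_borel_def)

lemma random_matrix_entry:
  "random_matrix M N X \<Longrightarrow> i < N \<Longrightarrow> j < N \<Longrightarrow> (\<lambda>\<omega>. X \<omega> $$ (i, j)) \<in> borel_measurable M"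
  unfolding random_matrix_def using measurable_compose[OF _ mat_borel_entry] by blast

text \<open>The product is at most the \<open>k\<close>-th power of its largest factor; the summand
  1 serves the empty product. Finite moments of single entries thus dominate mixed products.\<close>

lemma prod_le_sum_power:
  fixes a :: "nat \<Rightarrow> real"
  assumes "\<And>l. l < k \<Longrightarrow> 0 \<le> a l"
  shows "(\<Prod>l<k. a l) \<le> 1 + (\<Sum>l<k. a l ^ k)"
proof (cases "k = 0")
  case False
  then have "Max (a ` {..<k}) \<in> a ` {..<k}" by (intro Max_in) auto
  then obtain m where m: "m < k" "Max (a ` {..<k}) = a m" by auto
  then have m: "m < k" "\<And>l. l < k \<Longrightarrow> a l \<le> a m" by (metis Max_ge finite_imageI finite_lessThan image_eqI lessThan_iff)+
  have "(\<Prod>l<k. a l) \<le> (\<Prod>l<k. a m)" using assms m by (intro prod_mono) auto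
  also have "\<dots> = a m ^ k" by simp
  also have "\<dots> \<le> (\<Sum>l<k. a l ^ k)" using m assms by (intro member_le_sum) auto
  finally show ?thesis by simp
qed simp

lemma integrable_prod_entries:
  fixes k :: nat
  assumes "prob_space M" and X: "\<And>l. l < k \<Longrightarrow> random_matrix M N (X l)"
    and ab: "\<And>l. l < k \<Longrightarrow> a l < N \<and> b l < N"
  shows "integrable M (\<lambda>\<omega>. \<Prod>l<k. X l \<omega> $$ (a l, b l))"
proof -
  interpret prob_space M by fact
  have pw: "integrable M (\<lambda>\<omega>. cmod (X l \<omega> $$ (a l, b l)) ^ k)" if "l < k" for l
    using X[OF that] ab[OF that] unfolding random_matrix_def by blast
  have "integrable M (\<lambda>\<omega>. 1 + (\<Sum>l<k. cmod (X l \<omega> $$ (a l, b l)) ^ k))"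
    by (intro Bochner_Integration.integrable_add Bochner_Integration.integrable_sum) (use pw in auto)
  then show ?thesis
  proof (rule Bochner_Integration.integrable_bound)
    show "(\<lambda>\<omega>. \<Prod>l<k. X l \<omega> $$ (a l, b l)) \<in> borel_measurable M"
      by (intro borel_measurable_prod) (use random_matrix_entry X ab in blast)
    have "norm (\<Prod>l<k. X l \<omega> $$ (a l, b l)) \<le> norm (1 + (\<Sum>l<k. cmod (X l \<omega> $$ (a l, b l)) ^ k))" for \<omega>
      using prod_le_sum_power[of k "\<lambda>l. cmod (X l \<omega> $$ (a l, b l))"]
      by (simp add: prod_norm[symmetric])
    then show "AE \<omega> in M. norm (\<Prod>l<k. X l \<omega> $$ (a l, b l)) \<le>
        norm (1 + (\<Sum>l<k. cmod (X l \<omega> $$ (a l, b l)) ^ k))" by simp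
  qed
qed

text \<open>
  Indices are read transposed with respect to \<^const>\<open>rho\<close>; this absorbs the \<^const>\<open>transp\<close>
  in \<^const>\<open>moment\<close>.
\<close>

definition expect_tensor :: "'w measure \<Rightarrow> ('w \<Rightarrow> complex mat) list \<Rightarrow> (point \<Rightarrow> nat) \<Rightarrow> complex" where
  "expect_tensor M Bs x = (\<integral>\<omega>. (\<Prod>l<length Bs. (Bs ! l) \<omega> $$ (x (Bot l), x (Top l))) \<partial>M)"

lemma moment_expect_tensor:
  assumes "prob_space M" and Bs: "\<And>B. B \<in> set Bs \<Longrightarrow> random_matrix M N B"
    and p: "p \<in> partitions (length Bs)"
  shows "moment M N p Bs =
    (\<Sum>x\<in>multi (length Bs) N. expect_tensor M Bs x * ind p x) / of_nat (N ^ nc (cycles_of (length Bs) p))"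
proof -
  let ?k = "length Bs"
  have int: "integrable M (\<lambda>\<omega>. \<Prod>l<?k. (Bs ! l) \<omega> $$ (x (Bot l), x (Top l)))" if "x \<in> multi ?k N" for x
    by (rule integrable_prod_entries[OF assms(1), where N = N]) (use Bs multi_less[OF that] in \<open>auto simp: points_iff\<close>)
  have "(\<integral>\<omega>. tr (kron_list (map (\<lambda>B. B \<omega>) Bs) * rho N ?k (transp p)) \<partial>M) =
      (\<integral>\<omega>. (\<Sum>x\<in>multi ?k N. (\<Prod>l<?k. (Bs ! l) \<omega> $$ (x (Bot l), x (Top l))) * ind p x) \<partial>M)"
  proof (rule Bochner_Integration.integral_cong[OF refl])
    fix \<omega> assume w: "\<omega> \<in> space M"
    have "set (map (\<lambda>B. B \<omega>) Bs) \<subseteq> carrier_mat N N"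
      using Bs random_matrix_carrier[OF _ w] by auto
    then have "tr (kron_list (map (\<lambda>B. B \<omega>) Bs) * rho N ?k (transp p)) =
      (\<Sum>x\<in>multi ?k N. (\<Prod>l<?k. (map (\<lambda>B. B \<omega>) Bs ! l) $$ (x (Bot l), x (Top l))) * ind p x)"
      by (rule tr_kron_list_rho) (use p in simp_all)
    then show "tr (kron_list (map (\<lambda>B. B \<omega>) Bs) * rho N ?k (transp p)) =
      (\<Sum>x\<in>multi ?k N. (\<Prod>l<?k. (Bs ! l) \<omega> $$ (x (Bot l), x (Top l))) * ind p x)" by simp
  qed
  also have "\<dots> = (\<Sum>x\<in>multi ?k N. expect_tensor M Bs x * ind p x)"
    using int by (subst Bochner_Integration.integral_sum) (auto simp: expect_tensor_def)
  finally show ?thesis by (simp add: moment_def)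
qed

section \<open>Invariance of the law as invariance of the expected tensor\<close>

lemma prod_points_columns:
  fixes f :: "point \<Rightarrow> 'a :: comm_monoid_mult"
  shows "(\<Prod>i\<in>points k. f i) = (\<Prod>l<k. f (Bot l) * f (Top l))"
proof -
  have "(\<Prod>i\<in>points k. f i) = (\<Prod>i\<in>Top ` {..<k}. f i) * (\<Prod>i\<in>Bot ` {..<k}. f i)"
    unfolding points_def by (rule prod.union_disjoint) auto
  then show ?thesis by (simp add: prod.reindex inj_on_def prod.distrib mult.commute)
qed

lemma sum_multi_columns:
  fixes h :: "nat \<Rightarrow> nat \<Rightarrow> nat \<Rightarrow> 'a :: comm_semiring_1"
  shows "(\<Sum>y\<in>multi k N. \<Prod>l<k. h l (y (Bot l)) (y (Top l))) = (\<Prod>l<k. \<Sum>a<N. \<Sum>b<N. h l a b)"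
proof -
  have "(\<Prod>l<k. \<Sum>a<N. \<Sum>b<N. h l a b) = (\<Prod>l<k. \<Sum>u\<in>{..<N} \<times> {..<N}. h l (fst u) (snd u))"
    by (simp add: sum.cartesian_product case_prod_beta)
  also have "\<dots> = (\<Sum>f\<in>{..<k} \<rightarrow>\<^sub>E {..<N} \<times> {..<N}. \<Prod>l<k. h l (fst (f l)) (snd (f l)))"
    by (rule prod_sum_PiE) auto
  also have "\<dots> = (\<Sum>y\<in>multi k N. \<Prod>l<k. h l (y (Bot l)) (y (Top l)))"
  proof (rule sum.reindex_bij_witness[where i = "\<lambda>y. \<lambda>l\<in>{..<k}. (y (Bot l), y (Top l))"
        and j = "\<lambda>f. \<lambda>i\<in>points k. case i of Bot l \<Rightarrow> fst (f l) | Top l \<Rightarrow> snd (f l)"])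
    fix f assume f: "f \<in> {..<k} \<rightarrow>\<^sub>E {..<N} \<times> {..<N}"
    have fl: "fst (f l) < N" "snd (f l) < N" if "l < k" for l
      using f that by (auto simp: PiE_iff mem_Times_iff)
    let ?y = "\<lambda>i\<in>points k. case i of Bot l \<Rightarrow> fst (f l) | Top l \<Rightarrow> snd (f l)"
    show "(\<lambda>l\<in>{..<k}. (?y (Bot l), ?y (Top l))) = f"
      using f by (intro ext) (auto simp: points_iff PiE_def extensional_def)
    show "?y \<in> multi k N"
      using fl by (auto simp: multi_def points_iff split: point.split)
    show "(\<Prod>l<k. h l (?y (Bot l)) (?y (Top l))) = (\<Prod>l<k. h l (fst (f l)) (snd (f l)))"
      by (intro prod.cong refl) (simp add: points_iff)
  next
    fix y assume y: "y \<in> multi k N"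
    show "(\<lambda>l\<in>{..<k}. (y (Bot l), y (Top l))) \<in> {..<k} \<rightarrow>\<^sub>E {..<N} \<times> {..<N}"
      using multi_less[OF y] by (auto simp: points_iff)
    show "(\<lambda>i\<in>points k. case i of Bot l \<Rightarrow> fst ((\<lambda>l\<in>{..<k}. (y (Bot l), y (Top l))) l)
        | Top l \<Rightarrow> snd ((\<lambda>l\<in>{..<k}. (y (Bot l), y (Top l))) l)) = y"
      using y by (intro ext) (auto simp: multi_def PiE_def extensional_def points_iff split: point.split)
  qed
  finally show ?thesis by simp
qed

lemma mult_entry:
  assumes "A \<in> carrier_mat n n" "B \<in> carrier_mat n n" "a < n" "b < n"
  shows "(A * B) $$ (a, b) = (\<Sum>c<n. A $$ (a, c) * B $$ (c, b))"
  using assms by (auto simp: scalar_prod_def atLeast0LessThan intro!: sum.cong)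

lemma unitary_conj_entry:
  assumes g: "g \<in> carrier_mat N N" and X: "X \<in> carrier_mat N N" and ab: "a < N" "b < N"
  shows "(g * X * mat_adjoint g) $$ (a, b) = (\<Sum>c<N. \<Sum>d<N. g $$ (a, c) * cnj (g $$ (b, d)) * X $$ (c, d))"
proof -
  have h: "mat_adjoint g \<in> carrier_mat N N" using g by (rule mat_adjoint_carrier)
  have gX: "g * X \<in> carrier_mat N N" using g X by simp
  have "(g * X * mat_adjoint g) $$ (a, b) = (\<Sum>d<N. (g * X) $$ (a, d) * mat_adjoint g $$ (d, b))"
    by (rule mult_entry[OF gX h ab])
  also have "\<dots> = (\<Sum>d<N. (\<Sum>c<N. g $$ (a, c) * X $$ (c, d)) * cnj (g $$ (b, d)))"
    using g ab by (intro sum.cong refl) (simp add: mult_entry[OF g X] del: index_mult_mat)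
  also have "\<dots> = (\<Sum>d<N. \<Sum>c<N. g $$ (a, c) * cnj (g $$ (b, d)) * X $$ (c, d))"
    by (simp add: sum_distrib_left sum_distrib_right mult_ac)
  also have "\<dots> = (\<Sum>c<N. \<Sum>d<N. g $$ (a, c) * cnj (g $$ (b, d)) * X $$ (c, d))"
    by (rule sum.swap)
  finally show ?thesis .
qed

text \<open>An entry of the tensor is the integral of one measurable function \<open>f\<close> of
  the tuple of matrices, so it depends on the law of the tuple only. Evaluating \<open>f\<close> at
  the conjugated tuple expands into the action of \<open>g\<close>.\<close>

lemma expect_tensor_invariant:
  assumes "prob_space M" and L: "\<And>j. j \<in> J \<Longrightarrow> random_matrix M N (L j)"
    and inv: "invariant_family A M N J L" and js: "js \<in> lists J"
  shows "invariant_tensor A (length js) N (expect_tensor M (map L js))"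
  unfolding invariant_tensor_def
proof (intro ballI)
  let ?k = "length js"
  let ?P = "PiM {..<?k} (\<lambda>_. mat_borel N)"
  fix g x assume g: "g \<in> matrix_group A N" and x: "x \<in> multi ?k N"
  have u: "g \<in> unitary_group N" using g matrix_group_subset_unitary by blast
  then have gc: "g \<in> carrier_mat N N" by (simp add: unitary_group_def)
  have adj: "the (mat_inverse g) = mat_adjoint g" using mat_inverse_unitary[OF u] .
  have Lj: "random_matrix M N (L (js ! l))" if "l < ?k" for l
    using L js that by (auto simp: in_lists_conv_set)
  have xl: "x (Bot l) < N" "x (Top l) < N" if "l < ?k" for l
    using multi_less[OF x] that by (auto simp: points_iff)
  define f where "f w = (\<Prod>l<?k. w l $$ (x (Bot l), x (Top l)))" for w :: "nat \<Rightarrow> complex mat"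
  have fm: "f \<in> borel_measurable ?P"
    unfolding f_def
  proof (intro borel_measurable_prod)
    fix l assume l: "l \<in> {..<?k}"
    show "(\<lambda>w. w l $$ (x (Bot l), x (Top l))) \<in> borel_measurable ?P"
      by (rule PiM_mat_borel_entry) (use l xl in auto)
  qed
  have m1: "(\<lambda>\<omega>. \<lambda>l\<in>{..<?k}. L (js ! l) \<omega>) \<in> measurable M ?P"
    by (rule measurable_restrict) (use Lj in \<open>auto simp: random_matrix_def\<close>)
  have conj: "(g * L (js ! l) \<omega> * mat_adjoint g) $$ (a, b) =
      (\<Sum>c<N. \<Sum>d<N. g $$ (a, c) * cnj (g $$ (b, d)) * L (js ! l) \<omega> $$ (c, d))"
    if "l < ?k" "\<omega> \<in> space M" "a < N" "b < N" for l \<omega> a b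
    using unitary_conj_entry[OF gc random_matrix_carrier[OF Lj[OF that(1)] that(2)] that(3,4)] .
  have m2: "(\<lambda>\<omega>. \<lambda>l\<in>{..<?k}. g * L (js ! l) \<omega> * mat_adjoint g) \<in> measurable M ?P"
  proof (rule measurable_restrict)
    fix l assume "l \<in> {..<?k}"
    then have l: "l < ?k" by simp
    show "(\<lambda>\<omega>. g * L (js ! l) \<omega> * mat_adjoint g) \<in> measurable M (mat_borel N)"
    proof (rule measurable_mat_borelI)
      show "g * L (js ! l) \<omega> * mat_adjoint g \<in> carrier_mat N N" if "\<omega> \<in> space M" for \<omega>
        using gc random_matrix_carrier[OF Lj[OF l] that] mat_adjoint_carrier[OF gc] by auto
      fix a b assume ab: "a < N" "b < N"
      have "(\<lambda>\<omega>. \<Sum>c<N. \<Sum>d<N. g $$ (a, c) * cnj (g $$ (b, d)) * L (js ! l) \<omega> $$ (c, d)) \<in> borel_measurable M"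
        using random_matrix_entry[OF Lj[OF l]]
        by (intro borel_measurable_sum borel_measurable_times borel_measurable_const) auto
      then show "(\<lambda>\<omega>. (g * L (js ! l) \<omega> * mat_adjoint g) $$ (a, b)) \<in> borel_measurable M"
        using conj[OF l _ ab] by (subst measurable_cong) auto
    qed
  qed
  have int: "integrable M (\<lambda>\<omega>. \<Prod>l<?k. L (js ! l) \<omega> $$ (y (Bot l), y (Top l)))" if "y \<in> multi ?k N" for y
    by (rule integrable_prod_entries[OF assms(1), where N = N]) (use Lj multi_less[OF that] in \<open>auto simp: points_iff\<close>)
  have "expect_tensor M (map L js) x = (\<integral>\<omega>. f (\<lambda>l\<in>{..<?k}. L (js ! l) \<omega>) \<partial>M)"
    unfolding expect_tensor_def f_def
    by (simp cong: prod.cong_simp)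
  also have "\<dots> = integral\<^sup>L (distr M ?P (\<lambda>\<omega>. \<lambda>l\<in>{..<?k}. L (js ! l) \<omega>)) f"
    by (rule integral_distr[OF m1 fm, symmetric])
  also have "distr M ?P (\<lambda>\<omega>. \<lambda>l\<in>{..<?k}. L (js ! l) \<omega>) =
      distr M ?P (\<lambda>\<omega>. \<lambda>l\<in>{..<?k}. g * L (js ! l) \<omega> * mat_adjoint g)"
    using bspec[OF bspec[OF inv[unfolded invariant_family_def] g] js] unfolding adj by (rule sym)
  also have "integral\<^sup>L (distr M ?P (\<lambda>\<omega>. \<lambda>l\<in>{..<?k}. g * L (js ! l) \<omega> * mat_adjoint g)) f =
      (\<integral>\<omega>. f (\<lambda>l\<in>{..<?k}. g * L (js ! l) \<omega> * mat_adjoint g) \<partial>M)"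
    by (rule integral_distr[OF m2 fm])
  also have "\<dots> = (\<integral>\<omega>. (\<Sum>y\<in>multi ?k N. tensor_act ?k g x y * (\<Prod>l<?k. L (js ! l) \<omega> $$ (y (Bot l), y (Top l)))) \<partial>M)"
  proof (rule Bochner_Integration.integral_cong[OF refl])
    fix \<omega> assume w: "\<omega> \<in> space M"
    have "f (\<lambda>l\<in>{..<?k}. g * L (js ! l) \<omega> * mat_adjoint g) =
        (\<Prod>l<?k. \<Sum>c<N. \<Sum>d<N. g $$ (x (Bot l), c) * cnj (g $$ (x (Top l), d)) * L (js ! l) \<omega> $$ (c, d))"
      unfolding f_def by (intro prod.cong refl) (simp add: conj w xl)
    \<comment> \<open>Multiplying out one double sum per column creates a new multi-index, with
      \<open>g\<close> at its bottom values and the conjugate of \<open>g\<close> at its top values: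
      the factors of \<open>tensor_act\<close>.\<close>
    also have "\<dots> = (\<Sum>y\<in>multi ?k N. \<Prod>l<?k. g $$ (x (Bot l), y (Bot l)) * cnj (g $$ (x (Top l), y (Top l))) *
        L (js ! l) \<omega> $$ (y (Bot l), y (Top l)))"
      by (rule sum_multi_columns[symmetric])
    also have "\<dots> = (\<Sum>y\<in>multi ?k N. tensor_act ?k g x y * (\<Prod>l<?k. L (js ! l) \<omega> $$ (y (Bot l), y (Top l))))"
      by (simp add: tensor_act_def prod_points_columns twist_def prod.distrib)
    finally show "f (\<lambda>l\<in>{..<?k}. g * L (js ! l) \<omega> * mat_adjoint g) = \<dots>" .
  qed
  also have "\<dots> = (\<Sum>y\<in>multi ?k N. tensor_act ?k g x y * expect_tensor M (map L js) y)"
    using int by (subst Bochner_Integration.integral_sum) (auto simp: expect_tensor_def)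
  finally show "expect_tensor M (map L js) x =
      (\<Sum>y\<in>multi ?k N. tensor_act ?k g x y * expect_tensor M (map L js) y)" .
qed

section \<open>Independence as factorisation of the expected tensor\<close>

lemma (in column_split) prod_columns_split:
  fixes f :: "nat \<Rightarrow> 'b :: comm_monoid_mult"
  shows "(\<Prod>l<k. f l) = (\<Prod>l<k1. f (\<alpha> l)) * (\<Prod>l<k2. f (\<beta> l))"
proof -
  have "(\<Prod>l<k. f l) = (\<Prod>l\<in>\<alpha> ` {..<k1}. f l) * (\<Prod>l\<in>\<beta> ` {..<k2}. f l)"
    unfolding cover[symmetric] using disj by (intro prod.union_disjoint) auto
  then show ?thesis by (simp add: prod.reindex inj_\<alpha> inj_\<beta>)
qed

text \<open>Independence is given for the whole families, as random elements of two product spaces.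
  The products of entries of either kind are measurable functions \<open>f\<close> and
  \<open>h\<close> of finitely many coordinates there, hence independent, and finite moments make
  them integrable.\<close>

lemma (in column_split) expect_tensor_split:
  assumes "prob_space M" and X: "\<And>i. i \<in> I \<Longrightarrow> random_matrix M N (X i)"
    and L: "\<And>j. j \<in> J \<Longrightarrow> random_matrix M N (L j)"
    and ind: "independent_families M N I X J L"
    and ks: "ks \<in> lists I" "length ks = k1" and js: "js \<in> lists J" "length js = k2"
    and Bs: "length Bs = k" "\<And>l. l < k1 \<Longrightarrow> Bs ! \<alpha> l = X (ks ! l)" "\<And>l. l < k2 \<Longrightarrow> Bs ! \<beta> l = L (js ! l)"
    and x: "x \<in> multi k N"
  shows "expect_tensor M Bs x =
    expect_tensor M (map X ks) (restr \<alpha> k1 x) * expect_tensor M (map L js) (restr \<beta> k2 x)"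
proof -
  interpret prob_space M by fact
  let ?y = "restr \<alpha> k1 x" and ?z = "restr \<beta> k2 x"
  have y: "?y \<in> multi k1 N" and z: "?z \<in> multi k2 N" using restr_multi[OF x] by auto
  have isI: "ks ! l \<in> I" if "l < k1" for l using ks that by (auto simp: in_lists_conv_set)
  have jsJ: "js ! l \<in> J" if "l < k2" for l using js that by (auto simp: in_lists_conv_set)
  define f where "f w = (\<Prod>l<k1. w (ks ! l) $$ (?y (Bot l), ?y (Top l)))" for w :: "_ \<Rightarrow> complex mat"
  define h where "h w = (\<Prod>l<k2. w (js ! l) $$ (?z (Bot l), ?z (Top l)))" for w :: "_ \<Rightarrow> complex mat"
  have fm: "f \<in> borel_measurable (PiM I (\<lambda>_. mat_borel N))"
    unfolding f_def
  proof (intro borel_measurable_prod)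
    fix l assume l: "l \<in> {..<k1}"
    show "(\<lambda>w. w (ks ! l) $$ (?y (Bot l), ?y (Top l))) \<in> borel_measurable (PiM I (\<lambda>_. mat_borel N))"
      by (rule PiM_mat_borel_entry) (use l isI multi_less[OF y] in \<open>auto simp: points_iff\<close>)
  qed
  have hm: "h \<in> borel_measurable (PiM J (\<lambda>_. mat_borel N))"
    unfolding h_def
  proof (intro borel_measurable_prod)
    fix l assume l: "l \<in> {..<k2}"
    show "(\<lambda>w. w (js ! l) $$ (?z (Bot l), ?z (Top l))) \<in> borel_measurable (PiM J (\<lambda>_. mat_borel N))"
      by (rule PiM_mat_borel_entry) (use l jsJ multi_less[OF z] in \<open>auto simp: points_iff\<close>)
  qed
  let ?F = "\<lambda>\<omega>. \<Prod>l<k1. X (ks ! l) \<omega> $$ (?y (Bot l), ?y (Top l))"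
  let ?H = "\<lambda>\<omega>. \<Prod>l<k2. L (js ! l) \<omega> $$ (?z (Bot l), ?z (Top l))"
  have F: "f \<circ> (\<lambda>\<omega>. \<lambda>i\<in>I. X i \<omega>) = ?F" using isI by (auto simp: f_def fun_eq_iff intro!: prod.cong)
  have H: "h \<circ> (\<lambda>\<omega>. \<lambda>j\<in>J. L j \<omega>) = ?H" using jsJ by (auto simp: h_def fun_eq_iff intro!: prod.cong)
  have "indep_var borel ?F borel ?H"
    using indep_var_compose[OF ind[unfolded independent_families_def] fm hm] unfolding F H .
  moreover have "integrable M ?F"
    by (rule integrable_prod_entries[OF assms(1), where N = N]) (use X isI multi_less[OF y] in \<open>auto simp: points_iff\<close>)
  moreover have "integrable M ?H"
    by (rule integrable_prod_entries[OF assms(1), where N = N]) (use L jsJ multi_less[OF z] in \<open>auto simp: points_iff\<close>)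
  ultimately have "(\<integral>\<omega>. ?F \<omega> * ?H \<omega> \<partial>M) = (\<integral>\<omega>. ?F \<omega> \<partial>M) * (\<integral>\<omega>. ?H \<omega> \<partial>M)"
    by (rule indep_var_lebesgue_integral)
  moreover have "(\<Prod>l<length Bs. (Bs ! l) \<omega> $$ (x (Bot l), x (Top l))) = ?F \<omega> * ?H \<omega>" for \<omega>
    unfolding Bs(1) prod_columns_split
    by (intro arg_cong2[of _ _ _ _ times] prod.cong refl) (simp_all add: Bs restr_def points_iff)
  ultimately show ?thesis using ks js by (simp add: expect_tensor_def)
qed

section \<open>Asymptotic inversion\<close>

text \<open>A square linear system with trivial kernel has non-zero determinant. The matrix
  \<open>B\<close> carries the indices of \<open>W\<close> in reverse order, because the unknowns
  are paired with the first argument of \<open>W\<close>.\<close>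

lemma injective_imp_surjective:
  fixes W :: "'a \<Rightarrow> 'a \<Rightarrow> complex"
  assumes fin: "finite X"
    and inj: "\<And>\<kappa>. (\<And>p. p \<in> X \<Longrightarrow> (\<Sum>q\<in>X. \<kappa> q * W q p) = 0) \<Longrightarrow> (\<And>q. q \<in> X \<Longrightarrow> \<kappa> q = 0)"
  shows "\<exists>\<kappa>. \<forall>p\<in>X. m p = (\<Sum>q\<in>X. \<kappa> q * W q p)"
proof -
  define n where "n = card X"
  obtain e where e: "bij_betw e {..<n} X"
    using ex_bij_betw_nat_finite[OF fin] by (auto simp: n_def atLeast0LessThan)
  define e' where "e' = inv_into {..<n} e"
  have e': "e' q < n" "e (e' q) = q" if "q \<in> X" for q
    using e that bij_betw_inv_into_right[OF e that] inv_into_into[of q e "{..<n}"]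
    by (auto simp: e'_def bij_betw_def)
  have e'e: "e' (e i) = i" if "i < n" for i
    using bij_betw_inv_into_left[OF e, of i] that by (simp add: e'_def)
  have eX: "e i \<in> X" if "i < n" for i using e that by (auto simp: bij_betw_def)
  define B where "B = Matrix.mat n n (\<lambda>(i, j). W (e j) (e i))"
  have B: "B \<in> carrier_mat n n" by (simp add: B_def)
  have Bv: "(B *\<^sub>v v) $ i = (\<Sum>q\<in>X. v $ e' q * W q (e i))" if "v \<in> carrier_vec n" "i < n" for v i
  proof -
    have "(B *\<^sub>v v) $ i = (\<Sum>j<n. v $ j * W (e j) (e i))"
      using that by (auto simp: B_def scalar_prod_def atLeast0LessThan intro!: sum.cong)
    also have "\<dots> = (\<Sum>j<n. v $ e' (e j) * W (e j) (e i))" by (simp add: e'e)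
    also have "\<dots> = (\<Sum>q\<in>X. v $ e' q * W q (e i))" by (rule sum.reindex_bij_betw[OF e])
    finally show ?thesis .
  qed
  have "det B \<noteq> 0"
  proof
    assume "det B = 0"
    then obtain v where v: "v \<in> carrier_vec n" "v \<noteq> 0\<^sub>v n" "B *\<^sub>v v = 0\<^sub>v n"
      using det_0_iff_vec_prod_zero[OF B] by blast
    have "(\<Sum>q\<in>X. v $ e' q * W q p) = 0" if "p \<in> X" for p
      using Bv[OF v(1) e'(1)[OF that]] v(3) e'[OF that] by simp
    then have z: "v $ e' q = 0" if "q \<in> X" for q using inj[of "\<lambda>q. v $ e' q"] that by blast
    have "v = 0\<^sub>v n"
    proof (rule eq_vecI)
      show "v $ i = 0\<^sub>v n $ i" if "i < dim_vec (0\<^sub>v n)" for i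
        using z[OF eX, of i] e'e[of i] that by simp
    qed (use v in simp)
    then show False using v by simp
  qed
  then have "B \<in> Units (ring_mat TYPE(complex) n ())" by (rule det_non_zero_imp_unit[OF B])
  then obtain C where C: "C \<in> carrier_mat n n" "B * C = 1\<^sub>m n"
    by (auto simp: Units_def ring_mat_def)
  define v where "v = C *\<^sub>v vec n (\<lambda>i. m (e i))"
  have v: "v \<in> carrier_vec n" using C by (simp add: v_def)
  have "B *\<^sub>v v = (B * C) *\<^sub>v vec n (\<lambda>i. m (e i))"
    unfolding v_def by (rule assoc_mult_mat_vec[symmetric, OF B C(1)]) simp
  then have Bm: "B *\<^sub>v v = vec n (\<lambda>i. m (e i))" by (simp add: C(2))
  have "m p = (\<Sum>q\<in>X. v $ e' q * W q p)" if "p \<in> X" for p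
    using Bv[OF v e'(1)[OF that]] Bm e'[OF that] by simp
  then show ?thesis by (intro exI[of _ "\<lambda>q. v $ e' q"] ballI)
qed

text \<open>Setting for cumulants at finite \<open>N\<close>: \<open>R\<close> becomes the geodesic
  order, \<open>f\<close> the distance from the identity and \<open>W\<close> the matrix of weights.
  At finite \<open>N\<close> this matrix need not be triangular; only its limit is.\<close>

locale perturbed_triangular =
  fixes X :: "'a set" and R :: "'a \<Rightarrow> 'a \<Rightarrow> bool" and f :: "'a \<Rightarrow> real"
    and W :: "nat \<Rightarrow> 'a \<Rightarrow> 'a \<Rightarrow> complex"
  assumes fin: "finite X"
    and reflexive: "\<And>p. p \<in> X \<Longrightarrow> R p p"
    and less: "\<And>p q. p \<in> X \<Longrightarrow> q \<in> X \<Longrightarrow> R q p \<Longrightarrow> q \<noteq> p \<Longrightarrow> f q < f p"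
    and lim: "\<And>q p. q \<in> X \<Longrightarrow> p \<in> X \<Longrightarrow> (\<lambda>N. W N q p) \<longlonglongrightarrow> of_bool (R q p)"
begin

lemma ex_inverse: "\<exists>h. \<forall>s\<in>X. \<forall>q\<in>X. (\<Sum>p\<in>X. of_bool (R q p) * h p s) = (of_bool (q = s) :: complex)"
proof -
  have "\<exists>h. \<forall>q\<in>X. (\<Sum>p\<in>X. of_bool (R q p) * h p) = (of_bool (q = s) :: complex)" for s
  proof -
    \<comment> \<open>A column of the inverse is found by descending recursion along
      \<open>R\<close>, hence the reversed relation and \<open>- f\<close>.\<close>
    have "\<exists>!\<kappa>. (\<forall>q\<in>X. of_bool (q = s) = (\<Sum>p\<in>{p\<in>X. R q p}. \<kappa> p)) \<and> (\<forall>p. p \<notin> X \<longrightarrow> \<kappa> p = (0::complex))"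
      by (rule ex_triangular_inverse[where f = "\<lambda>p. - f p" and R = "\<lambda>p q. R q p", OF fin])
        (use reflexive less in auto)
    then obtain \<kappa> where \<kappa>: "\<And>q. q \<in> X \<Longrightarrow> of_bool (q = s) = (\<Sum>p\<in>{p\<in>X. R q p}. \<kappa> p :: complex)"
      by metis
    have "(\<Sum>p\<in>X. of_bool (R q p) * \<kappa> p) = of_bool (q = s)" if "q \<in> X" for q
    proof -
      have "(\<Sum>p\<in>X. of_bool (R q p) * \<kappa> p) = (\<Sum>p\<in>X. if R q p then \<kappa> p else 0)"
        by (intro sum.cong) auto
      then show ?thesis using \<kappa>[OF that] by (simp only: sum.inter_filter[OF fin])
    qed
    then show ?thesis by blast
  qed
  then obtain h where "\<And>s q. q \<in> X \<Longrightarrow> (\<Sum>p\<in>X. of_bool (R q p) * h s p) = (of_bool (q = s) :: complex)"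
    using choice[of "\<lambda>s h. \<forall>q\<in>X. (\<Sum>p\<in>X. of_bool (R q p) * h p) = (of_bool (q = s) :: complex)"]
    by blast
  then show ?thesis by (intro exI[of _ "\<lambda>p s. h s p"] ballI)
qed

text \<open>If \<open>R\<close> is a partial order, this is its Moebius function on
  \<open>X\<close>.\<close>

definition rinv :: "'a \<Rightarrow> 'a \<Rightarrow> complex" where
  "rinv = (SOME h. \<forall>s\<in>X. \<forall>q\<in>X. (\<Sum>p\<in>X. of_bool (R q p) * h p s) = of_bool (q = s))"

lemma rinv: "s \<in> X \<Longrightarrow> q \<in> X \<Longrightarrow> (\<Sum>p\<in>X. of_bool (R q p) * rinv p s) = of_bool (q = s)"
  using someI_ex[OF ex_inverse] unfolding rinv_def by blast

definition err :: "nat \<Rightarrow> 'a \<Rightarrow> 'a \<Rightarrow> complex" where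
  "err N q s = (\<Sum>p\<in>X. W N q p * rinv p s) - of_bool (q = s)"

definition eps :: "nat \<Rightarrow> real" where
  "eps N = (\<Sum>q\<in>X. \<Sum>s\<in>X. cmod (err N q s))"

lemma err_tendsto:
  assumes "q \<in> X" "s \<in> X"
  shows "(\<lambda>N. err N q s) \<longlonglongrightarrow> 0"
proof -
  have "(\<lambda>N. err N q s) \<longlonglongrightarrow> (\<Sum>p\<in>X. of_bool (R q p) * rinv p s) - of_bool (q = s)"
    unfolding err_def using assms lim by (intro tendsto_intros) auto
  then show ?thesis using rinv assms by simp
qed

lemma eps_tendsto: "eps \<longlonglongrightarrow> 0"
proof -
  have "(\<lambda>N. eps N) \<longlonglongrightarrow> (\<Sum>q\<in>X. \<Sum>s\<in>X. cmod 0)"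
    unfolding eps_def using err_tendsto by (intro tendsto_intros) auto
  then show ?thesis by simp
qed

lemma solve:
  assumes m: "\<And>p. p \<in> X \<Longrightarrow> m p = (\<Sum>q\<in>X. \<kappa> q * W N q p)" and s: "s \<in> X"
  shows "\<kappa> s = (\<Sum>p\<in>X. m p * rinv p s) - (\<Sum>q\<in>X. \<kappa> q * err N q s)"
proof -
  have "(\<Sum>p\<in>X. m p * rinv p s) = (\<Sum>p\<in>X. \<Sum>q\<in>X. \<kappa> q * (W N q p * rinv p s))"
    using m by (simp add: sum_distrib_right mult.assoc)
  also have "\<dots> = (\<Sum>q\<in>X. \<kappa> q * (\<Sum>p\<in>X. W N q p * rinv p s))"
    unfolding sum_distrib_left by (rule sum.swap)
  also have "\<dots> = (\<Sum>q\<in>X. \<kappa> q * err N q s) + (\<Sum>q\<in>X. if q = s then \<kappa> s else 0)"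
    unfolding sum.distrib[symmetric] by (intro sum.cong) (auto simp: err_def algebra_simps)
  finally show ?thesis using s fin by simp
qed

text \<open>By \<open>solve\<close>, \<open>\<kappa>\<close> differs from the product of
  \<open>m\<close> with \<open>rinv\<close> by \<open>\<kappa>\<close> times the error matrix. When
  the entries of that matrix sum to at most 1/2 in modulus, this term is at most half the norm of
  \<open>\<kappa>\<close> and is absorbed on the left.\<close>

lemma bound:
  assumes m: "\<And>p. p \<in> X \<Longrightarrow> m p = (\<Sum>q\<in>X. \<kappa> q * W N q p)" and N: "eps N \<le> 1/2"
  shows "(\<Sum>s\<in>X. cmod (\<kappa> s)) \<le> 2 * (\<Sum>s\<in>X. cmod (\<Sum>p\<in>X. m p * rinv p s))"
proof -
  let ?S = "\<Sum>s\<in>X. cmod (\<kappa> s)" and ?C = "\<Sum>s\<in>X. cmod (\<Sum>p\<in>X. m p * rinv p s)"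
  have "?S \<le> (\<Sum>s\<in>X. cmod (\<Sum>p\<in>X. m p * rinv p s) + cmod (\<Sum>q\<in>X. \<kappa> q * err N q s))"
  proof (rule sum_mono)
    fix s assume "s \<in> X"
    show "cmod (\<kappa> s) \<le> cmod (\<Sum>p\<in>X. m p * rinv p s) + cmod (\<Sum>q\<in>X. \<kappa> q * err N q s)"
      by (subst solve[OF m \<open>s \<in> X\<close>]) (auto intro: norm_triangle_ineq4)
  qed
  also have "\<dots> = ?C + (\<Sum>s\<in>X. cmod (\<Sum>q\<in>X. \<kappa> q * err N q s))" by (rule sum.distrib)
  also have "(\<Sum>s\<in>X. cmod (\<Sum>q\<in>X. \<kappa> q * err N q s)) \<le> (\<Sum>s\<in>X. \<Sum>q\<in>X. ?S * cmod (err N q s))"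
  proof (intro sum_mono)
    fix s
    have "cmod (\<Sum>q\<in>X. \<kappa> q * err N q s) \<le> (\<Sum>q\<in>X. cmod (\<kappa> q * err N q s))" by (rule norm_sum)
    also have "\<dots> \<le> (\<Sum>q\<in>X. ?S * cmod (err N q s))"
      unfolding norm_mult using fin by (intro sum_mono mult_right_mono member_le_sum) auto
    finally show "cmod (\<Sum>q\<in>X. \<kappa> q * err N q s) \<le> (\<Sum>q\<in>X. ?S * cmod (err N q s))" .
  qed
  also have "(\<Sum>s\<in>X. \<Sum>q\<in>X. ?S * cmod (err N q s)) = ?S * eps N"
    unfolding eps_def sum_distrib_left by (rule sum.swap)
  also have "?S * eps N \<le> ?S * (1/2)" using N by (intro mult_left_mono sum_nonneg) auto
  finally show ?thesis by simp
qed

lemma eventually_small: "\<forall>\<^sub>F N in sequentially. eps N \<le> 1/2"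
proof -
  have "\<forall>\<^sub>F N in sequentially. eps N < 1/2"
    using eps_tendsto by (rule order_tendstoD) simp
  then show ?thesis by (rule eventually_mono) simp
qed

text \<open>For right-hand side 0 the bound forces the zero solution, and a square system with
  trivial kernel can be solved for every right-hand side.\<close>

lemma eventually_solvable: "\<forall>\<^sub>F N in sequentially. \<forall>m. \<exists>\<kappa>. \<forall>p\<in>X. m p = (\<Sum>q\<in>X. \<kappa> q * W N q p)"
  using eventually_small
proof (rule eventually_mono)
  fix N assume N: "eps N \<le> 1/2"
  show "\<forall>m. \<exists>\<kappa>. \<forall>p\<in>X. m p = (\<Sum>q\<in>X. \<kappa> q * W N q p)"
  proof (intro allI injective_imp_surjective[OF fin])
    fix \<kappa> q assume z: "\<And>p. p \<in> X \<Longrightarrow> (\<Sum>q\<in>X. \<kappa> q * W N q p) = 0" and q: "q \<in> X"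
    have "(\<Sum>s\<in>X. cmod (\<kappa> s)) \<le> 2 * (\<Sum>s\<in>X. cmod (\<Sum>p\<in>X. 0 * rinv p s))"
      by (rule bound[OF _ N]) (simp add: z)
    then have "(\<Sum>s\<in>X. cmod (\<kappa> s)) \<le> 0" by simp
    moreover have "cmod (\<kappa> q) \<le> (\<Sum>s\<in>X. cmod (\<kappa> s))" using q fin by (intro member_le_sum) auto
    ultimately have "cmod (\<kappa> q) \<le> 0" by linarith
    then show "\<kappa> q = 0" by simp
  qed
qed

lemma solution_tendsto:
  assumes m: "\<And>p. p \<in> X \<Longrightarrow> (\<lambda>N. m N p) \<longlonglongrightarrow> m0 p"
    and \<kappa>: "\<forall>\<^sub>F N in sequentially. \<forall>p\<in>X. m N p = (\<Sum>q\<in>X. \<kappa> N q * W N q p)"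
    and \<kappa>0: "\<And>p. p \<in> X \<Longrightarrow> m0 p = (\<Sum>q\<in>{q\<in>X. R q p}. \<kappa>0 q)"
    and s: "s \<in> X"
  shows "(\<lambda>N. \<kappa> N s) \<longlonglongrightarrow> \<kappa>0 s"
proof -
  let ?C = "\<lambda>N. \<Sum>s\<in>X. cmod (\<Sum>p\<in>X. m N p * rinv p s)"
  have Clim: "?C \<longlonglongrightarrow> (\<Sum>s\<in>X. cmod (\<Sum>p\<in>X. m0 p * rinv p s))"
    using m by (intro tendsto_intros) auto
  have "(\<lambda>N. 2 * ?C N * eps N) \<longlonglongrightarrow> 2 * (\<Sum>s\<in>X. cmod (\<Sum>p\<in>X. m0 p * rinv p s)) * 0"
    by (intro tendsto_intros Clim eps_tendsto)
  then have z: "(\<lambda>N. 2 * ?C N * eps N) \<longlonglongrightarrow> 0" by simp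
  have rest: "(\<lambda>N. \<Sum>q\<in>X. \<kappa> N q * err N q s) \<longlonglongrightarrow> 0"
  proof (rule Lim_null_comparison[OF _ z])
    show "\<forall>\<^sub>F N in sequentially. norm (\<Sum>q\<in>X. \<kappa> N q * err N q s) \<le> 2 * ?C N * eps N"
      using \<kappa> eventually_small
    proof eventually_elim
      case (elim N)
      have b: "(\<Sum>q\<in>X. cmod (\<kappa> N q)) \<le> 2 * ?C N"
        by (rule bound[of "m N"]) (use elim in auto)
      have "norm (\<Sum>q\<in>X. \<kappa> N q * err N q s) \<le> (\<Sum>q\<in>X. cmod (\<kappa> N q) * cmod (err N q s))"
        unfolding norm_mult[symmetric] by (rule norm_sum)
      also have "\<dots> \<le> (\<Sum>q\<in>X. cmod (\<kappa> N q) * eps N)"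
      proof (intro sum_mono mult_left_mono)
        fix q assume q: "q \<in> X"
        have "cmod (err N q s) \<le> (\<Sum>s\<in>X. cmod (err N q s))"
          using s fin by (intro member_le_sum) auto
        also have "\<dots> \<le> eps N"
          unfolding eps_def using q fin
          by (intro member_le_sum[of q X "\<lambda>q. \<Sum>s\<in>X. cmod (err N q s)"] sum_nonneg) auto
        finally show "cmod (err N q s) \<le> eps N" .
      qed simp
      also have "\<dots> = (\<Sum>q\<in>X. cmod (\<kappa> N q)) * eps N" by (rule sum_distrib_right[symmetric])
      also have "\<dots> \<le> 2 * ?C N * eps N"
        using b by (intro mult_right_mono) (auto simp: eps_def intro!: sum_nonneg)
      finally show ?case .
    qed
  qed
  have "(\<lambda>N. (\<Sum>p\<in>X. m N p * rinv p s) - (\<Sum>q\<in>X. \<kappa> N q * err N q s)) \<longlonglongrightarrow> (\<Sum>p\<in>X. m0 p * rinv p s) - 0"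
    using m by (intro tendsto_intros rest) auto
  moreover have "\<forall>\<^sub>F N in sequentially.
      (\<Sum>p\<in>X. m N p * rinv p s) - (\<Sum>q\<in>X. \<kappa> N q * err N q s) = \<kappa> N s"
    using \<kappa> by (rule eventually_mono) (rule solve[symmetric, OF _ s], blast)
  ultimately have "(\<lambda>N. \<kappa> N s) \<longlonglongrightarrow> (\<Sum>p\<in>X. m0 p * rinv p s)"
    using tendsto_cong by fastforce
  also have "(\<Sum>p\<in>X. m0 p * rinv p s) = (\<Sum>p\<in>X. \<Sum>q\<in>X. \<kappa>0 q * (of_bool (R q p) * rinv p s))"
  proof (rule sum.cong[OF refl])
    fix p assume p: "p \<in> X"
    have "m0 p = (\<Sum>q\<in>X. \<kappa>0 q * of_bool (R q p))"
      unfolding \<kappa>0[OF p] sum.inter_filter[OF fin] by (intro sum.cong) auto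
    then show "m0 p * rinv p s = (\<Sum>q\<in>X. \<kappa>0 q * (of_bool (R q p) * rinv p s))"
      by (simp only: sum_distrib_right mult.assoc)
  qed
  also have "\<dots> = (\<Sum>q\<in>X. \<kappa>0 q * (\<Sum>p\<in>X. of_bool (R q p) * rinv p s))"
    unfolding sum_distrib_left by (rule sum.swap)
  also have "\<dots> = (\<Sum>q\<in>X. if q = s then \<kappa>0 s else 0)"
    using s by (intro sum.cong) (auto simp: rinv)
  also have "\<dots> = \<kappa>0 s" using s fin by simp
  finally show ?thesis .
qed

end

section \<open>The weights of the geodesic order\<close>

text \<open>\<open>N\<close> to the power minus the defect of the triangle inequality from the identity over \<open>p\<close> to \<open>q\<close>.\<close>

definition weight :: "nat \<Rightarrow> nat \<Rightarrow> point set set \<Rightarrow> point set set \<Rightarrow> complex" where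
  "weight k N p q = of_nat (N ^ nc (part_join k p q)) * of_nat (N ^ nc (cycles_of k p)) /
     (of_nat (N ^ nc p) * of_nat (N ^ nc (cycles_of k q)))"

lemma power_quotient_tendsto:
  assumes "a \<le> b"
  shows "(\<lambda>N. of_nat (N ^ a) / of_nat (N ^ b) :: complex) \<longlonglongrightarrow> of_bool (a = b)"
proof (cases "a = b")
  case True
  have "\<forall>\<^sub>F N in sequentially. of_nat (N ^ a) / of_nat (N ^ b) = (1 :: complex)"
    using eventually_gt_at_top[of 0] by (rule eventually_mono) (simp add: True)
  then show ?thesis using True by (simp add: tendsto_eventually)
next
  case False
  then obtain d where d: "b = a + Suc d" using assms by (metis le_neq_implies_less less_imp_Suc_add add_Suc_right)
  have "(\<lambda>N. inverse (of_nat N :: complex) ^ Suc d) \<longlonglongrightarrow> 0 ^ Suc d"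
    by (intro tendsto_power lim_inverse_n)
  moreover have "\<forall>\<^sub>F N in sequentially. inverse (of_nat N :: complex) ^ Suc d = of_nat (N ^ a) / of_nat (N ^ b)"
    using eventually_gt_at_top[of 0]
    by (rule eventually_mono) (simp add: d power_add field_simps)
  ultimately show ?thesis using False tendsto_cong by fastforce
qed

lemma part_join_commute: "part_join k p q = part_join k q p"
  unfolding part_join_def is_join_def by (rule arg_cong[where f = The]) auto

text \<open>Semimodularity with the identity partition as third argument makes the exponent
  non-positive. It is zero exactly when \<open>p\<close> lies on a geodesic from the identity to
  \<open>q\<close>, and otherwise the power tends to 0.\<close>

lemma weight_tendsto:
  assumes "p \<in> partitions k" "q \<in> partitions k"
  shows "(\<lambda>N. weight k N p q) \<longlonglongrightarrow> of_bool (geo_le k p q)"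
proof -
  let ?a = "nc (part_join k p q) + nc (cycles_of k p)" and ?b = "nc p + nc (cycles_of k q)"
  have le: "?a \<le> ?b"
    unfolding cycles_of_def by (rule nc_join_semimodular[OF assms partition_id_part])
  have eq: "geo_le k p q \<longleftrightarrow> ?a = ?b"
    unfolding geo_le_def pdist_def cycles_of_def part_join_commute[of k "id_part k"]
    by (auto simp: field_simps)
  have "weight k N p q = of_nat (N ^ ?a) / of_nat (N ^ ?b)" for N
    by (simp add: weight_def power_add)
  then show ?thesis using power_quotient_tendsto[OF le] by (simp only: eq)
qed

lemma perturbed_triangular_weight:
  "perturbed_triangular (parts A k) (geo_le k) (pdist k (id_part k)) (weight k)"
proof
  show "geo_le k p p" if "p \<in> parts A k" for p
    using that by (intro geo_le_refl) (simp add: parts_iff)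
  show "pdist k (id_part k) q < pdist k (id_part k) p"
    if "p \<in> parts A k" "q \<in> parts A k" "geo_le k q p" "q \<noteq> p" for p q
    using that pdist_pos[of q k p] by (auto simp: geo_le_def parts_iff)
  show "(\<lambda>N. weight k N q p) \<longlonglongrightarrow> of_bool (geo_le k q p)"
    if "q \<in> parts A k" "p \<in> parts A k" for q p
    using that by (intro weight_tendsto) (auto simp: parts_iff)
qed simp

lemma cumulant_eqI:
  assumes "is_cumulants A (length ts) (\<lambda>q. limit_moment \<Omega> B q ts) \<kappa>"
  shows "cumulant A \<Omega> B p ts = \<kappa> p"
proof -
  have "(THE \<kappa>. is_cumulants A (length ts) (\<lambda>q. limit_moment \<Omega> B q ts) \<kappa>) = \<kappa>"
    by (rule the1_equality[OF ex1_is_cumulants]) (rule assms)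
  then show ?thesis by (simp add: cumulant_def)
qed

section \<open>Asymptotic freeness\<close>

locale independent_invariant =
  fixes A :: kind
    and \<Omega> :: "nat \<Rightarrow> 'w measure"
    and I J :: "'i set"
    and M L :: "nat \<Rightarrow> 'i \<Rightarrow> 'w \<Rightarrow> complex mat"
  assumes disjoint: "I \<inter> J = {}"
    and prob: "\<And>N. N \<ge> 1 \<Longrightarrow> prob_space (\<Omega> N)"
    and random_M: "\<And>N i. N \<ge> 1 \<Longrightarrow> i \<in> I \<Longrightarrow> random_matrix (\<Omega> N) N (M N i)"
    and random_L: "\<And>N j. N \<ge> 1 \<Longrightarrow> j \<in> J \<Longrightarrow> random_matrix (\<Omega> N) N (L N j)"
    and conv_M: "converges_in_distribution A \<Omega> I M"
    and conv_L: "converges_in_distribution A \<Omega> J L"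
    and invariant_L: "\<And>N. N \<ge> 1 \<Longrightarrow> invariant_family A (\<Omega> N) N J (L N)"
    and independent: "\<And>N. N \<ge> 1 \<Longrightarrow> independent_families (\<Omega> N) N I (M N) J (L N)"
begin

abbreviation joint where "joint \<equiv> joint_family I M L"

lemma moment_pairing:
  assumes N: "N \<ge> 1" and B: "\<And>t. t \<in> T \<Longrightarrow> random_matrix (\<Omega> N) N (B N t)"
    and ts: "ts \<in> lists T" and p: "p \<in> partitions (length ts)"
  shows "moment_seq \<Omega> B p ts N * of_nat (N ^ nc (cycles_of (length ts) p)) =
    (\<Sum>x\<in>multi (length ts) N. expect_tensor (\<Omega> N) (map (B N) ts) x * ind p x)"
proof -
  have "random_matrix (\<Omega> N) N X" if "X \<in> set (map (B N) ts)" for X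
    using that ts B by auto
  then show ?thesis
    using moment_expect_tensor[OF prob[OF N], of "map (B N) ts" N p] p N by simp
qed

lemma random_joint:
  assumes "N \<ge> 1" "t \<in> I \<union> J"
  shows "random_matrix (\<Omega> N) N (joint N t)"
  using assms random_M random_L by (auto simp: joint_family_def)

lemma moment_M:
  assumes "N \<ge> 1" "ts \<in> lists I" "p \<in> partitions (length ts)"
  shows "moment_seq \<Omega> M p ts N * of_nat (N ^ nc (cycles_of (length ts) p)) =
    (\<Sum>x\<in>multi (length ts) N. expect_tensor (\<Omega> N) (map (M N) ts) x * ind p x)"
  by (rule moment_pairing[OF assms(1) _ assms(2,3)]) (rule random_M[OF assms(1)])

lemma moment_L:
  assumes "N \<ge> 1" "ts \<in> lists J" "p \<in> partitions (length ts)"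
  shows "moment_seq \<Omega> L p ts N * of_nat (N ^ nc (cycles_of (length ts) p)) =
    (\<Sum>x\<in>multi (length ts) N. expect_tensor (\<Omega> N) (map (L N) ts) x * ind p x)"
  by (rule moment_pairing[OF assms(1) _ assms(2,3)]) (rule random_L[OF assms(1)])

lemma moment_joint:
  assumes "N \<ge> 1" "ts \<in> lists (I \<union> J)" "p \<in> partitions (length ts)"
  shows "moment_seq \<Omega> joint p ts N * of_nat (N ^ nc (cycles_of (length ts) p)) =
    (\<Sum>x\<in>multi (length ts) N. expect_tensor (\<Omega> N) (map (joint N) ts) x * ind p x)"
  by (rule moment_pairing[OF assms(1) _ assms(2,3)]) (rule random_joint[OF assms(1)])

text \<open>The normalisation of \<open>ind p\<close> under which coefficients become cumulants at
  finite \<open>N\<close>: if \<open>ind q\<close> has coefficient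
  \<open>\<kappa> q * scale k N q\<close>, the normalised moments are \<open>\<kappa>\<close> times
  the matrix of weights.\<close>

definition scale :: "nat \<Rightarrow> nat \<Rightarrow> point set set \<Rightarrow> complex" where
  "scale k N p = of_nat (N ^ nc (cycles_of k p)) / of_nat (N ^ nc p)"

lemma scale_weight:
  assumes "N \<ge> 1"
  shows "scale k N p * of_nat (N ^ nc (part_join k p q)) = weight k N p q * of_nat (N ^ nc (cycles_of k q))"
  using assms by (simp add: scale_def weight_def)

text \<open>
  The cumulants \<open>kap_M\<close> and \<open>kap_L\<close> at finite \<open>N\<close>.  For \<open>M\<close>, which need not be invariant, they
  exist only because the matrix \<^const>\<open>weight\<close> is invertible for large \<open>N\<close>.
\<close>

definition kap_M :: "'i list \<Rightarrow> nat \<Rightarrow> point set set \<Rightarrow> complex" where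
  "kap_M ks N = (SOME \<kappa>. \<forall>p\<in>parts A (length ks).
     moment_seq \<Omega> M p ks N = (\<Sum>q\<in>parts A (length ks). \<kappa> q * weight (length ks) N q p))"

lemma kap_M:
  "\<forall>\<^sub>F N in sequentially. \<forall>p\<in>parts A (length ks).
     moment_seq \<Omega> M p ks N = (\<Sum>q\<in>parts A (length ks). kap_M ks N q * weight (length ks) N q p)"
  using perturbed_triangular.eventually_solvable[OF perturbed_triangular_weight[of A "length ks"]]
proof (rule eventually_mono)
  fix N assume "\<forall>m. \<exists>\<kappa>. \<forall>p\<in>parts A (length ks). m p = (\<Sum>q\<in>parts A (length ks). \<kappa> q * weight (length ks) N q p)"
  then have "\<exists>\<kappa>. \<forall>p\<in>parts A (length ks).
     moment_seq \<Omega> M p ks N = (\<Sum>q\<in>parts A (length ks). \<kappa> q * weight (length ks) N q p)"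
    by (rule spec)
  then show "\<forall>p\<in>parts A (length ks).
     moment_seq \<Omega> M p ks N = (\<Sum>q\<in>parts A (length ks). kap_M ks N q * weight (length ks) N q p)"
    unfolding kap_M_def by (rule someI_ex)
qed

lemma limit_moment:
  assumes "converges_in_distribution A \<Omega> T B" "ts \<in> lists T" "p \<in> parts A (length ts)"
  shows "moment_seq \<Omega> B p ts \<longlonglongrightarrow> limit_moment \<Omega> B p ts"
  using assms unfolding converges_in_distribution_def limit_moment_def convergent_LIMSEQ_iff by blast

lemma kap_M_tendsto:
  assumes "ks \<in> lists I" "p \<in> parts A (length ks)"
  shows "(\<lambda>N. kap_M ks N p) \<longlonglongrightarrow> cumulant A \<Omega> M p ks"
proof (rule perturbed_triangular.solution_tendsto[OF perturbed_triangular_weight])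
  show "(\<lambda>N. moment_seq \<Omega> M q ks N) \<longlonglongrightarrow> limit_moment \<Omega> M q ks" if "q \<in> parts A (length ks)" for q
    by (rule limit_moment[OF conv_M assms(1) that])
  show "limit_moment \<Omega> M q ks = (\<Sum>p'\<in>{p' \<in> parts A (length ks). geo_le (length ks) p' q}. cumulant A \<Omega> M p' ks)"
    if "q \<in> parts A (length ks)" for q
    by (rule cumulant_sum[OF that])
qed (use kap_M assms in auto)

text \<open>It is chosen through the expansion of the tensor and not through moments, because the
  second factor of a joint moment is expanded at every index.\<close>

definition kap_L :: "'i list \<Rightarrow> nat \<Rightarrow> point set set \<Rightarrow> complex" where
  "kap_L js N = (SOME \<kappa>. \<forall>z\<in>multi (length js) N. expect_tensor (\<Omega> N) (map (L N) js) z =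
     (\<Sum>q\<in>parts A (length js). \<kappa> q * scale (length js) N q * ind q z))"

lemma kap_L:
  assumes js: "js \<in> lists J" and N: "N \<ge> 1" "2 * length js + 2 \<le> N" and z: "z \<in> multi (length js) N"
  shows "expect_tensor (\<Omega> N) (map (L N) js) z =
     (\<Sum>q\<in>parts A (length js). kap_L js N q * scale (length js) N q * ind q z)"
proof -
  let ?k = "length js"
  have "invariant_tensor A ?k N (expect_tensor (\<Omega> N) (map (L N) js))"
    by (rule expect_tensor_invariant[OF prob[OF N(1)] random_L[OF N(1)] invariant_L[OF N(1)] js])
  then obtain c where c: "\<And>z. z \<in> multi ?k N \<Longrightarrow>
      expect_tensor (\<Omega> N) (map (L N) js) z = (\<Sum>q\<in>parts A ?k. c q * ind q z)"
    using invariant_tensor_span[OF _ N(2)] by blast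
  have s: "scale ?k N q \<noteq> 0" for q using N by (simp add: scale_def)
  have "\<exists>\<kappa>. \<forall>z\<in>multi ?k N. expect_tensor (\<Omega> N) (map (L N) js) z =
     (\<Sum>q\<in>parts A ?k. \<kappa> q * scale ?k N q * ind q z)"
    by (rule exI[of _ "\<lambda>q. c q / scale ?k N q"]) (simp add: c s)
  then have "\<forall>z\<in>multi ?k N. expect_tensor (\<Omega> N) (map (L N) js) z =
     (\<Sum>q\<in>parts A ?k. kap_L js N q * scale ?k N q * ind q z)"
    unfolding kap_L_def by (rule someI_ex)
  then show ?thesis using z by (rule bspec)
qed

text \<open>Pairing the expansion with \<open>ind p\<close> produces the linear system that also
  defines \<open>kap_M\<close>, so the same convergence result applies to both.\<close>

lemma kap_L_weight:
  assumes js: "js \<in> lists J" and N: "N \<ge> 1" "2 * length js + 2 \<le> N" and p: "p \<in> parts A (length js)"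
  shows "moment_seq \<Omega> L p js N = (\<Sum>q\<in>parts A (length js). kap_L js N q * weight (length js) N q p)"
proof -
  let ?k = "length js"
  have part: "q \<in> parts A ?k \<Longrightarrow> q \<in> partitions ?k" for q by (simp add: parts_iff)
  have "moment_seq \<Omega> L p js N * of_nat (N ^ nc (cycles_of ?k p)) =
      (\<Sum>x\<in>multi ?k N. \<Sum>q\<in>parts A ?k. kap_L js N q * scale ?k N q * (ind q x * ind p x))"
    unfolding moment_L[OF N(1) js part[OF p]]
    by (intro sum.cong refl) (simp add: kap_L[OF js N] sum_distrib_right mult.assoc)
  also have "\<dots> = (\<Sum>q\<in>parts A ?k. kap_L js N q * (scale ?k N q * (\<Sum>x\<in>multi ?k N. ind q x * ind p x)))"
    unfolding sum_distrib_left mult.assoc by (rule sum.swap)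
  also have "\<dots> = (\<Sum>q\<in>parts A ?k. kap_L js N q * (weight ?k N q p * of_nat (N ^ nc (cycles_of ?k p))))"
    by (intro sum.cong refl) (simp only: nc_join_pairing part p scale_weight[OF N(1)])
  also have "\<dots> = (\<Sum>q\<in>parts A ?k. kap_L js N q * weight ?k N q p) * of_nat (N ^ nc (cycles_of ?k p))"
    by (simp add: sum_distrib_right mult.assoc)
  finally show ?thesis using N(1) by simp
qed

lemma eventually_large: "\<forall>\<^sub>F N in sequentially. N \<ge> 1 \<and> 2 * k + 2 \<le> N" for k :: nat
  using eventually_ge_at_top[of "2 * k + 2"] by (rule eventually_mono) simp

lemma kap_L_tendsto:
  assumes "js \<in> lists J" "p \<in> parts A (length js)"
  shows "(\<lambda>N. kap_L js N p) \<longlonglongrightarrow> cumulant A \<Omega> L p js"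
proof (rule perturbed_triangular.solution_tendsto[OF perturbed_triangular_weight])
  show "(\<lambda>N. moment_seq \<Omega> L q js N) \<longlonglongrightarrow> limit_moment \<Omega> L q js" if "q \<in> parts A (length js)" for q
    by (rule limit_moment[OF conv_L assms(1) that])
  show "limit_moment \<Omega> L q js = (\<Sum>p'\<in>{p' \<in> parts A (length js). geo_le (length js) p' q}. cumulant A \<Omega> L p' js)"
    if "q \<in> parts A (length js)" for q
    by (rule cumulant_sum[OF that])
  show "\<forall>\<^sub>F N in sequentially. \<forall>p\<in>parts A (length js).
     moment_seq \<Omega> L p js N = (\<Sum>q\<in>parts A (length js). kap_L js N q * weight (length js) N q p)"
    using eventually_large[of "length js"]
    by (rule eventually_mono) (intro ballI kap_L_weight[OF assms(1)], auto)
qed (use assms in auto)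

end

locale independent_invariant_columns = independent_invariant A \<Omega> I J M L + column_split k k1 k2 \<alpha> \<beta>
  for A :: kind
    and \<Omega> :: "nat \<Rightarrow> 'w measure"
    and I J :: "'i set"
    and M L :: "nat \<Rightarrow> 'i \<Rightarrow> 'w \<Rightarrow> complex mat"
    and k k1 k2 \<alpha> \<beta> +
  fixes ks js ts :: "'i list"
  assumes ks: "ks \<in> lists I" "length ks = k1" and js: "js \<in> lists J" "length js = k2"
    and ts: "length ts = k" "\<And>l. l < k1 \<Longrightarrow> ts ! \<alpha> l = ks ! l" "\<And>l. l < k2 \<Longrightarrow> ts ! \<beta> l = js ! l"
begin

lemma ks_in: "l < k1 \<Longrightarrow> ks ! l \<in> I"
  using ks by (auto simp: in_lists_conv_set)

lemma js_in: "l < k2 \<Longrightarrow> js ! l \<in> J"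
  using js by (auto simp: in_lists_conv_set)

lemma ts_in: "ts \<in> lists (I \<union> J)"
proof -
  have "ts ! l \<in> I \<union> J" if "l < k" for l
  proof -
    have "l \<in> \<alpha> ` {..<k1} \<union> \<beta> ` {..<k2}" using that cover by simp
    then show ?thesis using ts(2,3) ks_in js_in by auto
  qed
  then have "t \<in> I \<union> J" if "t \<in> set ts" for t
    using that ts(1) unfolding in_set_conv_nth by blast
  then show ?thesis by auto
qed

lemma partsD: "q \<in> parts A k' \<Longrightarrow> q \<in> partitions k'"
  by (simp add: parts_iff)

lemma scale_glue:
  assumes "q1 \<in> partitions k1" "q2 \<in> partitions k2"
  shows "scale k N (glue \<alpha> \<beta> q1 q2) = scale k1 N q1 * scale k2 N q2"
  using nc_join_glue[OF assms partition_id_part partition_id_part] nc_glue[OF assms]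
  by (simp add: scale_def cycles_of_def glue_id power_add)

lemma moment_joint_weight:
  assumes p: "p \<in> parts A k" and N: "N \<ge> 1" "2 * k1 + 2 \<le> N" "2 * k2 + 2 \<le> N"
    and M: "\<forall>r\<in>parts A k1. moment_seq \<Omega> M r ks N = (\<Sum>q\<in>parts A k1. kap_M ks N q * weight k1 N q r)"
  shows "moment_seq \<Omega> joint p ts N =
    (\<Sum>q1\<in>parts A k1. \<Sum>q2\<in>parts A k2. kap_M ks N q1 * kap_L js N q2 * weight k N (glue \<alpha> \<beta> q1 q2) p)"
proof -
  let ?S = "expect_tensor (\<Omega> N) (map (M N) ks)" and ?T = "expect_tensor (\<Omega> N) (map (L N) js)"
  have T: "invariant_tensor A k2 N ?T"
    using expect_tensor_invariant[OF prob[OF N(1)] random_L[OF N(1)] invariant_L[OF N(1)] js(1)] js(2) by simp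
  have cT: "?T z = (\<Sum>q\<in>parts A k2. (kap_L js N q * scale k2 N q) * ind q z)" if "z \<in> multi k2 N" for z
    using kap_L[OF js(1) N(1), of z] N(3) js(2) that by simp
  have cS: "(\<Sum>y\<in>multi k1 N. ?S y * ind r y) =
      (\<Sum>q\<in>parts A k1. (kap_M ks N q * scale k1 N q) * of_nat (N ^ nc (part_join k1 q r)))"
    if r: "r \<in> parts A k1" for r
  proof -
    have "(\<Sum>y\<in>multi k1 N. ?S y * ind r y) = moment_seq \<Omega> M r ks N * of_nat (N ^ nc (cycles_of k1 r))"
      using moment_M[OF N(1) ks(1), of r] partsD[OF r] ks(2) by simp
    also have "\<dots> = (\<Sum>q\<in>parts A k1. kap_M ks N q * (weight k1 N q r * of_nat (N ^ nc (cycles_of k1 r))))"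
      using M r by (simp add: sum_distrib_right mult.assoc)
    finally show ?thesis by (simp only: scale_weight[OF N(1), symmetric] mult.assoc)
  qed
  have "moment_seq \<Omega> joint p ts N * of_nat (N ^ nc (cycles_of k p)) =
      (\<Sum>x\<in>multi k N. expect_tensor (\<Omega> N) (map (joint N) ts) x * ind p x)"
    using moment_joint[OF N(1) ts_in] partsD[OF p] ts(1) by simp
  also have "\<dots> = (\<Sum>x\<in>multi k N. ?S (restr \<alpha> k1 x) * ?T (restr \<beta> k2 x) * ind p x)"
  proof (intro sum.cong refl arg_cong2[of _ _ _ _ times])
    fix x assume x: "x \<in> multi k N"
    have \<alpha>k: "\<alpha> l < k" if "l < k1" for l using that cover by blast
    have \<beta>k: "\<beta> l < k" if "l < k2" for l using that cover by blast
    show "expect_tensor (\<Omega> N) (map (joint N) ts) x = ?S (restr \<alpha> k1 x) * ?T (restr \<beta> k2 x)"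
    proof (rule expect_tensor_split[OF prob[OF N(1)] random_M[OF N(1)] random_L[OF N(1)]
            independent[OF N(1)] ks js _ _ _ x])
      show "map (joint N) ts ! \<alpha> l = M N (ks ! l)" if "l < k1" for l
        using that \<alpha>k ts ks_in by (simp add: joint_family_def)
      \<comment> \<open>\<open>joint_family\<close> tests membership in \<open>I\<close>, so
        disjointness of the index sets is what selects \<open>L\<close> here.\<close>
      show "map (joint N) ts ! \<beta> l = L N (js ! l)" if "l < k2" for l
        using that \<beta>k ts js_in[OF that] disjoint by (auto simp: joint_family_def)
    qed (use ts in auto)
  qed
  also have "\<dots> = (\<Sum>q1\<in>parts A k1. \<Sum>q2\<in>parts A k2. (kap_M ks N q1 * scale k1 N q1) *
      (kap_L js N q2 * scale k2 N q2) * of_nat (N ^ nc (part_join k (glue \<alpha> \<beta> q1 q2) p)))"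
    by (rule joint_pairing[OF T p N(2) cT cS])
  \<comment> \<open>Block and cycle counts add under gluing, so the two scales multiply to the scale
    of the glued partition, which combines with the pairing into a single weight.\<close>
  also have "\<dots> = (\<Sum>q1\<in>parts A k1. \<Sum>q2\<in>parts A k2. kap_M ks N q1 * kap_L js N q2 *
      (scale k N (glue \<alpha> \<beta> q1 q2) * of_nat (N ^ nc (part_join k (glue \<alpha> \<beta> q1 q2) p))))"
    by (intro sum.cong refl) (simp add: scale_glue partsD mult_ac)
  also have "\<dots> = (\<Sum>q1\<in>parts A k1. \<Sum>q2\<in>parts A k2. kap_M ks N q1 * kap_L js N q2 *
      weight k N (glue \<alpha> \<beta> q1 q2) p) * of_nat (N ^ nc (cycles_of k p))"
    by (simp only: scale_weight[OF N(1)] sum_distrib_right mult.assoc)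
  finally show ?thesis using N(1) by simp
qed

text \<open>All three factors of the formula at finite \<open>N\<close> converge. This yields both
  the convergence of the joint family and the limit moments as sums over glued partitions below
  \<open>p\<close>.\<close>

lemma moment_joint_tendsto:
  assumes p: "p \<in> parts A k"
  shows "moment_seq \<Omega> joint p ts \<longlonglongrightarrow> (\<Sum>q1\<in>parts A k1. \<Sum>q2\<in>parts A k2.
    cumulant A \<Omega> M q1 ks * cumulant A \<Omega> L q2 js * of_bool (geo_le k (glue \<alpha> \<beta> q1 q2) p))"
proof -
  have "(\<lambda>N. \<Sum>q1\<in>parts A k1. \<Sum>q2\<in>parts A k2. kap_M ks N q1 * kap_L js N q2 * weight k N (glue \<alpha> \<beta> q1 q2) p)
    \<longlonglongrightarrow> (\<Sum>q1\<in>parts A k1. \<Sum>q2\<in>parts A k2.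
    cumulant A \<Omega> M q1 ks * cumulant A \<Omega> L q2 js * of_bool (geo_le k (glue \<alpha> \<beta> q1 q2) p))"
  proof (intro tendsto_sum tendsto_mult)
    fix q1 q2 assume q: "q1 \<in> parts A k1" "q2 \<in> parts A k2"
    show "(\<lambda>N. kap_M ks N q1) \<longlonglongrightarrow> cumulant A \<Omega> M q1 ks"
      by (rule kap_M_tendsto) (use q ks in auto)
    show "(\<lambda>N. kap_L js N q2) \<longlonglongrightarrow> cumulant A \<Omega> L q2 js"
      by (rule kap_L_tendsto) (use q js in auto)
    show "(\<lambda>N. weight k N (glue \<alpha> \<beta> q1 q2) p) \<longlonglongrightarrow> of_bool (geo_le k (glue \<alpha> \<beta> q1 q2) p)"
      by (rule weight_tendsto) (use q p in \<open>auto intro: glue_partition partsD\<close>)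
  qed
  moreover have "\<forall>\<^sub>F N in sequentially. (\<Sum>q1\<in>parts A k1. \<Sum>q2\<in>parts A k2.
      kap_M ks N q1 * kap_L js N q2 * weight k N (glue \<alpha> \<beta> q1 q2) p) = moment_seq \<Omega> joint p ts N"
    using kap_M[of ks] eventually_large[of k1] eventually_large[of k2]
  proof eventually_elim
    case (elim N)
    then show ?case using moment_joint_weight[OF p, of N] ks(2) by simp
  qed
  ultimately show ?thesis by (rule Lim_transform_eventually)
qed

text \<open>The limit moments already are sums, over glued partitions below \<open>p\<close>, of
  products of cumulants. Placing each product at its glued partition therefore gives a solution of
  the moment-cumulant relation, and that solution is unique.\<close>

lemma cumulant_joint:
  "cumulant A \<Omega> joint p ts = (\<Sum>q1\<in>parts A k1. \<Sum>q2\<in>parts A k2.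
    cumulant A \<Omega> M q1 ks * cumulant A \<Omega> L q2 js * of_bool (glue \<alpha> \<beta> q1 q2 = p))"
proof -
  define c where "c q1 q2 = cumulant A \<Omega> M q1 ks * cumulant A \<Omega> L q2 js" for q1 q2
  define \<kappa> where "\<kappa> p = (\<Sum>q1\<in>parts A k1. \<Sum>q2\<in>parts A k2. c q1 q2 * of_bool (glue \<alpha> \<beta> q1 q2 = p))" for p
  have "is_cumulants A (length ts) (\<lambda>q. limit_moment \<Omega> joint q ts) \<kappa>"
    unfolding is_cumulants_def ts(1)
  proof (intro conjI ballI allI impI)
    fix p assume p: "p \<in> parts A k"
    let ?P = "{p' \<in> parts A k. geo_le k p' p}"
    have "(\<Sum>p'\<in>?P. \<kappa> p') = (\<Sum>q1\<in>parts A k1. \<Sum>p'\<in>?P. \<Sum>q2\<in>parts A k2. c q1 q2 * of_bool (glue \<alpha> \<beta> q1 q2 = p'))"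
      unfolding \<kappa>_def by (rule sum.swap)
    also have "\<dots> = (\<Sum>q1\<in>parts A k1. \<Sum>q2\<in>parts A k2. \<Sum>p'\<in>?P. c q1 q2 * of_bool (glue \<alpha> \<beta> q1 q2 = p'))"
      by (rule sum.cong[OF refl], rule sum.swap)
    also have "\<dots> = (\<Sum>q1\<in>parts A k1. \<Sum>q2\<in>parts A k2. c q1 q2 * of_bool (geo_le k (glue \<alpha> \<beta> q1 q2) p))"
    proof (intro sum.cong refl)
      fix q1 q2 assume q: "q1 \<in> parts A k1" "q2 \<in> parts A k2"
      have "(\<Sum>p'\<in>?P. c q1 q2 * of_bool (glue \<alpha> \<beta> q1 q2 = p')) =
          (\<Sum>p'\<in>?P. if p' = glue \<alpha> \<beta> q1 q2 then c q1 q2 else 0)"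
        by (intro sum.cong refl) auto
      also have "\<dots> = c q1 q2 * of_bool (geo_le k (glue \<alpha> \<beta> q1 q2) p)"
        using glue_parts[OF q] by (subst sum.delta) auto
      finally show "(\<Sum>p'\<in>?P. c q1 q2 * of_bool (glue \<alpha> \<beta> q1 q2 = p')) =
          c q1 q2 * of_bool (geo_le k (glue \<alpha> \<beta> q1 q2) p)" .
    qed
    also have "\<dots> = limit_moment \<Omega> joint p ts"
      unfolding limit_moment_def c_def by (rule limI[OF moment_joint_tendsto[OF p], symmetric])
    finally show "limit_moment \<Omega> joint p ts = (\<Sum>p'\<in>?P. \<kappa> p')" by simp
  next
    fix p assume p: "p \<notin> parts A k"
    have "c q1 q2 * of_bool (glue \<alpha> \<beta> q1 q2 = p) = 0" if "q1 \<in> parts A k1" "q2 \<in> parts A k2" for q1 q2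
      using glue_parts[OF that] p by auto
    then show "\<kappa> p = 0" unfolding \<kappa>_def by (intro sum.neutral ballI)
  qed
  then show ?thesis using cumulant_eqI[of A ts \<Omega> joint \<kappa> p] by (simp add: \<kappa>_def c_def)
qed

text \<open>Only glued partitions carry a non-zero cumulant, and no cycle of a glued partition meets
  columns of both families.\<close>

lemma cumulant_joint_mixed:
  assumes "c \<in> cycles_of k p" "s < k" "t < k" "Top s \<in> c" "Top t \<in> c" "ts ! s \<in> I" "ts ! t \<in> J"
  shows "cumulant A \<Omega> joint p ts = 0"
  unfolding cumulant_joint
proof (intro sum.neutral ballI)
  fix q1 q2 assume q: "q1 \<in> parts A k1" "q2 \<in> parts A k2"
  have "s \<in> \<alpha> ` {..<k1} \<union> \<beta> ` {..<k2}" "t \<in> \<alpha> ` {..<k1} \<union> \<beta> ` {..<k2}"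
    using assms cover by auto
  moreover have "s \<notin> \<beta> ` {..<k2}" using assms(6) js_in ts(3) disjoint by force
  moreover have "t \<notin> \<alpha> ` {..<k1}" using assms(7) ks_in ts(2) disjoint by force
  ultimately obtain i j where "i < k1" "s = \<alpha> i" "j < k2" "t = \<beta> j" by auto
  then have "glue \<alpha> \<beta> q1 q2 \<noteq> p"
    using cycles_of_glue[OF partsD[OF q(1)] partsD[OF q(2)], of c i j] assms by auto
  then show "cumulant A \<Omega> M q1 ks * cumulant A \<Omega> L q2 js * of_bool (glue \<alpha> \<beta> q1 q2 = p) = 0" by simp
qed

lemma cumulant_joint_glue:
  assumes p: "p1 \<in> parts A k1" "p2 \<in> parts A k2"
  shows "cumulant A \<Omega> joint (glue \<alpha> \<beta> p1 p2) ts = cumulant A \<Omega> M p1 ks * cumulant A \<Omega> L p2 js"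
proof -
  have "(glue \<alpha> \<beta> q1 q2 = glue \<alpha> \<beta> p1 p2) = (q1 = p1 \<and> q2 = p2)"
    if "q1 \<in> parts A k1" "q2 \<in> parts A k2" for q1 q2
    using glue_inj[of q1 q2 p1 p2] that p by (auto dest: partsD)
  then have "cumulant A \<Omega> joint (glue \<alpha> \<beta> p1 p2) ts = (\<Sum>q1\<in>parts A k1. \<Sum>q2\<in>parts A k2.
      if q2 = p2 then (if q1 = p1 then cumulant A \<Omega> M p1 ks * cumulant A \<Omega> L p2 js else 0) else 0)"
    unfolding cumulant_joint by (intro sum.cong refl) auto
  also have "\<dots> = cumulant A \<Omega> M p1 ks * cumulant A \<Omega> L p2 js" using p by simp
  finally show ?thesis .
qed

end

section \<open>Splitting a word between the two families\<close>

lemma image_plus_lessThan: "(+) a ` {..<b} = {a..<a + b :: nat}"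
  using image_add_atLeastLessThan[of a 0 b] by (simp add: atLeast0LessThan add.commute[of b])

text \<open>A word is a rearrangement of its two filtered subwords put side by side. The permutation
  realising this, cut at the length of the first subword, enumerates the columns of either
  family.\<close>

lemma ex_column_split:
  fixes ts :: "'i list"
  shows "\<exists>\<alpha> \<beta>. column_split (length ts) (length (filter P ts)) (length (filter (\<lambda>t. \<not> P t) ts)) \<alpha> \<beta> \<and>
    (\<forall>l<length (filter P ts). ts ! \<alpha> l = filter P ts ! l) \<and>
    (\<forall>l<length (filter (\<lambda>t. \<not> P t) ts). ts ! \<beta> l = filter (\<lambda>t. \<not> P t) ts ! l)"
proof -
  let ?ks = "filter P ts" and ?js = "filter (\<lambda>t. \<not> P t) ts"
  let ?k1 = "length ?ks" and ?k2 = "length ?js"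
  have "mset (?ks @ ?js) = mset ts" by simp
  then obtain \<pi> where \<pi>: "\<pi> permutes {..<length ts}" "permute_list \<pi> ts = ?ks @ ?js"
    by (rule mset_eq_permutation)
  have len: "length ts = ?k1 + ?k2" by (rule sum_length_filter_compl[symmetric])
  have nth: "ts ! \<pi> l = (?ks @ ?js) ! l" if "l < length ts" for l
    using permute_list_nth[OF \<pi>(1) that] \<pi>(2) by simp
  have inj: "inj_on \<pi> S" for S using permutes_inj_on[OF \<pi>(1)] .
  have shift: "(+) ?k1 ` {..<?k2} = {?k1..<length ts}" unfolding len by (rule image_plus_lessThan)
  have "column_split (length ts) ?k1 ?k2 \<pi> (\<pi> \<circ> (+) ?k1)"
  proof
    show "inj_on \<pi> {..<?k1}" by (rule inj)
    show "inj_on (\<pi> \<circ> (+) ?k1) {..<?k2}" by (rule comp_inj_on[OF _ inj]) simp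
    have "\<pi> ` {..<?k1} \<inter> \<pi> ` {?k1..<length ts} = \<pi> ` ({..<?k1} \<inter> {?k1..<length ts})"
      by (rule inj_on_image_Int[OF inj[of UNIV], symmetric]) auto
    then show "\<pi> ` {..<?k1} \<inter> (\<pi> \<circ> (+) ?k1) ` {..<?k2} = {}"
      unfolding image_comp[symmetric] shift by auto
    have "{..<?k1} \<union> {?k1..<length ts} = {..<length ts}" using len by auto
    then show "\<pi> ` {..<?k1} \<union> (\<pi> \<circ> (+) ?k1) ` {..<?k2} = {..<length ts}"
      unfolding image_comp[symmetric] shift image_Un[symmetric] using permutes_image[OF \<pi>(1)] by simp
  qed
  moreover have "ts ! \<pi> l = ?ks ! l" if "l < ?k1" for l
    using nth[of l] that len by (simp add: nth_append)
  moreover have "ts ! (\<pi> \<circ> (+) ?k1) l = ?js ! l" if "l < ?k2" for l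
    using nth[of "?k1 + l"] that len by (simp add: nth_append)
  ultimately show ?thesis by blast
qed

lemma column_split_append: "column_split (k1 + k2) k1 k2 id ((+) k1)"
proof
  show "id ` {..<k1} \<inter> (+) k1 ` {..<k2} = {}" "id ` {..<k1} \<union> (+) k1 ` {..<k2} = {..<k1 + k2}"
    unfolding image_plus_lessThan by auto
qed simp_all

lemma ptensor_glue: "ptensor k1 p q = glue id ((+) k1) p q"
proof -
  have "cmap id = id" by (rule ext) (case_tac x; simp)
  moreover have "shift k1 = cmap ((+) k1)" by (rule ext) (case_tac x; simp)
  ultimately show ?thesis by (simp add: ptensor_def glue_def image_def)
qed

theorem theorem5p1:
  fixes A :: kind
    and \<Omega> :: "nat \<Rightarrow> 'w measure"
    and I J :: "'i set"
    and M L :: "nat \<Rightarrow> 'i \<Rightarrow> 'w \<Rightarrow> complex mat"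
  assumes disjoint: "I \<inter> J = {}"
    and prob: "\<And>N. N \<ge> 1 \<Longrightarrow> prob_space (\<Omega> N)"
    and random_M: "\<And>N i. N \<ge> 1 \<Longrightarrow> i \<in> I \<Longrightarrow> random_matrix (\<Omega> N) N (M N i)"
    and random_L: "\<And>N j. N \<ge> 1 \<Longrightarrow> j \<in> J \<Longrightarrow> random_matrix (\<Omega> N) N (L N j)"
    and conv_M: "converges_in_distribution A \<Omega> I M"
    and conv_L: "converges_in_distribution A \<Omega> J L"
    and invariant_L: "\<And>N. N \<ge> 1 \<Longrightarrow> invariant_family A (\<Omega> N) N J (L N)"
    and independent: "\<And>N. N \<ge> 1 \<Longrightarrow> independent_families (\<Omega> N) N I (M N) J (L N)"
  shows "asymptotically_free A \<Omega> I M J L"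
proof -
  interpret independent_invariant A \<Omega> I J M L
    by (rule independent_invariant.intro) (fact assms)+
  \<comment> \<open>Convergence and the vanishing of mixed cumulants concern arbitrary words over
    \<open>I \<union> J\<close>; letters outside \<open>I\<close> lie in \<open>J\<close>, so
    membership in \<open>I\<close> decides the family.\<close>
  have columns: "\<exists>k1 k2 \<alpha> \<beta> ks js.
      independent_invariant_columns A \<Omega> I J M L (length ts) k1 k2 \<alpha> \<beta> ks js ts"
    if ts: "ts \<in> lists (I \<union> J)" for ts
  proof -
    let ?ks = "filter (\<lambda>t. t \<in> I) ts" and ?js = "filter (\<lambda>t. \<not> t \<in> I) ts"
    obtain \<alpha> \<beta> where ab: "column_split (length ts) (length ?ks) (length ?js) \<alpha> \<beta>"
      "\<forall>l<length ?ks. ts ! \<alpha> l = ?ks ! l" "\<forall>l<length ?js. ts ! \<beta> l = ?js ! l"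
      using ex_column_split[of ts "\<lambda>t. t \<in> I"] by blast
    have "independent_invariant_columns A \<Omega> I J M L (length ts) (length ?ks) (length ?js) \<alpha> \<beta> ?ks ?js ts"
      using ab ts independent_invariant_axioms
      unfolding independent_invariant_columns_def independent_invariant_columns_axioms_def
      by auto
    then show ?thesis by blast
  qed
  show ?thesis
    unfolding asymptotically_free_def
  proof (intro conjI ballI impI)
    show "converges_in_distribution A \<Omega> (I \<union> J) joint"
      unfolding converges_in_distribution_def
    proof (intro ballI)
      fix ts p assume ts: "ts \<in> lists (I \<union> J)" and p: "p \<in> parts A (length ts)"
      obtain k1 k2 \<alpha> \<beta> ks js where
        "independent_invariant_columns A \<Omega> I J M L (length ts) k1 k2 \<alpha> \<beta> ks js ts"
        using columns[OF ts] by blast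
      then interpret independent_invariant_columns A \<Omega> I J M L "length ts" k1 k2 \<alpha> \<beta> ks js ts .
      show "convergent (moment_seq \<Omega> joint p ts)"
        using moment_joint_tendsto[OF p] by (rule convergentI)
    qed
  next
    fix ts p
    assume ts: "ts \<in> lists (I \<union> J)" and p: "p \<in> parts A (length ts)"
      and mixed: "\<exists>c\<in>cycles_of (length ts) p. \<exists>s<length ts. \<exists>t<length ts.
        Top s \<in> c \<and> Top t \<in> c \<and> ts ! s \<in> I \<and> ts ! t \<in> J"
    obtain k1 k2 \<alpha> \<beta> ks js where
      "independent_invariant_columns A \<Omega> I J M L (length ts) k1 k2 \<alpha> \<beta> ks js ts"
      using columns[OF ts] by blast
    then interpret independent_invariant_columns A \<Omega> I J M L "length ts" k1 k2 \<alpha> \<beta> ks js ts .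
    show "cumulant A \<Omega> joint p ts = 0" using mixed cumulant_joint_mixed by blast
  next
    fix ks js p1 p2
    assume ks: "ks \<in> lists I" and js: "js \<in> lists J"
      and p: "p1 \<in> parts A (length ks)" "p2 \<in> parts A (length js)"
    \<comment> \<open>For a concatenated word the splitting is fixed as consecutive columns instead
      of being obtained from a permutation, so that \<open>glue\<close> coincides with
      \<open>ptensor\<close>.\<close>
    interpret column_split "length ks + length js" "length ks" "length js" id "(+) (length ks)"
      by (rule column_split_append)
    interpret independent_invariant_columns A \<Omega> I J M L "length ks + length js" "length ks" "length js"
      id "(+) (length ks)" ks js "ks @ js"
      by unfold_locales (use ks js in \<open>auto simp: nth_append\<close>)
    show "cumulant A \<Omega> joint (ptensor (length ks) p1 p2) (ks @ js) =
        cumulant A \<Omega> M p1 ks * cumulant A \<Omega> L p2 js"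
      unfolding ptensor_glue by (rule cumulant_joint_glue[OF p])
  qed
qed

end
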